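(* Consider a theory of measuring apparatuses (a class of apparatuses for quantum systems) in which every observable of every system is precisely measured by at least one apparatus, and which satisfies the mixing law, so that every apparatus has an operational distribution. If the extendability postulate holds, then the operational distribution of every apparatus is a CP instrument.
   Context: Systems are described by separable complex Hilbert spaces; states are density operators; observables are self-adjoint operators, with spectral measures $E^{B}$. An apparatus $\mathbf{A}(\mathbf{x})$ with real output variable $\mathbf{x}$, measuring a system with Hilbert space $\mathcal{H}$, assigns to each state $\rho$ a probability measure $\Delta\mapsto\Pr\{\mathbf{x}\in\Delta\|\rho\}$ on the Borel sets of $\mathbb{R}$, and to each $\rho$ and each $\Delta$ with $\Pr\{\mathbf{x}\in\Delta\|\rho\}>0$ a state $\rho_{\{\mathbf{x}\in\Delta\}}$ (the output state; it is arbitrary when the probability is $0$). It precisely measures $B$ if $\Pr\{\mathbf{x}\in\Delta\|\rho\}=\mathrm{Tr}[E^{B}(\Delta)\rho]$ for all $\Delta,\rho$. If $\mathbf{A}(\mathbf{x})$ is immediately followed by $\mathbf{A}(\mathbf{y})$ on the same system, the joint output probability distribution is $\Pr\{\mathbf{x}\in\Delta,\mathbf{y}\in\Delta'\|\rho\}=\Pr\{\mathbf{y}\in\Delta'\|\rho_{\{\mathbf{x}\in\Delta\}}\}\Pr\{\mathbf{x}\in\Delta\|\rho\}$, assumed to be a (countably additive) joint probability distribution. Mixing law: for any two apparatuses $\mathbf{A}(\mathbf{x}),\mathbf{A}(\mathbf{y})$ for the same system and any Borel sets $\Delta,\Delta'$, the function $\rho\mapsto\Pr\{\mathbf{x}\in\Delta,\mathbf{y}\in\Delta'\|\rho\}$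 is affine on density operators. A DL instrument on $\mathcal{H}$ is a map $\mathcal{I}$ from Borel sets of $\mathbb{R}$ to positive bounded linear maps on the trace-class operators $\tau c(\mathcal{H})$, countably additive in the strong sense (trace-norm convergence of $\sum_j\mathcal{I}(\Delta_j)\rho$), with $\mathcal{I}(\mathbb{R})$ trace-preserving. Under the mixing law, each apparatus has a unique DL instrument $\mathcal{I}$ with $\mathcal{I}(\Delta)\rho=\Pr\{\mathbf{x}\in\Delta\|\rho\}\,\rho_{\{\mathbf{x}\in\Delta\}}$ for all $\Delta$ and density operators $\rho$; this $\mathcal{I}$ is called the operational distribution of the apparatus. A CP instrument is a DL instrument with every $\mathcal{I}(\Delta)$ completely positive, i.e. $\mathcal{I}(\Delta)\otimes\mathrm{id}_n$ is positive on $\tau c(\mathcal{H}\otimes\mathbb{C}^n)$ for all $n$. Extendability postulate: for any apparatus $\mathbf{A}(\mathbf{x})$ measuring a system $\mathbf{S}$ with Hilbert space $\mathcal{H}$ and any other quantum system $\mathbf{S}'$ with Hilbert space $\mathcal{H}'$ not interacting with $\mathbf{A}(\mathbf{x})$ or $\mathbf{S}$ (such systems exist for every $\mathcal{H}'$, e.g. $\mathbb{C}^n$), there is an apparatus $\mathbf{A}(\mathbf{x}')$ measuring $\mathbf{S}+\mathbf{S}'$ (Hilbert space $\mathcal{H}\otimes\mathcal{H}'$) with $\Pr\{\mathbf{x}'\in\Delta\|\rho\otimes\rho'\}=\Pr\{\mathbf{x}\in\Delta\|\rho\}$ and $(\rho\otimes\rho')_{\{\mathbf{x}'\in\Delta\}}=\rho_{\{\mathbf{x}\in\Delta\}}\otimes\rho'$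 for all Borel $\Delta$ and all states $\rho$ of $\mathbf{S}$, $\rho'$ of $\mathbf{S}'$. *)

theory Defs
  imports "HOL-Probability.Probability" "HOL-Library.Function_Algebras"
begin

section \<open>Complex vector spaces\<close>

class scaleC =
  fixes scaleC :: "complex \<Rightarrow> 'a \<Rightarrow> 'a"  (infixr "*\<^sub>C" 75)

class complex_vector = scaleC + ab_group_add +
  assumes scaleC_add_right: "a *\<^sub>C (x + y) = a *\<^sub>C x + a *\<^sub>C y"
    and scaleC_add_left: "(a + b) *\<^sub>C x = a *\<^sub>C x + b *\<^sub>C x"
    and scaleC_scaleC: "a *\<^sub>C b *\<^sub>C x = (a * b) *\<^sub>C x"
    and scaleC_one: "1 *\<^sub>C x = x"

global_interpretation complex_vector: vector_space "scaleC :: complex \<Rightarrow> 'a \<Rightarrow> 'a::complex_vector"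
  by unfold_locales
    (simp_all add: scaleC_add_right scaleC_add_left scaleC_scaleC scaleC_one)

instantiation complex :: complex_vector
begin
definition "scaleC_complex = ((*) :: complex \<Rightarrow> complex \<Rightarrow> complex)"
instance
  by standard (simp_all add: scaleC_complex_def algebra_simps)
end

instantiation "fun" :: (type, complex_vector) complex_vector
begin
definition "scaleC_fun a f = (\<lambda>x. a *\<^sub>C f x)"
instance
  by standard
    (simp_all add: scaleC_fun_def fun_eq_iff scaleC_add_right scaleC_add_left scaleC_scaleC scaleC_one)
end

section \<open>Separable Hilbert spaces\<close>

text \<open>A Hilbert space is a linear subspace of an ambient complex vector space, with an inner
  product of its own, so that one type carries many different Hilbert spaces.  Inner products are
  antilinear in the first argument.\<close>

record 'v hspace =
  hcarrier :: "'v set"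
  hinner :: "'v \<Rightarrow> 'v \<Rightarrow> complex"

definition hnorm :: "('v, 'z) hspace_scheme \<Rightarrow> 'v \<Rightarrow> real" where
  "hnorm H x = sqrt (Re (hinner H x x))"

definition dense_in :: "'v::complex_vector hspace \<Rightarrow> 'v set \<Rightarrow> bool" where
  "dense_in H X \<longleftrightarrow> X \<subseteq> hcarrier H \<and>
     (\<forall>x\<in>hcarrier H. \<forall>\<epsilon>>0. \<exists>y\<in>X. hnorm H (x - y) < \<epsilon>)"

locale inner_product_space =
  fixes H :: "'v::complex_vector hspace"
  assumes subspace: "complex_vector.subspace (hcarrier H)"
    and inner_commute: "\<lbrakk>x \<in> hcarrier H; y \<in> hcarrier H\<rbrakk> \<Longrightarrow> hinner H x y = cnj (hinner H y x)"
    and inner_add_right: "\<lbrakk>x \<in> hcarrier H; y \<in> hcarrier H; z \<in> hcarrier H\<rbrakk> \<Longrightarrow>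
      hinner H x (y + z) = hinner H x y + hinner H x z"
    and inner_scale_right: "\<lbrakk>x \<in> hcarrier H; y \<in> hcarrier H\<rbrakk> \<Longrightarrow>
      hinner H x (c *\<^sub>C y) = c * hinner H x y"
    and inner_nonneg: "x \<in> hcarrier H \<Longrightarrow> Re (hinner H x x) \<ge> 0"
    and inner_eq_zero: "\<lbrakk>x \<in> hcarrier H; hinner H x x = 0\<rbrakk> \<Longrightarrow> x = 0"

locale separable_hilbert_space = inner_product_space +
  assumes complete: "\<lbrakk>\<And>n. X n \<in> hcarrier H;
      \<And>\<epsilon>. \<epsilon> > 0 \<Longrightarrow> \<exists>N. \<forall>m\<ge>N. \<forall>n\<ge>N. hnorm H (X m - X n) < \<epsilon>\<rbrakk> \<Longrightarrow>
      \<exists>l\<in>hcarrier H. (\<lambda>n::nat. hnorm H (X n - l)) \<longlonglongrightarrow> 0"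
    and separable: "\<exists>X. countable X \<and> dense_in H X"

definition orthonormal_basis :: "'v::complex_vector hspace \<Rightarrow> 'v set \<Rightarrow> bool" where
  "orthonormal_basis H B \<longleftrightarrow> B \<subseteq> hcarrier H \<and>
     (\<forall>e\<in>B. \<forall>f\<in>B. hinner H e f = (if e = f then 1 else 0)) \<and>
     dense_in H (complex_vector.span B)"

definition unitarily_equivalent ::
  "'v::complex_vector hspace \<Rightarrow> 'w::complex_vector hspace \<Rightarrow> bool" where
  "unitarily_equivalent H K \<longleftrightarrow> (\<exists>U. bij_betw U (hcarrier H) (hcarrier K) \<and>
     (\<forall>x\<in>hcarrier H. \<forall>y\<in>hcarrier H. U (x + y) = U x + U y) \<and>
     (\<forall>x\<in>hcarrier H. \<forall>c. U (c *\<^sub>C x) = c *\<^sub>C U x) \<and>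
     (\<forall>x\<in>hcarrier H. \<forall>y\<in>hcarrier H. hinner K (U x) (U y) = hinner H x y))"

section \<open>Bounded and trace-class operators\<close>

text \<open>Operators on \<open>H\<close> are represented by functions that vanish outside the carrier; with this
  convention sums, scalar multiples and composites of operators are those of functions, and
  operators that agree on the carrier are equal.\<close>

definition bounded_ops :: "'v::complex_vector hspace \<Rightarrow> ('v \<Rightarrow> 'v) set" where
  "bounded_ops H = {T. (\<forall>x. x \<notin> hcarrier H \<longrightarrow> T x = 0) \<and>
     (\<forall>x\<in>hcarrier H. T x \<in> hcarrier H) \<and>
     (\<forall>x\<in>hcarrier H. \<forall>y\<in>hcarrier H. T (x + y) = T x + T y) \<and>
     (\<forall>x\<in>hcarrier H. \<forall>c. T (c *\<^sub>C x) = c *\<^sub>C T x) \<and>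
     (\<exists>C. \<forall>x\<in>hcarrier H. hnorm H (T x) \<le> C * hnorm H x)}"

definition positive_op :: "'v::complex_vector hspace \<Rightarrow> ('v \<Rightarrow> 'v) \<Rightarrow> bool" where
  "positive_op H T \<longleftrightarrow> T \<in> bounded_ops H \<and>
     (\<forall>x\<in>hcarrier H. Im (hinner H x (T x)) = 0 \<and> Re (hinner H x (T x)) \<ge> 0)"

text \<open>The absolute value of \<open>T\<close>: the positive operator \<open>P\<close> with \<open>P\<close> squared equal to the adjoint
  of \<open>T\<close> composed with \<open>T\<close>.\<close>

definition abs_op :: "'v::complex_vector hspace \<Rightarrow> ('v \<Rightarrow> 'v) \<Rightarrow> 'v \<Rightarrow> 'v" where
  "abs_op H T = (THE P. positive_op H P \<and>
     (\<forall>x\<in>hcarrier H. \<forall>y\<in>hcarrier H. hinner H x (P (P y)) = hinner H (T x) (T y)))"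

definition op_trace :: "'v::complex_vector hspace \<Rightarrow> ('v \<Rightarrow> 'v) \<Rightarrow> complex" where
  "op_trace H T = (\<Sum>\<^sub>\<infinity>e\<in>(SOME B. orthonormal_basis H B). hinner H e (T e))"

definition trace_class :: "'v::complex_vector hspace \<Rightarrow> ('v \<Rightarrow> 'v) set" where
  "trace_class H = {T \<in> bounded_ops H. \<forall>B. orthonormal_basis H B \<longrightarrow>
     (\<lambda>e. hinner H e (abs_op H T e)) summable_on B}"

definition trace_norm :: "'v::complex_vector hspace \<Rightarrow> ('v \<Rightarrow> 'v) \<Rightarrow> real" where
  "trace_norm H T = Re (op_trace H (abs_op H T))"

definition density_ops :: "'v::complex_vector hspace \<Rightarrow> ('v \<Rightarrow> 'v) set" where
  "density_ops H = {\<rho> \<in> trace_class H. positive_op H \<rho> \<and> op_trace H \<rho> = 1}"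

section \<open>Observables\<close>

text \<open>\<open>B\<close> is a possibly unbounded operator with domain \<open>D\<close>; the last clause says that the domain
  of the adjoint is \<open>D\<close>.\<close>

definition self_adjoint :: "'v::complex_vector hspace \<Rightarrow> 'v set \<Rightarrow> ('v \<Rightarrow> 'v) \<Rightarrow> bool" where
  "self_adjoint H D B \<longleftrightarrow> complex_vector.subspace D \<and> dense_in H D \<and>
     (\<forall>x\<in>D. B x \<in> hcarrier H) \<and>
     (\<forall>x\<in>D. \<forall>y\<in>D. B (x + y) = B x + B y) \<and>
     (\<forall>x\<in>D. \<forall>c. B (c *\<^sub>C x) = c *\<^sub>C B x) \<and>
     (\<forall>x\<in>D. \<forall>y\<in>D. hinner H (B x) y = hinner H x (B y)) \<and>
     {y \<in> hcarrier H. \<exists>z\<in>hcarrier H. \<forall>x\<in>D. hinner H (B x) y = hinner H x z} = D"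

definition projection_valued_measure ::
  "'v::complex_vector hspace \<Rightarrow> (real set \<Rightarrow> 'v \<Rightarrow> 'v) \<Rightarrow> bool" where
  "projection_valued_measure H E \<longleftrightarrow>
     (\<forall>\<Delta>\<in>sets borel. E \<Delta> \<in> bounded_ops H \<and> E \<Delta> \<circ> E \<Delta> = E \<Delta> \<and>
        (\<forall>x\<in>hcarrier H. \<forall>y\<in>hcarrier H. hinner H (E \<Delta> x) y = hinner H x (E \<Delta> y))) \<and>
     (\<forall>x\<in>hcarrier H. E UNIV x = x) \<and>
     (\<forall>\<Delta>. range \<Delta> \<subseteq> sets borel \<longrightarrow> disjoint_family \<Delta> \<longrightarrow>
        (\<forall>x\<in>hcarrier H. (\<lambda>n::nat. hnorm H (E (\<Union>j. \<Delta> j) x - (\<Sum>j<n. E (\<Delta> j) x))) \<longlonglongrightarrow> 0))"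

definition vector_measure ::
  "'v hspace \<Rightarrow> (real set \<Rightarrow> 'v \<Rightarrow> 'v) \<Rightarrow> 'v \<Rightarrow> real measure" where
  "vector_measure H E x =
     measure_of UNIV (sets borel) (\<lambda>\<Delta>. ennreal (Re (hinner H x (E \<Delta> x))))"

text \<open>By polarization, the last two clauses below determine \<open>D\<close> and \<open>B\<close> from \<open>E\<close>.\<close>

definition spectral_measure ::
  "'v::complex_vector hspace \<Rightarrow> 'v set \<Rightarrow> ('v \<Rightarrow> 'v) \<Rightarrow> (real set \<Rightarrow> 'v \<Rightarrow> 'v) \<Rightarrow> bool" where
  "spectral_measure H D B E \<longleftrightarrow> projection_valued_measure H E \<and>
     D = {x \<in> hcarrier H. integrable (vector_measure H E x) (\<lambda>t. t\<^sup>2)} \<and>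
     (\<forall>x\<in>D. hinner H x (B x) = complex_of_real (\<integral>t. t \<partial>vector_measure H E x))"

section \<open>Tensor products\<close>

definition tensor_product :: "'u::complex_vector hspace \<Rightarrow> 'v::complex_vector hspace \<Rightarrow>
    'w::complex_vector hspace \<Rightarrow> ('u \<Rightarrow> 'v \<Rightarrow> 'w) \<Rightarrow> bool" where
  "tensor_product H H' K t \<longleftrightarrow>
     (\<forall>x\<in>hcarrier H. \<forall>y\<in>hcarrier H'. t x y \<in> hcarrier K) \<and>
     (\<forall>x\<in>hcarrier H. \<forall>x'\<in>hcarrier H. \<forall>y\<in>hcarrier H'. t (x + x') y = t x y + t x' y) \<and>
     (\<forall>x\<in>hcarrier H. \<forall>y\<in>hcarrier H'. \<forall>y'\<in>hcarrier H'. t x (y + y') = t x y + t x y') \<and>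
     (\<forall>x\<in>hcarrier H. \<forall>y\<in>hcarrier H'. \<forall>c.
        t (c *\<^sub>C x) y = c *\<^sub>C t x y \<and> t x (c *\<^sub>C y) = c *\<^sub>C t x y) \<and>
     (\<forall>x\<in>hcarrier H. \<forall>x'\<in>hcarrier H. \<forall>y\<in>hcarrier H'. \<forall>y'\<in>hcarrier H'.
        hinner K (t x y) (t x' y') = hinner H x x' * hinner H' y y') \<and>
     dense_in K (complex_vector.span {t x y | x y. x \<in> hcarrier H \<and> y \<in> hcarrier H'})"

definition tensor_op :: "'u::complex_vector hspace \<Rightarrow> 'v::complex_vector hspace \<Rightarrow>
    'w::complex_vector hspace \<Rightarrow> ('u \<Rightarrow> 'v \<Rightarrow> 'w) \<Rightarrow> ('u \<Rightarrow> 'u) \<Rightarrow> ('v \<Rightarrow> 'v) \<Rightarrow> 'w \<Rightarrow> 'w" where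
  "tensor_op H H' K t S T = (THE R. R \<in> bounded_ops K \<and>
     (\<forall>x\<in>hcarrier H. \<forall>y\<in>hcarrier H'. R (t x y) = t (S x) (T y)))"

definition Cn :: "nat \<Rightarrow> (nat \<Rightarrow> complex) hspace" where
  "Cn n = \<lparr>hcarrier = {c. \<forall>i\<ge>n. c i = 0}, hinner = (\<lambda>c d. \<Sum>i<n. cnj (c i) * d i)\<rparr>"

text \<open>The tensor product of \<open>H\<close> with \<open>Cn n\<close>, realized as the space of \<open>n\<close>-tuples of vectors
  of \<open>H\<close>.\<close>

definition tensor_Cn :: "'v::complex_vector hspace \<Rightarrow> nat \<Rightarrow> (nat \<Rightarrow> 'v) hspace" where
  "tensor_Cn H n = \<lparr>hcarrier = {x. (\<forall>i<n. x i \<in> hcarrier H) \<and> (\<forall>i\<ge>n. x i = 0)},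
     hinner = (\<lambda>x y. \<Sum>i<n. hinner H (x i) (y i))\<rparr>"

definition tens_Cn :: "'v::complex_vector \<Rightarrow> (nat \<Rightarrow> complex) \<Rightarrow> nat \<Rightarrow> 'v" where
  "tens_Cn x c = (\<lambda>i. c i *\<^sub>C x)"

lemma (in inner_product_space) tensor_product_tensor_Cn:
  "tensor_product H (Cn n) (tensor_Cn H n) tens_Cn"
proof -
  have zero: "0 \<in> hcarrier H" and scale: "x \<in> hcarrier H \<Longrightarrow> c *\<^sub>C x \<in> hcarrier H" for x c
    using subspace by (auto simp: complex_vector.subspace_def)
  have inner_scale_left: "hinner H (c *\<^sub>C x) y = cnj c * hinner H x y"
    if "x \<in> hcarrier H" "y \<in> hcarrier H" for x y c
    using inner_commute[OF scale[OF that(1)] that(2)] inner_commute[OF that]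
      inner_scale_right[OF that(2,1)] by simp
  have inner_zero: "hinner H 0 0 = 0"
    using inner_scale_right[OF zero zero, of 0] by simp
  let ?G = "{tens_Cn x c | x c. x \<in> hcarrier H \<and> c \<in> hcarrier (Cn n)}"
  have sub: "complex_vector.subspace (hcarrier (tensor_Cn H n))"
    using subspace
    by (auto simp: complex_vector.subspace_def tensor_Cn_def scaleC_fun_def)
  have gen: "?G \<subseteq> hcarrier (tensor_Cn H n)"
    using scale by (auto simp: tens_Cn_def Cn_def tensor_Cn_def)
  have span: "z \<in> complex_vector.span ?G" if z: "z \<in> hcarrier (tensor_Cn H n)" for z
  proof -
    have "z = (\<Sum>i<n. tens_Cn (z i) (\<lambda>j. if j = i then 1 else 0))"
    proof
      fix k
      have "(\<Sum>i<m. tens_Cn (z i) (\<lambda>j. if j = i then 1 else 0)) k = (if k < m then z k else 0)" for m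
        by (induction m) (auto simp: tens_Cn_def scaleC_one less_Suc_eq)
      then show "z k = (\<Sum>i<n. tens_Cn (z i) (\<lambda>j. if j = i then 1 else 0)) k"
        using z by (auto simp: tensor_Cn_def)
    qed
    moreover have "tens_Cn (z i) (\<lambda>j. if j = i then 1 else 0) \<in> ?G" if "i < n" for i
    proof -
      have "(\<lambda>j. if j = i then 1 else 0) \<in> hcarrier (Cn n)"
        using that by (auto simp: Cn_def)
      moreover have "z i \<in> hcarrier H" using z that by (auto simp: tensor_Cn_def)
      ultimately show ?thesis by blast
    qed
    ultimately show ?thesis
      using complex_vector.span_sum[of "{..<n}" "\<lambda>i. tens_Cn (z i) (\<lambda>j. if j = i then 1 else 0)" ?G]
        complex_vector.span_base[of _ ?G] by simp
  qed
  have dense_span: "dense_in (tensor_Cn H n) (complex_vector.span ?G)"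
    unfolding dense_in_def
  proof (intro conjI ballI allI impI)
    show "complex_vector.span ?G \<subseteq> hcarrier (tensor_Cn H n)"
      by (rule complex_vector.span_minimal[OF gen sub])
    fix z and \<epsilon> :: real assume z: "z \<in> hcarrier (tensor_Cn H n)" "\<epsilon> > 0"
    have "hnorm (tensor_Cn H n) (z - z) = 0"
      by (simp add: hnorm_def tensor_Cn_def inner_zero)
    then show "\<exists>y\<in>complex_vector.span ?G. hnorm (tensor_Cn H n) (z - y) < \<epsilon>"
      using span[OF z(1)] z(2) by (intro bexI[of _ z]) simp_all
  qed
  have inner: "hinner (tensor_Cn H n) (tens_Cn x c) (tens_Cn y d) = hinner H x y * hinner (Cn n) c d"
    if xy: "x \<in> hcarrier H" "y \<in> hcarrier H" for x y c d
  proof -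
    have "hinner H (a *\<^sub>C x) (b *\<^sub>C y) = hinner H x y * (cnj a * b)" for a b
      by (simp add: inner_scale_left[OF xy(1) scale[OF xy(2)]] inner_scale_right[OF xy])
    then show ?thesis
      by (simp add: tensor_Cn_def tens_Cn_def Cn_def sum_distrib_left)
  qed
  have add_left: "tens_Cn (x + y) c = tens_Cn x c + tens_Cn y c" for x y :: 'v and c
    by (simp add: tens_Cn_def fun_eq_iff scaleC_add_right)
  have add_right: "tens_Cn x (c + d) = tens_Cn x c + tens_Cn x d" for x :: 'v and c d
    by (simp add: tens_Cn_def fun_eq_iff scaleC_add_left)
  have scale_left: "tens_Cn (a *\<^sub>C x) c = a *\<^sub>C tens_Cn x c" for x :: 'v and a c
    by (simp add: tens_Cn_def fun_eq_iff scaleC_fun_def scaleC_scaleC mult.commute[of a])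
  have scale_right: "tens_Cn x (a *\<^sub>C c) = a *\<^sub>C tens_Cn x c" for x :: 'v and a c
    by (simp add: tens_Cn_def fun_eq_iff scaleC_fun_def scaleC_scaleC scaleC_complex_def)
  show ?thesis
    unfolding tensor_product_def
  proof (intro conjI ballI allI)
    show "tens_Cn x c \<in> hcarrier (tensor_Cn H n)"
      if "x \<in> hcarrier H" "c \<in> hcarrier (Cn n)" for x c
      using gen that by blast
  qed (assumption | rule dense_span add_left add_right scale_left scale_right inner)+
qed

section \<open>Instruments\<close>

definition linear_on_trace_class ::
  "'v::complex_vector hspace \<Rightarrow> (('v \<Rightarrow> 'v) \<Rightarrow> ('v \<Rightarrow> 'v)) \<Rightarrow> bool" where
  "linear_on_trace_class H \<Phi> \<longleftrightarrow>
     (\<forall>T\<in>trace_class H. \<Phi> T \<in> trace_class H) \<and>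
     (\<forall>S\<in>trace_class H. \<forall>T\<in>trace_class H. \<Phi> (S + T) = \<Phi> S + \<Phi> T) \<and>
     (\<forall>T\<in>trace_class H. \<forall>c. \<Phi> (c *\<^sub>C T) = c *\<^sub>C \<Phi> T)"

definition positive_on_trace_class ::
  "'v::complex_vector hspace \<Rightarrow> (('v \<Rightarrow> 'v) \<Rightarrow> ('v \<Rightarrow> 'v)) \<Rightarrow> bool" where
  "positive_on_trace_class H \<Phi> \<longleftrightarrow>
     (\<forall>T\<in>trace_class H. positive_op H T \<longrightarrow> positive_op H (\<Phi> T))"

text \<open>The first clause fixes the values of an instrument outside its domain, so that instruments
  which agree on all Borel sets and trace-class operators are equal.\<close>

definition DL_instrument ::
  "'v::complex_vector hspace \<Rightarrow> (real set \<Rightarrow> ('v \<Rightarrow> 'v) \<Rightarrow> ('v \<Rightarrow> 'v)) \<Rightarrow> bool" where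
  "DL_instrument H \<I> \<longleftrightarrow>
     (\<forall>\<Delta> T. \<Delta> \<notin> sets borel \<or> T \<notin> trace_class H \<longrightarrow> \<I> \<Delta> T = 0) \<and>
     (\<forall>\<Delta>\<in>sets borel. linear_on_trace_class H (\<I> \<Delta>) \<and> positive_on_trace_class H (\<I> \<Delta>) \<and>
        (\<exists>C. \<forall>T\<in>trace_class H. trace_norm H (\<I> \<Delta> T) \<le> C * trace_norm H T)) \<and>
     (\<forall>\<Delta>. range \<Delta> \<subseteq> sets borel \<longrightarrow> disjoint_family \<Delta> \<longrightarrow>
        (\<forall>T\<in>trace_class H.
          (\<lambda>n::nat. trace_norm H (\<I> (\<Union>j. \<Delta> j) T - (\<Sum>j<n. \<I> (\<Delta> j) T))) \<longlonglongrightarrow> 0)) \<and>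
     (\<forall>T\<in>trace_class H. op_trace H (\<I> UNIV T) = op_trace H T)"

definition tensor_id_Cn :: "'v::complex_vector hspace \<Rightarrow> nat \<Rightarrow>
    (('v \<Rightarrow> 'v) \<Rightarrow> ('v \<Rightarrow> 'v)) \<Rightarrow> (((nat \<Rightarrow> 'v) \<Rightarrow> (nat \<Rightarrow> 'v)) \<Rightarrow> ((nat \<Rightarrow> 'v) \<Rightarrow> (nat \<Rightarrow> 'v))) \<Rightarrow> bool" where
  "tensor_id_Cn H n \<Phi> \<Psi> \<longleftrightarrow> linear_on_trace_class (tensor_Cn H n) \<Psi> \<and>
     (\<forall>T\<in>trace_class H. \<forall>S\<in>trace_class (Cn n).
        \<Psi> (tensor_op H (Cn n) (tensor_Cn H n) tens_Cn T S) =
          tensor_op H (Cn n) (tensor_Cn H n) tens_Cn (\<Phi> T) S)"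

text \<open>The map \<open>\<Psi>\<close> below is unique on the trace class, as \<open>Cn n\<close> is finite-dimensional.\<close>

definition completely_positive ::
  "'v::complex_vector hspace \<Rightarrow> (('v \<Rightarrow> 'v) \<Rightarrow> ('v \<Rightarrow> 'v)) \<Rightarrow> bool" where
  "completely_positive H \<Phi> \<longleftrightarrow>
     (\<forall>n. \<exists>\<Psi>. tensor_id_Cn H n \<Phi> \<Psi> \<and> positive_on_trace_class (tensor_Cn H n) \<Psi>)"

definition CP_instrument ::
  "'v::complex_vector hspace \<Rightarrow> (real set \<Rightarrow> ('v \<Rightarrow> 'v) \<Rightarrow> ('v \<Rightarrow> 'v)) \<Rightarrow> bool" where
  "CP_instrument H \<I> \<longleftrightarrow> DL_instrument H \<I> \<and> (\<forall>\<Delta>\<in>sets borel. completely_positive H (\<I> \<Delta>))"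

section \<open>Theories of measuring apparatuses\<close>

text \<open>A theory has a type \<open>'s\<close> of quantum systems and a type \<open>'a\<close> of apparatuses.  Each apparatus
  measures one system \<open>system_of a\<close>.  The relation \<open>isolated a S'\<close> says that \<open>S'\<close> is another
  system which interacts neither with \<open>a\<close> nor with the system measured by \<open>a\<close>.\<close>

record ('s, 'a, 'v) apparatus_theory =
  hilb :: "'s \<Rightarrow> 'v hspace"
  system_of :: "'a \<Rightarrow> 's"
  out_distr :: "'a \<Rightarrow> ('v \<Rightarrow> 'v) \<Rightarrow> real measure"
  out_state :: "'a \<Rightarrow> ('v \<Rightarrow> 'v) \<Rightarrow> real set \<Rightarrow> ('v \<Rightarrow> 'v)"
  isolated :: "'a \<Rightarrow> 's \<Rightarrow> bool"
  compose :: "'s \<Rightarrow> 's \<Rightarrow> 's"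
  tens :: "'s \<Rightarrow> 's \<Rightarrow> 'v \<Rightarrow> 'v \<Rightarrow> 'v"

abbreviation space_of :: "('s, 'a, 'v) apparatus_theory \<Rightarrow> 'a \<Rightarrow> 'v hspace" where
  "space_of M a \<equiv> hilb M (system_of M a)"

definition out_prob ::
  "('s, 'a, 'v) apparatus_theory \<Rightarrow> 'a \<Rightarrow> ('v \<Rightarrow> 'v) \<Rightarrow> real set \<Rightarrow> real" where
  "out_prob M a \<rho> \<Delta> = measure (out_distr M a \<rho>) \<Delta>"

definition joint_prob ::
  "('s, 'a, 'v) apparatus_theory \<Rightarrow> 'a \<Rightarrow> 'a \<Rightarrow> ('v \<Rightarrow> 'v) \<Rightarrow> real set \<Rightarrow> real set \<Rightarrow> real" where
  "joint_prob M a b \<rho> \<Delta> \<Delta>' = out_prob M b (out_state M a \<rho> \<Delta>) \<Delta>' * out_prob M a \<rho> \<Delta>"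

locale measurement_theory =
  fixes M :: "('s, 'a, 'v::complex_vector) apparatus_theory"
  assumes hilb: "separable_hilbert_space (hilb M S)"
    and hilb_nonzero: "hcarrier (hilb M S) \<noteq> {0}"
    and out_distr: "\<rho> \<in> density_ops (space_of M a) \<Longrightarrow>
      prob_space (out_distr M a \<rho>) \<and> sets (out_distr M a \<rho>) = sets borel"
    and out_state: "\<lbrakk>\<rho> \<in> density_ops (space_of M a); \<Delta> \<in> sets borel; out_prob M a \<rho> \<Delta> > 0\<rbrakk> \<Longrightarrow>
      out_state M a \<rho> \<Delta> \<in> density_ops (space_of M a)"
    and joint_distr: "\<lbrakk>system_of M a = system_of M b; \<rho> \<in> density_ops (space_of M a)\<rbrakk> \<Longrightarrow>
      \<exists>J :: (real \<times> real) measure. prob_space J \<and> sets J = sets borel \<and>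
        (\<forall>\<Delta>\<in>sets borel. \<forall>\<Delta>'\<in>sets borel. measure J (\<Delta> \<times> \<Delta>') = joint_prob M a b \<rho> \<Delta> \<Delta>')"
    and composite: "isolated M a S' \<Longrightarrow>
      tensor_product (space_of M a) (hilb M S') (hilb M (compose M (system_of M a) S'))
        (tens M (system_of M a) S')"

definition precisely_measures :: "('s, 'a, 'v::complex_vector) apparatus_theory \<Rightarrow> 'a \<Rightarrow>
    'v set \<Rightarrow> ('v \<Rightarrow> 'v) \<Rightarrow> bool" where
  "precisely_measures M a D B \<longleftrightarrow> (\<forall>E. spectral_measure (space_of M a) D B E \<longrightarrow>
     (\<forall>\<rho>\<in>density_ops (space_of M a). \<forall>\<Delta>\<in>sets borel.
        complex_of_real (out_prob M a \<rho> \<Delta>) = op_trace (space_of M a) (E \<Delta> \<circ> \<rho>)))"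

definition observables_measurable :: "('s, 'a, 'v::complex_vector) apparatus_theory \<Rightarrow> bool" where
  "observables_measurable M \<longleftrightarrow> (\<forall>S D B. self_adjoint (hilb M S) D B \<longrightarrow>
     (\<exists>a. system_of M a = S \<and> precisely_measures M a D B))"

definition mixing_law :: "('s, 'a, 'v::complex_vector) apparatus_theory \<Rightarrow> bool" where
  "mixing_law M \<longleftrightarrow> (\<forall>a b. system_of M a = system_of M b \<longrightarrow>
     (\<forall>\<Delta>\<in>sets borel. \<forall>\<Delta>'\<in>sets borel.
      \<forall>\<rho>\<in>density_ops (space_of M a). \<forall>\<sigma>\<in>density_ops (space_of M a). \<forall>p\<in>{0..1}.
        joint_prob M a b (complex_of_real p *\<^sub>C \<rho> + complex_of_real (1 - p) *\<^sub>C \<sigma>) \<Delta> \<Delta>' =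
          p * joint_prob M a b \<rho> \<Delta> \<Delta>' + (1 - p) * joint_prob M a b \<sigma> \<Delta> \<Delta>'))"

definition operational_distribution :: "('s, 'a, 'v::complex_vector) apparatus_theory \<Rightarrow> 'a \<Rightarrow>
    (real set \<Rightarrow> ('v \<Rightarrow> 'v) \<Rightarrow> ('v \<Rightarrow> 'v)) \<Rightarrow> bool" where
  "operational_distribution M a \<I> \<longleftrightarrow> DL_instrument (space_of M a) \<I> \<and>
     (\<forall>\<Delta>\<in>sets borel. \<forall>\<rho>\<in>density_ops (space_of M a).
        \<I> \<Delta> \<rho> = complex_of_real (out_prob M a \<rho> \<Delta>) *\<^sub>C out_state M a \<rho> \<Delta>)"

text \<open>Every separable Hilbert space is unitarily equivalent to one carried by a space of complex
  sequences, so quantifying over those in \<open>isolated_systems_exist\<close> covers all of them, including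
  every \<open>Cn n\<close> with \<open>n\<close> positive.\<close>

definition isolated_systems_exist :: "('s, 'a, 'v::complex_vector) apparatus_theory \<Rightarrow> bool" where
  "isolated_systems_exist M \<longleftrightarrow> (\<forall>a. \<forall>H' :: (nat \<Rightarrow> complex) hspace.
     separable_hilbert_space H' \<and> hcarrier H' \<noteq> {0} \<longrightarrow>
     (\<exists>S'. isolated M a S' \<and> unitarily_equivalent (hilb M S') H'))"

abbreviation state_tensor :: "('s, 'a, 'v::complex_vector) apparatus_theory \<Rightarrow> 's \<Rightarrow> 's \<Rightarrow>
    ('v \<Rightarrow> 'v) \<Rightarrow> ('v \<Rightarrow> 'v) \<Rightarrow> ('v \<Rightarrow> 'v)" where
  "state_tensor M S S' \<equiv> tensor_op (hilb M S) (hilb M S') (hilb M (compose M S S')) (tens M S S')"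

text \<open>As output states are arbitrary for outcomes of probability zero, the condition on output
  states is imposed for outcomes of positive probability only.\<close>

definition extendability_postulate :: "('s, 'a, 'v::complex_vector) apparatus_theory \<Rightarrow> bool" where
  "extendability_postulate M \<longleftrightarrow> isolated_systems_exist M \<and>
     (\<forall>a S'. isolated M a S' \<longrightarrow>
       (\<exists>a'. system_of M a' = compose M (system_of M a) S' \<and>
         (\<forall>\<rho>\<in>density_ops (space_of M a). \<forall>\<rho>'\<in>density_ops (hilb M S'). \<forall>\<Delta>\<in>sets borel.
            out_prob M a' (state_tensor M (system_of M a) S' \<rho> \<rho>') \<Delta> = out_prob M a \<rho> \<Delta> \<and>
            (out_prob M a \<rho> \<Delta> > 0 \<longrightarrow>
               out_state M a' (state_tensor M (system_of M a) S' \<rho> \<rho>') \<Delta> =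
                 state_tensor M (system_of M a) S' (out_state M a \<rho> \<Delta>) \<rho>'))))"

end

(*
The mixing law makes rho |-> Pr{x in Delta | rho} rho_Delta affine on density operators: expectations
of the output state in a unit vector v are probabilities of a subsequent measurement of the projection
onto v.  An affine map on density operators extends to a linear map on the trace class, since every
trace-class operator is a combination of four positive ones (from the polar decomposition and
polarization).  Countable additivity in trace norm reduces to that of the output probabilities, as the
trace norm of a positive operator is its trace.

For complete positivity, adjoin an isolated system with Hilbert space C^n.  The operational
distribution of the extended apparatus is positive and maps rho (x) sigma to I(Delta) rho (x) sigma,
hence it is I(Delta) (x) id up to a unitary.
*)

theory Submission
  imports Defs
begin

section \<open>Hilbert spaces\<close>

text \<open>The extendability postulate prescribes the extended apparatus on product states only,
  whereas complete positivity concerns entangled ones. The gap is closed by the mixing law for the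
  apparatuses of the composite system: it gives the extended apparatus an operational distribution
  of its own, linear and positive on the whole trace class of the composite. Linearity in each
  factor then carries the product formula from states to all product operators. So existence of the
  operational distribution has to be available for every apparatus, not just the given one.

  Two features of the data shape the construction. Output states of probability zero are arbitrary,
  so one works with the unnormalized \<open>raw_output\<close>, where they are multiplied by 0. And
  the output state depends on the outcome set, so additivity in that set does not follow from the
  output distribution; it comes from the joint distribution with a later measurement of a rank-one
  projection. For the latter, such projections must be shown to be observables and their spectral
  measures computed.\<close>

lemma norm_sq_le_if_quadratic_nonneg:
  fixes b :: complex
  assumes q: "\<And>l. 0 \<le> a + 2 * Re (l * b) + (cmod l)\<^sup>2 * c" and c: "0 \<le> c"
  shows "(cmod b)\<^sup>2 \<le> a * c"
proof (cases "c = 0")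
  case True
  have "b = 0"
  proof (rule ccontr)
    assume "b \<noteq> 0"
    then have b: "(cmod b)\<^sup>2 > 0" by simp
    \<comment> \<open>With \<open>c = 0\<close> the hypothesis is affine along
      \<open>l = - t * cnj b\<close>; this \<open>t\<close> makes its right-hand side equal to
      \<open>-1\<close>.\<close>
    define t where "t = (a + 1) / (2 * (cmod b)\<^sup>2)"
    have "Re ((- (of_real t * cnj b)) * b) = - t * (cmod b)\<^sup>2"
      unfolding cmod_power2 by (simp add: power2_eq_square algebra_simps)
    then have "0 \<le> a - 2 * t * (cmod b)\<^sup>2"
      using q[of "- (of_real t * cnj b)"] True by simp
    then show False using b by (simp add: t_def field_simps)
  qed
  then show ?thesis using True by simp
next
  case False
  then have c: "c > 0" using c by simp
  \<comment> \<open>The minimizer of the quadratic, found by completing the square; the minimum is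
    \<open>a - (cmod b)\<^sup>2 / c\<close>.\<close>
  let ?l = "- (cnj b / of_real c)"
  have "?l * b = of_real (- ((cmod b)\<^sup>2 / c))"
    using complex_norm_square[of b] by (simp add: mult.commute)
  then have "Re (?l * b) = - ((cmod b)\<^sup>2 / c)" by (metis Re_complex_of_real)
  moreover have "(cmod ?l)\<^sup>2 * c = (cmod b)\<^sup>2 / c"
    using c by (simp add: norm_divide power2_eq_square field_simps)
  ultimately have "0 \<le> a - (cmod b)\<^sup>2 / c" using q[of ?l] by linarith
  then show ?thesis using c by (simp add: field_simps)
qed

lemma scaleC_fun_apply [simp]: "(c *\<^sub>C f) x = c *\<^sub>C f x"
  by (simp add: scaleC_fun_def)

lemma sum_fun_apply: "(\<Sum>i\<in>I. f i) x = (\<Sum>i\<in>I. (f i x :: 'b::comm_monoid_add))"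
  by (induction I rule: infinite_finite_induct) auto

lemma sum_lessThan_4: "(\<Sum>k<4. f k) = (f 0 + f 1 + f 2 + f (3::nat) :: 'b::comm_monoid_add)"
  by (simp add: numeral_eq_Suc add_ac)

lemma i_combination:
  "(\<Sum>k<4. \<i> ^ k *\<^sub>C f k) = f 0 + \<i> *\<^sub>C f 1 - f 2 - \<i> *\<^sub>C (f 3 :: 'b::complex_vector)"
  by (simp add: sum_lessThan_4 power3_eq_cube scaleC_one)

context inner_product_space
begin

abbreviation inner ("\<langle>_, _\<rangle>") where "\<langle>x, y\<rangle> \<equiv> hinner H x y"
abbreviation vnorm ("\<parallel>_\<parallel>") where "\<parallel>x\<parallel> \<equiv> hnorm H x"

lemma zero_mem [simp]: "0 \<in> hcarrier H"
  and add_mem [simp]: "x \<in> hcarrier H \<Longrightarrow> y \<in> hcarrier H \<Longrightarrow> x + y \<in> hcarrier H"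
  and scale_mem [simp]: "x \<in> hcarrier H \<Longrightarrow> c *\<^sub>C x \<in> hcarrier H"
  using subspace by (auto simp: complex_vector.subspace_def)

lemma diff_mem [simp]: "x \<in> hcarrier H \<Longrightarrow> y \<in> hcarrier H \<Longrightarrow> x - y \<in> hcarrier H"
  using subspace by (rule complex_vector.subspace_diff)

lemma uminus_mem [simp]: "x \<in> hcarrier H \<Longrightarrow> - x \<in> hcarrier H"
  using subspace by (rule complex_vector.subspace_neg)

lemma sum_mem: "(\<And>i. i \<in> I \<Longrightarrow> f i \<in> hcarrier H) \<Longrightarrow> (\<Sum>i\<in>I. f i) \<in> hcarrier H"
  using subspace by (rule complex_vector.subspace_sum)

lemma inner_add_left: "\<lbrakk>x \<in> hcarrier H; y \<in> hcarrier H; z \<in> hcarrier H\<rbrakk> \<Longrightarrow>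
    \<langle>x + y, z\<rangle> = \<langle>x, z\<rangle> + \<langle>y, z\<rangle>"
  using inner_commute[of "x + y" z] inner_commute[of x z] inner_commute[of y z]
  by (simp add: inner_add_right)

lemma inner_scale_left: "\<lbrakk>x \<in> hcarrier H; y \<in> hcarrier H\<rbrakk> \<Longrightarrow> \<langle>c *\<^sub>C x, y\<rangle> = cnj c * \<langle>x, y\<rangle>"
  using inner_commute[of "c *\<^sub>C x" y] inner_commute[of x y]
  by (simp add: inner_scale_right)

lemma inner_zero_right [simp]: "x \<in> hcarrier H \<Longrightarrow> \<langle>x, 0\<rangle> = 0"
  using inner_scale_right[of x 0 0] by simp

lemma inner_zero_left [simp]: "x \<in> hcarrier H \<Longrightarrow> \<langle>0, x\<rangle> = 0"
  using inner_scale_left[of 0 x 0] by simp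

lemma inner_minus_right: "\<lbrakk>x \<in> hcarrier H; y \<in> hcarrier H\<rbrakk> \<Longrightarrow> \<langle>x, - y\<rangle> = - \<langle>x, y\<rangle>"
  using inner_scale_right[of x y "-1"] by simp

lemma inner_minus_left: "\<lbrakk>x \<in> hcarrier H; y \<in> hcarrier H\<rbrakk> \<Longrightarrow> \<langle>- x, y\<rangle> = - \<langle>x, y\<rangle>"
  using inner_scale_left[of x y "-1"] by simp

lemma inner_diff_right: "\<lbrakk>x \<in> hcarrier H; y \<in> hcarrier H; z \<in> hcarrier H\<rbrakk> \<Longrightarrow>
    \<langle>x, y - z\<rangle> = \<langle>x, y\<rangle> - \<langle>x, z\<rangle>"
  using inner_add_right[of x y "- z"] by (simp add: inner_minus_right)

lemma inner_diff_left: "\<lbrakk>x \<in> hcarrier H; y \<in> hcarrier H; z \<in> hcarrier H\<rbrakk> \<Longrightarrow>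
    \<langle>x - y, z\<rangle> = \<langle>x, z\<rangle> - \<langle>y, z\<rangle>"
  using inner_add_left[of x "- y" z] by (simp add: inner_minus_left)

lemma inner_sum_right: "\<lbrakk>x \<in> hcarrier H; \<And>i. i \<in> I \<Longrightarrow> f i \<in> hcarrier H\<rbrakk> \<Longrightarrow>
    \<langle>x, \<Sum>i\<in>I. f i\<rangle> = (\<Sum>i\<in>I. \<langle>x, f i\<rangle>)"
  by (induction I rule: infinite_finite_induct) (simp_all add: inner_add_right sum_mem)

lemma inner_sum_left: "\<lbrakk>x \<in> hcarrier H; \<And>i. i \<in> I \<Longrightarrow> f i \<in> hcarrier H\<rbrakk> \<Longrightarrow>
    \<langle>\<Sum>i\<in>I. f i, x\<rangle> = (\<Sum>i\<in>I. \<langle>f i, x\<rangle>)"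
  by (induction I rule: infinite_finite_induct) (simp_all add: inner_add_left sum_mem)

lemmas inner_simps = inner_add_left inner_add_right inner_diff_left inner_diff_right
  inner_scale_left inner_scale_right inner_minus_left inner_minus_right

lemma hnorm_nonneg [simp]: "x \<in> hcarrier H \<Longrightarrow> 0 \<le> \<parallel>x\<parallel>"
  by (simp add: hnorm_def inner_nonneg)

lemma hnorm_sq: "x \<in> hcarrier H \<Longrightarrow> \<parallel>x\<parallel>\<^sup>2 = Re \<langle>x, x\<rangle>"
  by (simp add: hnorm_def inner_nonneg)

lemma inner_self: "x \<in> hcarrier H \<Longrightarrow> \<langle>x, x\<rangle> = of_real (\<parallel>x\<parallel>\<^sup>2)"
  using inner_commute[of x x] by (simp add: hnorm_sq complex_eq_iff)

lemma Re_inner_commute: "\<lbrakk>x \<in> hcarrier H; y \<in> hcarrier H\<rbrakk> \<Longrightarrow> Re \<langle>x, y\<rangle> = Re \<langle>y, x\<rangle>"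
  using inner_commute[of x y] by simp

lemma hnorm_zero [simp]: "\<parallel>0\<parallel> = 0"
  by (simp add: hnorm_def)

lemma hnorm_eq_zero: "x \<in> hcarrier H \<Longrightarrow> \<parallel>x\<parallel> = 0 \<longleftrightarrow> x = 0"
  using inner_eq_zero[of x] by (auto simp: inner_self)

lemma hnorm_scale: "x \<in> hcarrier H \<Longrightarrow> \<parallel>c *\<^sub>C x\<parallel> = cmod c * \<parallel>x\<parallel>"
proof (rule power2_eq_imp_eq)
  assume x: "x \<in> hcarrier H"
  have "\<langle>c *\<^sub>C x, c *\<^sub>C x\<rangle> = of_real ((cmod c)\<^sup>2) * \<langle>x, x\<rangle>"
    using x by (simp add: inner_simps complex_norm_square flip: of_real_power)
  then show "\<parallel>c *\<^sub>C x\<parallel>\<^sup>2 = (cmod c * \<parallel>x\<parallel>)\<^sup>2"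
    using x by (simp add: hnorm_sq power_mult_distrib)
qed auto

lemma hnorm_minus: "x \<in> hcarrier H \<Longrightarrow> \<parallel>- x\<parallel> = \<parallel>x\<parallel>"
  using hnorm_scale[of x "-1"] by simp

lemma hnorm_minus_commute: "x \<in> hcarrier H \<Longrightarrow> y \<in> hcarrier H \<Longrightarrow> \<parallel>x - y\<parallel> = \<parallel>y - x\<parallel>"
  using hnorm_minus[of "x - y"] by simp

lemma hnorm_add_sq: "\<lbrakk>x \<in> hcarrier H; y \<in> hcarrier H\<rbrakk> \<Longrightarrow>
    \<parallel>x + y\<parallel>\<^sup>2 = \<parallel>x\<parallel>\<^sup>2 + 2 * Re \<langle>x, y\<rangle> + \<parallel>y\<parallel>\<^sup>2"
  using Re_inner_commute[of x y] by (simp add: hnorm_sq inner_simps)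

lemma hnorm_diff_sq: "\<lbrakk>x \<in> hcarrier H; y \<in> hcarrier H\<rbrakk> \<Longrightarrow>
    \<parallel>x - y\<parallel>\<^sup>2 = \<parallel>x\<parallel>\<^sup>2 - 2 * Re \<langle>x, y\<rangle> + \<parallel>y\<parallel>\<^sup>2"
  using Re_inner_commute[of x y] by (simp add: hnorm_sq inner_simps)

lemma Cauchy_Schwarz:
  assumes x: "x \<in> hcarrier H" and y: "y \<in> hcarrier H"
  shows "cmod \<langle>x, y\<rangle> \<le> \<parallel>x\<parallel> * \<parallel>y\<parallel>"
proof -
  have "(cmod \<langle>x, y\<rangle>)\<^sup>2 \<le> \<parallel>x\<parallel>\<^sup>2 * \<parallel>y\<parallel>\<^sup>2"
  proof (rule norm_sq_le_if_quadratic_nonneg)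
    fix l
    have "0 \<le> \<parallel>x + l *\<^sub>C y\<parallel>\<^sup>2" by simp
    then show "0 \<le> \<parallel>x\<parallel>\<^sup>2 + 2 * Re (l * \<langle>x, y\<rangle>) + (cmod l)\<^sup>2 * \<parallel>y\<parallel>\<^sup>2"
      using x y by (simp add: hnorm_add_sq hnorm_scale inner_scale_right power_mult_distrib)
  qed simp
  then have "(cmod \<langle>x, y\<rangle>)\<^sup>2 \<le> (\<parallel>x\<parallel> * \<parallel>y\<parallel>)\<^sup>2" by (simp only: power_mult_distrib)
  then show ?thesis by (rule power2_le_imp_le) (simp add: x y)
qed

lemma triangle: "\<lbrakk>x \<in> hcarrier H; y \<in> hcarrier H\<rbrakk> \<Longrightarrow> \<parallel>x + y\<parallel> \<le> \<parallel>x\<parallel> + \<parallel>y\<parallel>"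
proof (rule power2_le_imp_le)
  assume *: "x \<in> hcarrier H" "y \<in> hcarrier H"
  show "\<parallel>x + y\<parallel>\<^sup>2 \<le> (\<parallel>x\<parallel> + \<parallel>y\<parallel>)\<^sup>2"
    using Cauchy_Schwarz[OF *] complex_Re_le_cmod[of "\<langle>x, y\<rangle>"]
    by (simp add: hnorm_add_sq * power2_sum)
qed simp

lemma triangle_diff: "\<lbrakk>x \<in> hcarrier H; y \<in> hcarrier H; z \<in> hcarrier H\<rbrakk> \<Longrightarrow>
    \<parallel>x - z\<parallel> \<le> \<parallel>x - y\<parallel> + \<parallel>y - z\<parallel>"
  using triangle[of "x - y" "y - z"] by simp

lemma inner_ext: "\<lbrakk>x \<in> hcarrier H; y \<in> hcarrier H; \<And>z. z \<in> hcarrier H \<Longrightarrow> \<langle>z, x\<rangle> = \<langle>z, y\<rangle>\<rbrakk> \<Longrightarrow> x = y"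
  using inner_eq_zero[of "x - y"] by (simp add: inner_diff_right)

subsection \<open>Convergence\<close>

text \<open>The type \<open>'v\<close> carries many Hilbert spaces and no topology, so convergence
  is expressed through the norm of \<open>H\<close>; membership in the carrier is built in because
  the inner product is only controlled there.\<close>

definition converges :: "(nat \<Rightarrow> 'v) \<Rightarrow> 'v \<Rightarrow> bool" where
  "converges X l \<longleftrightarrow> (\<forall>n. X n \<in> hcarrier H) \<and> l \<in> hcarrier H \<and> (\<lambda>n. \<parallel>X n - l\<parallel>) \<longlonglongrightarrow> 0"

lemma converges_inner:
  assumes "converges X x" "converges Y y"
  shows "(\<lambda>n. \<langle>X n, Y n\<rangle>) \<longlonglongrightarrow> \<langle>x, y\<rangle>"
proof -
  have m: "\<And>n. X n \<in> hcarrier H" "x \<in> hcarrier H" "\<And>n. Y n \<in> hcarrier H" "y \<in> hcarrier H"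
    using assms by (auto simp: converges_def)
  have lim: "(\<lambda>n. \<parallel>X n - x\<parallel> * (\<parallel>Y n - y\<parallel> + \<parallel>y\<parallel>) + \<parallel>x\<parallel> * \<parallel>Y n - y\<parallel>) \<longlonglongrightarrow> 0 * (0 + \<parallel>y\<parallel>) + \<parallel>x\<parallel> * 0"
    using assms by (intro tendsto_intros) (auto simp: converges_def)
  have "cmod (\<langle>X n, Y n\<rangle> - \<langle>x, y\<rangle>) \<le> \<parallel>X n - x\<parallel> * (\<parallel>Y n - y\<parallel> + \<parallel>y\<parallel>) + \<parallel>x\<parallel> * \<parallel>Y n - y\<parallel>" for n
  proof -
    \<comment> \<open>Writing \<open>Y n\<close> as \<open>(Y n - y) + y\<close> leaves only null
      sequences and the constant \<open>\<parallel>y\<parallel>\<close> in the estimate, so no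
      separate bound on \<open>Y n\<close> is called for.\<close>
    have "\<langle>X n, Y n\<rangle> - \<langle>x, y\<rangle> = \<langle>X n - x, (Y n - y) + y\<rangle> + \<langle>x, Y n - y\<rangle>"
      using m by (simp add: inner_diff_left inner_diff_right)
    also have "cmod \<dots> \<le> \<parallel>X n - x\<parallel> * \<parallel>(Y n - y) + y\<parallel> + \<parallel>x\<parallel> * \<parallel>Y n - y\<parallel>"
      using m by (intro norm_triangle_mono Cauchy_Schwarz) auto
    also have "\<dots> \<le> \<parallel>X n - x\<parallel> * (\<parallel>Y n - y\<parallel> + \<parallel>y\<parallel>) + \<parallel>x\<parallel> * \<parallel>Y n - y\<parallel>"
      using m by (intro add_mono mult_left_mono triangle) auto
    finally show ?thesis .
  qed
  moreover have "(\<lambda>n. \<parallel>X n - x\<parallel> * (\<parallel>Y n - y\<parallel> + \<parallel>y\<parallel>) + \<parallel>x\<parallel> * \<parallel>Y n - y\<parallel>) \<longlonglongrightarrow> 0"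
    using lim by simp
  ultimately have "(\<lambda>n. \<langle>X n, Y n\<rangle> - \<langle>x, y\<rangle>) \<longlonglongrightarrow> 0"
    by (rule Lim_null_comparison[OF always_eventually[OF allI]])
  then show ?thesis by (rule LIM_zero_cancel)
qed

lemma converges_const: "x \<in> hcarrier H \<Longrightarrow> converges (\<lambda>n. x) x"
  by (simp add: converges_def)

lemma converges_norm:
  assumes "converges X x" shows "(\<lambda>n. \<parallel>X n\<parallel>) \<longlonglongrightarrow> \<parallel>x\<parallel>"
  unfolding hnorm_def by (intro tendsto_intros converges_inner assms)

lemma converges_unique:
  assumes "converges X x" "converges X y" shows "x = y"
proof (rule inner_ext)
  fix z assume "z \<in> hcarrier H"
  then show "\<langle>z, x\<rangle> = \<langle>z, y\<rangle>"
    by (intro LIMSEQ_unique[OF converges_inner[OF converges_const assms(1)]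
          converges_inner[OF converges_const assms(2)]])
qed (use assms in \<open>auto simp: converges_def\<close>)

lemma converges_add:
  assumes "converges X x" "converges Y y" shows "converges (\<lambda>n. X n + Y n) (x + y)"
proof -
  have m: "\<And>n. X n \<in> hcarrier H" "x \<in> hcarrier H" "\<And>n. Y n \<in> hcarrier H" "y \<in> hcarrier H"
    using assms by (auto simp: converges_def)
  have lim: "(\<lambda>n. \<parallel>X n - x\<parallel> + \<parallel>Y n - y\<parallel>) \<longlonglongrightarrow> 0"
    using assms by (auto intro: tendsto_add_zero simp: converges_def)
  have "norm \<parallel>(X n + Y n) - (x + y)\<parallel> \<le> \<parallel>X n - x\<parallel> + \<parallel>Y n - y\<parallel>" for n
    using triangle[of "X n - x" "Y n - y"] m by (simp add: add_diff_add)
  then have "(\<lambda>n. \<parallel>(X n + Y n) - (x + y)\<parallel>) \<longlonglongrightarrow> 0"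
    by (rule Lim_null_comparison[OF always_eventually[OF allI] lim])
  then show ?thesis using m by (simp add: converges_def)
qed

lemma converges_scale:
  assumes "converges X x" shows "converges (\<lambda>n. c *\<^sub>C X n) (c *\<^sub>C x)"
proof -
  have m: "\<And>n. X n \<in> hcarrier H" "x \<in> hcarrier H"
    using assms by (auto simp: converges_def)
  have "(\<lambda>n. cmod c * \<parallel>X n - x\<parallel>) \<longlonglongrightarrow> 0"
    using assms by (intro tendsto_mult_right_zero) (simp add: converges_def)
  moreover have "\<parallel>c *\<^sub>C X n - c *\<^sub>C x\<parallel> = cmod c * \<parallel>X n - x\<parallel>" for n
    using hnorm_scale[of "X n - x" c] m
    by (metis complex_vector.scale_right_diff_distrib diff_mem)
  ultimately show ?thesis using m unfolding converges_def by simp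
qed

end

subsection \<open>The Riesz representation\<close>

text \<open>Completeness is split off so that everything below applies to
  \<open>tensor_Cn H n\<close> as soon as that space is shown to be complete.\<close>

locale hilbert_space = inner_product_space +
  assumes Cauchy_converges: "\<lbrakk>\<And>n. X n \<in> hcarrier H;
      \<And>\<epsilon>. \<epsilon> > 0 \<Longrightarrow> \<exists>N. \<forall>m\<ge>N. \<forall>n\<ge>N. hnorm H (X m - X n) < \<epsilon>\<rbrakk> \<Longrightarrow>
      \<exists>l\<in>hcarrier H. (\<lambda>n::nat. hnorm H (X n - l)) \<longlonglongrightarrow> 0"

sublocale separable_hilbert_space \<subseteq> hilbert_space
  by unfold_locales (rule complete)

context hilbert_space
begin

text \<open>The representing vector minimizes \<open>\<parallel>x\<parallel>\<^sup>2 - 2 * Re (\<phi> x)\<close>; by the parallelogram law, minimizing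
  sequences are Cauchy.  As \<open>W\<close> need not be closed, the minimum is only attained in its closure.\<close>

theorem Riesz_representation:
  assumes W: "complex_vector.subspace W" "W \<subseteq> hcarrier H"
    and add: "\<And>x y. x \<in> W \<Longrightarrow> y \<in> W \<Longrightarrow> \<phi> (x + y) = \<phi> x + \<phi> y"
    and scale: "\<And>x c. x \<in> W \<Longrightarrow> \<phi> (c *\<^sub>C x) = c * (\<phi> x :: complex)"
    and bound: "\<And>x. x \<in> W \<Longrightarrow> cmod (\<phi> x) \<le> C * \<parallel>x\<parallel>"
  obtains y X where "converges X y" "\<And>n. X n \<in> W" "\<And>h. h \<in> W \<Longrightarrow> \<phi> h = \<langle>y, h\<rangle>"
proof -
  define J where "J x = \<parallel>x\<parallel>\<^sup>2 - 2 * Re (\<phi> x)" for x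
  have WH: "x \<in> hcarrier H" if "x \<in> W" for x using that W by auto
  have Wadd: "x + y \<in> W" if "x \<in> W" "y \<in> W" for x y
    using W that by (simp add: complex_vector.subspace_add)
  have Wscale: "c *\<^sub>C x \<in> W" if "x \<in> W" for x c
    using W that by (simp add: complex_vector.subspace_scale)
  have W0: "0 \<in> W" using W by (simp add: complex_vector.subspace_0)
  \<comment> \<open>From \<open>2 * C * \<parallel>x\<parallel> \<le> C\<^sup>2 +
    \<parallel>x\<parallel>\<^sup>2\<close>; it makes the infimum \<open>m\<close>
    meaningful.\<close>
  have J_lower: "- C\<^sup>2 \<le> J x" if x: "x \<in> W" for x
  proof -
    have "2 * Re (\<phi> x) \<le> 2 * (C * \<parallel>x\<parallel>)"
      using bound[OF x] complex_Re_le_cmod[of "\<phi> x"] by simp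
    also have "\<dots> \<le> C\<^sup>2 + \<parallel>x\<parallel>\<^sup>2" using sum_squares_bound[of C "\<parallel>x\<parallel>"] by simp
    finally show ?thesis by (simp add: J_def)
  qed
  define m where "m = Inf (J ` W)"
  have bdd: "bdd_below (J ` W)" using J_lower by (auto simp: bdd_below_def)
  have m_le: "m \<le> J x" if "x \<in> W" for x
    unfolding m_def using that bdd by (auto intro: cInf_lower)
  have "\<exists>x\<in>W. J x < m + inverse (real (Suc n))" for n
  proof -
    have "Inf (J ` W) < m + inverse (real (Suc n))" by (simp add: m_def)
    then show ?thesis using cInf_lessD[of "J ` W"] W0 by blast
  qed
  then obtain X where X: "\<And>n. X n \<in> W" and XJ: "\<And>n. J (X n) < m + inverse (real (Suc n))" by metis
  \<comment> \<open>The parallelogram law makes \<open>\<parallel>x - y\<parallel>\<^sup>2\<close>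
    equal to \<open>2 * J x + 2 * J y - 4 * J z\<close> with \<open>z\<close> the midpoint, because
    the linear parts cancel; and \<open>J z \<ge> m\<close>.\<close>
  have par: "\<parallel>x - y\<parallel>\<^sup>2 \<le> 2 * (J x - m) + 2 * (J y - m)" if x: "x \<in> W" and y: "y \<in> W" for x y
  proof -
    have mid: "m \<le> J ((1/2) *\<^sub>C (x + y))" using x y by (intro m_le Wscale Wadd)
    have "\<parallel>(1/2) *\<^sub>C (x + y)\<parallel>\<^sup>2 = (\<parallel>x\<parallel>\<^sup>2 + 2 * Re \<langle>x, y\<rangle> + \<parallel>y\<parallel>\<^sup>2) / 4"
      using x y WH by (simp add: hnorm_scale power_divide hnorm_add_sq)
    moreover have "\<phi> ((1/2) *\<^sub>C (x + y)) = (\<phi> x + \<phi> y) / 2"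
      using x y Wadd by (simp add: scale add)
    then have "Re (\<phi> ((1/2) *\<^sub>C (x + y))) = (Re (\<phi> x) + Re (\<phi> y)) / 2"
      by (simp only: Re_divide_numeral plus_complex.sel)
    moreover have "\<parallel>x - y\<parallel>\<^sup>2 = \<parallel>x\<parallel>\<^sup>2 - 2 * Re \<langle>x, y\<rangle> + \<parallel>y\<parallel>\<^sup>2"
      using x y WH by (simp add: hnorm_diff_sq)
    ultimately show ?thesis using mid unfolding J_def by argo
  qed
  have "\<exists>N. \<forall>i\<ge>N. \<forall>j\<ge>N. \<parallel>X i - X j\<parallel> < e" if e: "e > 0" for e
  proof -
    obtain N where N: "inverse (real (Suc N)) < e\<^sup>2 / 4"
      using e reals_Archimedean[of "e\<^sup>2 / 4"] by auto
    have "\<parallel>X i - X j\<parallel> < e" if "i \<ge> N" "j \<ge> N" for i j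
    proof (rule power2_less_imp_less)
      have "inverse (real (Suc i)) \<le> inverse (real (Suc N))" "inverse (real (Suc j)) \<le> inverse (real (Suc N))"
        using that by (simp_all add: le_imp_inverse_le)
      then show "\<parallel>X i - X j\<parallel>\<^sup>2 < e\<^sup>2"
        using par[OF X[of i] X[of j]] XJ[of i] XJ[of j] N by argo
    qed (use e in simp)
    then show ?thesis by blast
  qed
  then obtain y where y: "y \<in> hcarrier H" "(\<lambda>n. \<parallel>X n - y\<parallel>) \<longlonglongrightarrow> 0"
    using Cauchy_converges[of X] X WH by blast
  have conv: "converges X y" using X WH y by (auto simp: converges_def)
  \<comment> \<open>The first-order condition at the minimum: a polynomial in the real variable
    \<open>t\<close> without constant term is nonnegative, so its linear coefficient
    vanishes.\<close>
  have Re_eq: "Re (\<phi> h) = Re \<langle>y, h\<rangle>" if h: "h \<in> W" for h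
  proof -
    have key: "0 \<le> t\<^sup>2 * \<parallel>h\<parallel>\<^sup>2 + 2 * t * (Re \<langle>y, h\<rangle> - Re (\<phi> h))" for t
    proof -
      \<comment> \<open>The perturbation is made at \<open>X n\<close> and not at the limit
        \<open>y\<close>, which may lie outside \<open>W\<close>, where nothing is known about
        \<open>\<phi>\<close>. The error disappears as \<open>n\<close> grows.\<close>
      have ge: "- inverse (real (Suc n)) \<le> t\<^sup>2 * \<parallel>h\<parallel>\<^sup>2 + 2 * t * (Re \<langle>X n, h\<rangle> - Re (\<phi> h))" for n
      proof -
        have "m \<le> J (X n + of_real t *\<^sub>C h)"
          using h X by (intro m_le Wadd Wscale)
        moreover have "J (X n + of_real t *\<^sub>C h) =
            J (X n) + (t\<^sup>2 * \<parallel>h\<parallel>\<^sup>2 + 2 * t * (Re \<langle>X n, h\<rangle> - Re (\<phi> h)))"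
          using h X[of n] WH Wscale[OF h]
          by (simp add: J_def hnorm_add_sq hnorm_scale add scale inner_scale_right power_mult_distrib
              right_diff_distrib)
        ultimately show ?thesis using XJ[of n] by linarith
      qed
      have lim0: "(\<lambda>n. - inverse (real (Suc n))) \<longlonglongrightarrow> 0"
        using tendsto_minus[OF LIMSEQ_inverse_real_of_nat] by simp
      have "(\<lambda>n. Re \<langle>X n, h\<rangle>) \<longlonglongrightarrow> Re \<langle>y, h\<rangle>"
        using h WH by (intro tendsto_Re converges_inner[OF conv converges_const]) auto
      then have "(\<lambda>n. t\<^sup>2 * \<parallel>h\<parallel>\<^sup>2 + 2 * t * (Re \<langle>X n, h\<rangle> - Re (\<phi> h)))
          \<longlonglongrightarrow> t\<^sup>2 * \<parallel>h\<parallel>\<^sup>2 + 2 * t * (Re \<langle>y, h\<rangle> - Re (\<phi> h))"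
        by (intro tendsto_add tendsto_mult tendsto_diff tendsto_const)
      with lim0 show ?thesis by (rule LIMSEQ_le) (use ge in blast)
    qed
    define d where "d = Re \<langle>y, h\<rangle> - Re (\<phi> h)"
    have "(cmod (of_real d))\<^sup>2 \<le> \<parallel>h\<parallel>\<^sup>2 * 0 \<or> d = 0"
    proof (cases "\<parallel>h\<parallel> = 0")
      case True
      then show ?thesis using key[of 1] key[of "-1"] by (auto simp: d_def)
    next
      case False
      \<comment> \<open>This \<open>t\<close> minimizes the quadratic in \<open>key\<close>; the
        minimum \<open>- d\<^sup>2 / \<parallel>h\<parallel>\<^sup>2\<close> is negative unless
        \<open>d = 0\<close>.\<close>
      have "0 \<le> (- d / \<parallel>h\<parallel>\<^sup>2)\<^sup>2 * \<parallel>h\<parallel>\<^sup>2 + 2 * (- d / \<parallel>h\<parallel>\<^sup>2) * d" using key[of "- d / \<parallel>h\<parallel>\<^sup>2"] by (simp add: d_def)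
      also have "\<dots> = - d\<^sup>2 / \<parallel>h\<parallel>\<^sup>2" using False by (simp add: field_simps power2_eq_square)
      finally show ?thesis using False by (simp add: divide_le_0_iff)
    qed
    then show ?thesis by (auto simp: d_def)
  qed
  have "\<phi> h = \<langle>y, h\<rangle>" if h: "h \<in> W" for h
  proof (rule complex_eqI)
    show "Re (\<phi> h) = Re \<langle>y, h\<rangle>" by (rule Re_eq[OF h])
    \<comment> \<open>Imaginary parts at \<open>h\<close> are, up to sign, real parts at
      \<open>\<i> *\<^sub>C h\<close>.\<close>
    show "Im (\<phi> h) = Im \<langle>y, h\<rangle>"
      using Re_eq[OF Wscale[OF h, of \<i>]] h y WH by (simp add: scale inner_scale_right)
  qed
  then show thesis using that conv X by blast
qed

end

section \<open>Bounded operators\<close>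

context inner_product_space
begin

text \<open>\<open>op_mem\<close> asks nothing of \<open>x\<close>: off the carrier the value is 0,
  which belongs to the carrier. This keeps membership goals for iterated operators trivial.\<close>

lemma
  assumes "T \<in> bounded_ops H"
  shows op_outside: "x \<notin> hcarrier H \<Longrightarrow> T x = 0"
    and op_mem [simp]: "T x \<in> hcarrier H"
    and op_add: "x \<in> hcarrier H \<Longrightarrow> y \<in> hcarrier H \<Longrightarrow> T (x + y) = T x + T y"
    and op_scale: "x \<in> hcarrier H \<Longrightarrow> T (c *\<^sub>C x) = c *\<^sub>C T x"
  using assms unfolding bounded_ops_def by (blast, metis (mono_tags, lifting) mem_Collect_eq zero_mem, blast+)

lemma op_zero [simp]: "T \<in> bounded_ops H \<Longrightarrow> T 0 = 0"
  using op_scale[of T 0 0] by simp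

lemma op_minus: "T \<in> bounded_ops H \<Longrightarrow> x \<in> hcarrier H \<Longrightarrow> T (- x) = - T x"
  using op_scale[of T x "-1"] by simp

lemma op_diff: "T \<in> bounded_ops H \<Longrightarrow> x \<in> hcarrier H \<Longrightarrow> y \<in> hcarrier H \<Longrightarrow> T (x - y) = T x - T y"
  using op_add[of T x "- y"] by (simp add: op_minus)

lemma op_sum: "T \<in> bounded_ops H \<Longrightarrow> (\<And>i. i \<in> I \<Longrightarrow> f i \<in> hcarrier H) \<Longrightarrow>
    T (\<Sum>i\<in>I. f i) = (\<Sum>i\<in>I. T (f i))"
  by (induction I rule: infinite_finite_induct) (simp_all add: op_add sum_mem)

lemmas op_simps = op_add op_scale op_minus op_diff

lemma op_bound:
  assumes "T \<in> bounded_ops H"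
  obtains C where "C > 0" "\<And>x. x \<in> hcarrier H \<Longrightarrow> \<parallel>T x\<parallel> \<le> C * \<parallel>x\<parallel>"
proof -
  from assms obtain C where C: "\<And>x. x \<in> hcarrier H \<Longrightarrow> \<parallel>T x\<parallel> \<le> C * \<parallel>x\<parallel>"
    unfolding bounded_ops_def by blast
  have "\<parallel>T x\<parallel> \<le> (\<bar>C\<bar> + 1) * \<parallel>x\<parallel>" if "x \<in> hcarrier H" for x
    by (rule order_trans[OF C[OF that]], rule mult_right_mono) (use that in auto)
  then show thesis by (intro that[of "\<bar>C\<bar> + 1"]) auto
qed

lemma bounded_opsI:
  assumes "\<And>x. x \<notin> hcarrier H \<Longrightarrow> T x = 0"
    and "\<And>x. x \<in> hcarrier H \<Longrightarrow> T x \<in> hcarrier H"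
    and "\<And>x y. x \<in> hcarrier H \<Longrightarrow> y \<in> hcarrier H \<Longrightarrow> T (x + y) = T x + T y"
    and "\<And>x c. x \<in> hcarrier H \<Longrightarrow> T (c *\<^sub>C x) = c *\<^sub>C T x"
    and "\<And>x. x \<in> hcarrier H \<Longrightarrow> \<parallel>T x\<parallel> \<le> C * \<parallel>x\<parallel>"
  shows "T \<in> bounded_ops H"
  unfolding bounded_ops_def using assms by blast

lemma op_ext:
  assumes "S \<in> bounded_ops H" "T \<in> bounded_ops H" "\<And>x. x \<in> hcarrier H \<Longrightarrow> S x = T x"
  shows "S = T"
proof
  fix x show "S x = T x" using assms by (cases "x \<in> hcarrier H") (auto simp: op_outside)
qed

lemma op_ext_inner:
  assumes "S \<in> bounded_ops H" "T \<in> bounded_ops H"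
    and "\<And>x y. x \<in> hcarrier H \<Longrightarrow> y \<in> hcarrier H \<Longrightarrow> \<langle>x, S y\<rangle> = \<langle>x, T y\<rangle>"
  shows "S = T"
  using assms by (intro op_ext inner_ext) auto

lemma zero_bounded [simp]: "0 \<in> bounded_ops H"
  by (rule bounded_opsI[where C = 0]) auto

lemma add_bounded [simp]:
  assumes S: "S \<in> bounded_ops H" and T: "T \<in> bounded_ops H"
  shows "S + T \<in> bounded_ops H"
proof -
  from op_bound[OF S] obtain C where C: "\<And>x. x \<in> hcarrier H \<Longrightarrow> \<parallel>S x\<parallel> \<le> C * \<parallel>x\<parallel>" by blast
  from op_bound[OF T] obtain D where D: "\<And>x. x \<in> hcarrier H \<Longrightarrow> \<parallel>T x\<parallel> \<le> D * \<parallel>x\<parallel>" by blast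
  show ?thesis
  proof (rule bounded_opsI)
    fix x assume x: "x \<in> hcarrier H"
    have "\<parallel>S x + T x\<parallel> \<le> \<parallel>S x\<parallel> + \<parallel>T x\<parallel>" using S T by (intro triangle) auto
    also have "\<dots> \<le> (C + D) * \<parallel>x\<parallel>" using C[OF x] D[OF x] by (simp add: distrib_right)
    finally show "\<parallel>(S + T) x\<parallel> \<le> (C + D) * \<parallel>x\<parallel>" by simp
  qed (use S T in \<open>auto simp: op_outside op_simps complex_vector.scale_right_distrib\<close>)
qed

lemma scale_bounded [simp]:
  assumes T: "T \<in> bounded_ops H"
  shows "c *\<^sub>C T \<in> bounded_ops H"
proof -
  from op_bound[OF T] obtain C where C: "\<And>x. x \<in> hcarrier H \<Longrightarrow> \<parallel>T x\<parallel> \<le> C * \<parallel>x\<parallel>" by blast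
  show ?thesis
  proof (rule bounded_opsI)
    fix x assume x: "x \<in> hcarrier H"
    show "\<parallel>(c *\<^sub>C T) x\<parallel> \<le> (cmod c * C) * \<parallel>x\<parallel>"
      using mult_left_mono[OF C[OF x], of "cmod c"] T by (simp add: hnorm_scale mult.assoc)
  qed (use T in \<open>auto simp: op_outside op_simps complex_vector.scale_right_distrib
      complex_vector.scale_left_commute\<close>)
qed

lemma uminus_bounded [simp]: "T \<in> bounded_ops H \<Longrightarrow> - T \<in> bounded_ops H"
  using scale_bounded[of T "-1"] by (simp del: scale_bounded)

lemma diff_bounded [simp]: "S \<in> bounded_ops H \<Longrightarrow> T \<in> bounded_ops H \<Longrightarrow> S - T \<in> bounded_ops H"
  using add_bounded[of S "- T"] by (simp del: add_bounded)

lemma sum_bounded: "(\<And>i. i \<in> I \<Longrightarrow> f i \<in> bounded_ops H) \<Longrightarrow> (\<Sum>i\<in>I. f i) \<in> bounded_ops H"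
  by (induction I rule: infinite_finite_induct) auto

lemma comp_bounded [simp]:
  assumes S: "S \<in> bounded_ops H" and T: "T \<in> bounded_ops H"
  shows "S \<circ> T \<in> bounded_ops H"
proof -
  from op_bound[OF S] obtain C where C: "C > 0" "\<And>x. x \<in> hcarrier H \<Longrightarrow> \<parallel>S x\<parallel> \<le> C * \<parallel>x\<parallel>" by blast
  from op_bound[OF T] obtain D where D: "\<And>x. x \<in> hcarrier H \<Longrightarrow> \<parallel>T x\<parallel> \<le> D * \<parallel>x\<parallel>" by blast
  show ?thesis
  proof (rule bounded_opsI)
    fix x assume x: "x \<in> hcarrier H"
    have "\<parallel>S (T x)\<parallel> \<le> C * \<parallel>T x\<parallel>" using C T by simp
    also have "\<dots> \<le> C * (D * \<parallel>x\<parallel>)" using C D[OF x] by simp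
    finally show "\<parallel>(S \<circ> T) x\<parallel> \<le> (C * D) * \<parallel>x\<parallel>" by (simp add: mult.assoc)
  qed (use S T in \<open>auto simp: op_outside op_simps\<close>)
qed

text \<open>The unit of the algebra of bounded operators; \<open>id\<close> itself violates the
  convention of vanishing outside the carrier.\<close>

definition ident :: "'v \<Rightarrow> 'v" where
  "ident x = (if x \<in> hcarrier H then x else 0)"

lemma ident_apply [simp]: "x \<in> hcarrier H \<Longrightarrow> ident x = x"
  by (simp add: ident_def)

lemma ident_bounded [simp]: "ident \<in> bounded_ops H"
  by (rule bounded_opsI[where C = 1]) (auto simp: ident_def)

lemma ident_comp [simp]: "T \<in> bounded_ops H \<Longrightarrow> ident \<circ> T = T" "T \<in> bounded_ops H \<Longrightarrow> T \<circ> ident = T"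
  by (auto intro!: op_ext)

lemma converges_op:
  assumes T: "T \<in> bounded_ops H" and X: "converges X x"
  shows "converges (\<lambda>n. T (X n)) (T x)"
proof -
  have m: "\<And>n. X n \<in> hcarrier H" "x \<in> hcarrier H" using X by (auto simp: converges_def)
  from op_bound[OF T] obtain C where C: "\<And>x. x \<in> hcarrier H \<Longrightarrow> \<parallel>T x\<parallel> \<le> C * \<parallel>x\<parallel>" by blast
  have lim: "(\<lambda>n. C * \<parallel>X n - x\<parallel>) \<longlonglongrightarrow> 0"
    using X by (intro tendsto_mult_right_zero) (simp add: converges_def)
  have "norm \<parallel>T (X n) - T x\<parallel> \<le> C * \<parallel>X n - x\<parallel>" for n
    using C[of "X n - x"] m T by (simp add: op_diff)
  then have "(\<lambda>n. \<parallel>T (X n) - T x\<parallel>) \<longlonglongrightarrow> 0"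
    by (rule Lim_null_comparison[OF always_eventually[OF allI] lim])
  then show ?thesis using T by (simp add: converges_def)
qed

lemma quadratic_form_add:
  assumes T: "T \<in> bounded_ops H" and x: "x \<in> hcarrier H" and y: "y \<in> hcarrier H"
  shows "\<langle>x + c *\<^sub>C y, T (x + c *\<^sub>C y)\<rangle> =
    \<langle>x, T x\<rangle> + c * \<langle>x, T y\<rangle> + cnj c * \<langle>y, T x\<rangle> + (c * cnj c) * \<langle>y, T y\<rangle>"
  using assms by (simp add: inner_simps op_simps distrib_left mult_ac)

lemma polarization:
  assumes T: "T \<in> bounded_ops H" and x: "x \<in> hcarrier H" and y: "y \<in> hcarrier H"
  shows "4 * \<langle>x, T y\<rangle> = (\<Sum>k<4. (-\<i>) ^ k * \<langle>x + \<i> ^ k *\<^sub>C y, T (x + \<i> ^ k *\<^sub>C y)\<rangle>)"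
  unfolding quadratic_form_add[OF assms] sum_lessThan_4
  by (simp add: power3_eq_cube power2_eq_square distrib_left right_diff_distrib)

lemma op_ext_quadratic:
  assumes "S \<in> bounded_ops H" "T \<in> bounded_ops H"
    and "\<And>x. x \<in> hcarrier H \<Longrightarrow> \<langle>x, S x\<rangle> = \<langle>x, T x\<rangle>"
  shows "S = T"
proof (rule op_ext_inner)
  fix x y assume "x \<in> hcarrier H" "y \<in> hcarrier H"
  then have "4 * \<langle>x, S y\<rangle> = 4 * \<langle>x, T y\<rangle>"
    by (simp only: polarization assms add_mem scale_mem)
  then show "\<langle>x, S y\<rangle> = \<langle>x, T y\<rangle>" by simp
qed (use assms in auto)

subsection \<open>Positive operators\<close>

lemma positive_bounded [simp]: "positive_op H T \<Longrightarrow> T \<in> bounded_ops H"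
  by (simp add: positive_op_def)

lemma positive_inner: "positive_op H T \<Longrightarrow> x \<in> hcarrier H \<Longrightarrow> \<langle>x, T x\<rangle> = of_real (Re \<langle>x, T x\<rangle>)"
  by (simp add: positive_op_def complex_eq_iff)

lemma positive_Re: "positive_op H T \<Longrightarrow> x \<in> hcarrier H \<Longrightarrow> 0 \<le> Re \<langle>x, T x\<rangle>"
  by (simp add: positive_op_def)

text \<open>Reality of the quadratic form at \<open>x + y\<close> gives the imaginary part of the
  identity, reality at \<open>x + \<i> *\<^sub>C y\<close> the real part.\<close>

lemma positive_self_adjoint:
  assumes T: "positive_op H T" and x: "x \<in> hcarrier H" and y: "y \<in> hcarrier H"
  shows "\<langle>T x, y\<rangle> = \<langle>x, T y\<rangle>"
proof -
  have T': "T \<in> bounded_ops H" using T by simp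
  have real: "Im \<langle>z, T z\<rangle> = 0" if "z \<in> hcarrier H" for z using T that by (simp add: positive_op_def)
  have "Im \<langle>x, T y\<rangle> + Im \<langle>y, T x\<rangle> = 0"
    using real[OF add_mem[OF x y]] real[OF x] real[OF y] x y T' by (simp add: inner_simps op_simps)
  moreover have "Re \<langle>x, T y\<rangle> = Re \<langle>y, T x\<rangle>"
    using real[OF add_mem[OF x scale_mem[OF y, of \<i>]]] real[OF x] real[OF y] x y T'
    by (simp add: inner_simps op_simps)
  ultimately show ?thesis
    using inner_commute[of "T x" y] T' x y by (simp add: complex_eq_iff)
qed

text \<open>The discriminant argument again, for the semi-inner product defined by \<open>T\<close>.
  It may be degenerate, which is why \<open>norm_sq_le_if_quadratic_nonneg\<close> allows
  \<open>c = 0\<close>.\<close>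

lemma positive_Cauchy_Schwarz:
  assumes T: "positive_op H T" and x: "x \<in> hcarrier H" and y: "y \<in> hcarrier H"
  shows "(cmod \<langle>x, T y\<rangle>)\<^sup>2 \<le> Re \<langle>x, T x\<rangle> * Re \<langle>y, T y\<rangle>"
proof (rule norm_sq_le_if_quadratic_nonneg)
  fix l
  have T': "T \<in> bounded_ops H" using T by simp
  have 0: "0 \<le> Re \<langle>x + l *\<^sub>C y, T (x + l *\<^sub>C y)\<rangle>"
    using T x y by (intro positive_Re) auto
  have 2: "cnj l * \<langle>y, T x\<rangle> = cnj (l * \<langle>x, T y\<rangle>)"
    using positive_self_adjoint[OF T x y] inner_commute[of y "T x"] T' x y by simp
  have 3: "Re (cnj (l * \<langle>x, T y\<rangle>)) = Re (l * \<langle>x, T y\<rangle>)" by (simp only: cnj.sel)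
  have 4: "Re ((l * cnj l) * \<langle>y, T y\<rangle>) = (cmod l)\<^sup>2 * Re \<langle>y, T y\<rangle>"
    unfolding complex_norm_square[symmetric]
    by (simp only: times_complex.sel Re_complex_of_real Im_complex_of_real mult_zero_left diff_0_right)
  show "0 \<le> Re \<langle>x, T x\<rangle> + 2 * Re (l * \<langle>x, T y\<rangle>) + (cmod l)\<^sup>2 * Re \<langle>y, T y\<rangle>"
    using 0 unfolding quadratic_form_add[OF T' x y] 2 plus_complex.sel 3 4 by simp
qed (use assms positive_Re in auto)

text \<open>Cauchy-Schwarz for the form of \<open>T\<close>, tested on the pair \<open>T y\<close>
  and \<open>y\<close>, bounds the square of \<open>\<langle>T y, T y\<rangle>\<close> by a multiple
  of \<open>Re \<langle>y, T y\<rangle>\<close>.\<close>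

lemma positive_zero_iff:
  assumes T: "positive_op H T" and y: "y \<in> hcarrier H" and z: "Re \<langle>y, T y\<rangle> = 0"
  shows "T y = 0"
  using positive_Cauchy_Schwarz[OF T op_mem[OF positive_bounded[OF T], of y] y] z T
  by (intro inner_eq_zero) auto

lemma positive_add: "positive_op H S \<Longrightarrow> positive_op H T \<Longrightarrow> positive_op H (S + T)"
  by (simp add: positive_op_def inner_add_right)

lemma positive_scale: "positive_op H T \<Longrightarrow> 0 \<le> r \<Longrightarrow> positive_op H (of_real r *\<^sub>C T)"
  by (simp add: positive_op_def inner_scale_right)

lemma positive_zero [simp]: "positive_op H 0"
  by (simp add: positive_op_def)

lemma positive_conj:
  assumes "A \<in> bounded_ops H" "T \<in> bounded_ops H"
    and "\<And>x y. x \<in> hcarrier H \<Longrightarrow> y \<in> hcarrier H \<Longrightarrow> \<langle>x, T y\<rangle> = \<langle>A x, A y\<rangle>"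
  shows "positive_op H T"
  using assms by (simp add: positive_op_def inner_self inner_nonneg)

end

context hilbert_space
begin

lemma adjoint_exists:
  assumes A: "A \<in> bounded_ops H"
  obtains A' where "A' \<in> bounded_ops H"
    "\<And>x y. x \<in> hcarrier H \<Longrightarrow> y \<in> hcarrier H \<Longrightarrow> \<langle>A' x, y\<rangle> = \<langle>x, A y\<rangle>"
proof -
  from op_bound[OF A] obtain C where C: "C > 0" "\<And>x. x \<in> hcarrier H \<Longrightarrow> \<parallel>A x\<parallel> \<le> C * \<parallel>x\<parallel>" by blast
  have "\<exists>y\<in>hcarrier H. \<forall>h\<in>hcarrier H. \<langle>x, A h\<rangle> = \<langle>y, h\<rangle>" if x: "x \<in> hcarrier H" for x
  proof -
    have bd: "cmod \<langle>x, A h\<rangle> \<le> (\<parallel>x\<parallel> * C) * \<parallel>h\<parallel>" if h: "h \<in> hcarrier H" for h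
    proof -
      have "cmod \<langle>x, A h\<rangle> \<le> \<parallel>x\<parallel> * \<parallel>A h\<parallel>" using x A by (intro Cauchy_Schwarz) auto
      also have "\<dots> \<le> \<parallel>x\<parallel> * (C * \<parallel>h\<parallel>)" using x C(2)[OF h] by (intro mult_left_mono) auto
      finally show ?thesis by (simp add: mult.assoc)
    qed
    show ?thesis
      using Riesz_representation[OF subspace order_refl, of "\<lambda>h. \<langle>x, A h\<rangle>" "\<parallel>x\<parallel> * C"] x A bd
      by (metis (no_types, lifting) converges_def inner_add_right inner_scale_right op_add op_mem op_scale)
  qed
  then obtain f where f: "\<And>x. x \<in> hcarrier H \<Longrightarrow> f x \<in> hcarrier H"
    "\<And>x h. x \<in> hcarrier H \<Longrightarrow> h \<in> hcarrier H \<Longrightarrow> \<langle>f x, h\<rangle> = \<langle>x, A h\<rangle>" by metis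
  have ext: "u = v" if "u \<in> hcarrier H" "v \<in> hcarrier H" "\<And>h. h \<in> hcarrier H \<Longrightarrow> \<langle>u, h\<rangle> = \<langle>v, h\<rangle>" for u v
    using that by (intro inner_ext) (metis inner_commute)+
  define A' where "A' x = (if x \<in> hcarrier H then f x else 0)" for x
  have "A' \<in> bounded_ops H"
  proof (rule bounded_opsI)
    fix x assume x: "x \<in> hcarrier H"
    \<comment> \<open>The adjoint inherits the bound \<open>C\<close>: estimate its squared norm by
      moving one copy across the inner product, then cancel
      \<open>\<parallel>f x\<parallel>\<close>.\<close>
    have "\<parallel>f x\<parallel> * \<parallel>f x\<parallel> = cmod \<langle>f x, f x\<rangle>"
      using f(1)[OF x] by (simp add: inner_self norm_power power2_eq_square flip: of_real_mult)
    also have "\<dots> = cmod \<langle>x, A (f x)\<rangle>" using f x by simp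
    also have "\<dots> \<le> \<parallel>x\<parallel> * \<parallel>A (f x)\<parallel>" using x A by (intro Cauchy_Schwarz) auto
    also have "\<dots> \<le> \<parallel>x\<parallel> * (C * \<parallel>f x\<parallel>)" using x C(2)[OF f(1)[OF x]] by (intro mult_left_mono) auto
    finally have "\<parallel>f x\<parallel> * \<parallel>f x\<parallel> \<le> (C * \<parallel>x\<parallel>) * \<parallel>f x\<parallel>" by (simp add: mult_ac)
    then have "\<parallel>f x\<parallel> \<le> C * \<parallel>x\<parallel>"
      using hnorm_nonneg[OF f(1)[OF x]] C(1) x by (cases "\<parallel>f x\<parallel> = 0") (auto simp: mult_le_cancel_right)
    then show "\<parallel>A' x\<parallel> \<le> C * \<parallel>x\<parallel>" using x by (simp add: A'_def)
  qed (use A in \<open>auto simp: A'_def f inner_simps intro!: ext\<close>)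
  moreover have "\<langle>A' x, y\<rangle> = \<langle>x, A y\<rangle>" if "x \<in> hcarrier H" "y \<in> hcarrier H" for x y
    using f that by (simp add: A'_def)
  ultimately show thesis using that by blast
qed

lemma pointwise_limit_bounded:
  assumes Y: "\<And>n. Y n \<in> bounded_ops H"
    and conv: "\<And>x. x \<in> hcarrier H \<Longrightarrow> converges (\<lambda>n. Y n x) (L x)"
    and bd: "\<And>n x. x \<in> hcarrier H \<Longrightarrow> \<parallel>Y n x\<parallel> \<le> C * \<parallel>x\<parallel>"
    and out: "\<And>x. x \<notin> hcarrier H \<Longrightarrow> L x = 0"
  shows "L \<in> bounded_ops H" "\<And>x. x \<in> hcarrier H \<Longrightarrow> \<parallel>L x\<parallel> \<le> C * \<parallel>x\<parallel>"
proof -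
  show le: "\<parallel>L x\<parallel> \<le> C * \<parallel>x\<parallel>" if "x \<in> hcarrier H" for x
    using bd[OF that] by (intro LIMSEQ_le_const2[OF converges_norm[OF conv[OF that]]]) blast
  show "L \<in> bounded_ops H"
  proof (rule bounded_opsI[OF out _ _ _ le])
    fix x y c assume x: "x \<in> hcarrier H" and y: "y \<in> hcarrier H"
    show "L (x + y) = L x + L y"
      using conv[of "x + y"] converges_add[OF conv[OF x] conv[OF y]] x y
      by (intro converges_unique) (simp_all add: op_add[OF Y])
  next
    fix x c assume x: "x \<in> hcarrier H"
    show "L (c *\<^sub>C x) = c *\<^sub>C L x"
      using conv[of "c *\<^sub>C x"] converges_scale[OF conv[OF x], of c] x
      by (intro converges_unique) (simp_all add: op_scale[OF Y])
  qed (use conv in \<open>auto simp: converges_def\<close>)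
qed

end

subsection \<open>Square roots\<close>

text \<open>The iteration \<open>Y \<mapsto> (1 - A + Y\<^sup>2) / 2\<close> started at \<open>0\<close> converges in operator norm to \<open>1 - sqrt A\<close>
  when \<open>0 \<le> A \<le> 1\<close>, because it is dominated by the same iteration for the real number \<open>A = 0\<close>.\<close>

primrec sqrt_iter :: "('v \<Rightarrow> 'v) \<Rightarrow> nat \<Rightarrow> 'v::complex_vector \<Rightarrow> 'v" where
  "sqrt_iter B 0 = 0"
| "sqrt_iter B (Suc n) = (1/2) *\<^sub>C (B + (sqrt_iter B n \<circ> sqrt_iter B n))"

primrec sqrt_iter_real :: "nat \<Rightarrow> real" where
  "sqrt_iter_real 0 = 0"
| "sqrt_iter_real (Suc n) = (1 + (sqrt_iter_real n)\<^sup>2) / 2"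

lemma sqrt_iter_real_bounds: "0 \<le> sqrt_iter_real n" "sqrt_iter_real n \<le> 1"
  by (induction n) (auto simp: power_le_one)

lemma sqrt_iter_real_mono: "sqrt_iter_real n \<le> sqrt_iter_real (Suc n)"
proof -
  have "0 \<le> (1 - sqrt_iter_real n)\<^sup>2" by simp
  then show ?thesis by (simp add: power2_diff)
qed

lemma sqrt_iter_real_Cauchy: "Cauchy sqrt_iter_real"
proof -
  have "convergent sqrt_iter_real"
    by (rule Bseq_mono_convergent[OF BseqI'[where K = 1]])
      (use sqrt_iter_real_bounds lift_Suc_mono_le[of sqrt_iter_real, OF sqrt_iter_real_mono] in auto)
  then show ?thesis by (rule convergent_Cauchy)
qed

context hilbert_space
begin

lemma sqrt_iter_bounded: "B \<in> bounded_ops H \<Longrightarrow> sqrt_iter B n \<in> bounded_ops H"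
  by (induction n) simp_all

text \<open>The iterates are polynomials in \<open>B\<close>. The limit inherits the commutation,
  and uniqueness of square roots depends on it.\<close>

lemma sqrt_iter_commute:
  assumes "B \<in> bounded_ops H" "C \<in> bounded_ops H" "C \<circ> B = B \<circ> C"
  shows "C \<circ> sqrt_iter B n = sqrt_iter B n \<circ> C"
proof (induction n)
  case 0
  then show ?case using assms by (auto simp: fun_eq_iff)
next
  case (Suc n)
  have Y: "sqrt_iter B n \<in> bounded_ops H" using assms by (intro sqrt_iter_bounded)
  have 1: "C (sqrt_iter B n x) = sqrt_iter B n (C x)" for x using Suc by (metis comp_apply)
  have 2: "C (B x) = B (C x)" for x using assms(3) by (metis comp_apply)
  show ?case
    using assms Y by (simp add: fun_eq_iff op_scale op_add 1 2)
qed

lemma sqrt_iter_self_adjoint: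
  assumes B: "B \<in> bounded_ops H"
    and sa: "\<And>x y. x \<in> hcarrier H \<Longrightarrow> y \<in> hcarrier H \<Longrightarrow> \<langle>B x, y\<rangle> = \<langle>x, B y\<rangle>"
    and x: "x \<in> hcarrier H" and y: "y \<in> hcarrier H"
  shows "\<langle>sqrt_iter B n x, y\<rangle> = \<langle>x, sqrt_iter B n y\<rangle>"
  using x y
proof (induction n arbitrary: x y)
  case (Suc n)
  have Y: "sqrt_iter B n \<in> bounded_ops H" using B by (rule sqrt_iter_bounded)
  show ?case using Suc B Y by (simp add: inner_simps sa)
qed simp

lemma sqrt_iter_norm:
  assumes B: "B \<in> bounded_ops H" and contr: "\<And>x. x \<in> hcarrier H \<Longrightarrow> \<parallel>B x\<parallel> \<le> \<parallel>x\<parallel>"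
    and x: "x \<in> hcarrier H"
  shows "\<parallel>sqrt_iter B n x\<parallel> \<le> sqrt_iter_real n * \<parallel>x\<parallel>"
  using x
proof (induction n arbitrary: x)
  case (Suc n)
  let ?Y = "sqrt_iter B n" and ?y = "sqrt_iter_real n"
  have Y: "?Y \<in> bounded_ops H" using B by (rule sqrt_iter_bounded)
  have "\<parallel>?Y (?Y x)\<parallel> \<le> ?y * \<parallel>?Y x\<parallel>" using Y by (intro Suc.IH) simp
  also have "\<dots> \<le> ?y * (?y * \<parallel>x\<parallel>)" using Suc by (intro mult_left_mono sqrt_iter_real_bounds) auto
  finally have 1: "\<parallel>?Y (?Y x)\<parallel> \<le> ?y\<^sup>2 * \<parallel>x\<parallel>" by (simp add: power2_eq_square mult.assoc)
  have "\<parallel>sqrt_iter B (Suc n) x\<parallel> = \<parallel>B x + ?Y (?Y x)\<parallel> / 2"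
    using B Y by (simp add: hnorm_scale)
  also have "\<dots> \<le> (\<parallel>B x\<parallel> + \<parallel>?Y (?Y x)\<parallel>) / 2"
    using B Y by (simp add: triangle)
  also have "\<dots> \<le> (1 * \<parallel>x\<parallel> + ?y\<^sup>2 * \<parallel>x\<parallel>) / 2" using contr[OF Suc.prems] 1 by simp
  also have "\<dots> = sqrt_iter_real (Suc n) * \<parallel>x\<parallel>" by (simp add: field_simps)
  finally show ?case .
qed simp

text \<open>Two successive iterates \<open>Y\<close> and \<open>Z\<close> satisfy
  \<open>Z Z - Y Y = Z (Z - Y) + (Z - Y) Y\<close>, whether or not they commute. The scalar
  iteration obeys the same identity, so its increments dominate by induction.\<close>

lemma sqrt_iter_step:
  assumes B: "B \<in> bounded_ops H" and contr: "\<And>x. x \<in> hcarrier H \<Longrightarrow> \<parallel>B x\<parallel> \<le> \<parallel>x\<parallel>"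
    and x: "x \<in> hcarrier H"
  shows "\<parallel>sqrt_iter B (Suc n) x - sqrt_iter B n x\<parallel> \<le> (sqrt_iter_real (Suc n) - sqrt_iter_real n) * \<parallel>x\<parallel>"
  using x
proof (induction n arbitrary: x)
  case 0
  then show ?case using B contr[OF 0] by (simp add: hnorm_scale)
next
  case (Suc n)
  let ?Y = "sqrt_iter B n" and ?Z = "sqrt_iter B (Suc n)"
  let ?y = "sqrt_iter_real n" and ?z = "sqrt_iter_real (Suc n)"
  have Y: "?Y \<in> bounded_ops H" and Z: "?Z \<in> bounded_ops H" using B by (auto intro!: sqrt_iter_bounded simp del: sqrt_iter.simps)
  have nn: "0 \<le> ?y" "0 \<le> ?z" "0 \<le> ?z - ?y"
    using sqrt_iter_real_bounds[of n] sqrt_iter_real_bounds[of "Suc n"] sqrt_iter_real_mono[of n] by auto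
  define D where "D x = ?Z x - ?Y x" for x
  have D: "D x \<in> hcarrier H" for x using Y Z by (simp add: D_def del: sqrt_iter.simps)
  have step: "sqrt_iter B (Suc (Suc n)) x - ?Z x = (1/2) *\<^sub>C (?Z (?Z x) - ?Y (?Y x))"
    by (simp add: complex_vector.scale_right_distrib complex_vector.scale_right_diff_distrib)
  have "?Z (?Z x) - ?Y (?Y x) = ?Z (D x) + D (?Y x)"
    using Z Y unfolding D_def by (simp add: op_diff del: sqrt_iter.simps)
  then have "\<parallel>sqrt_iter B (Suc (Suc n)) x - ?Z x\<parallel> = \<parallel>?Z (D x) + D (?Y x)\<parallel> / 2"
    unfolding step using Z D by (simp add: hnorm_scale del: sqrt_iter.simps)
  also have "\<dots> \<le> (\<parallel>?Z (D x)\<parallel> + \<parallel>D (?Y x)\<parallel>) / 2" using Z D by (simp add: triangle del: sqrt_iter.simps)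
  also have "\<dots> \<le> (?z * ((?z - ?y) * \<parallel>x\<parallel>) + (?z - ?y) * (?y * \<parallel>x\<parallel>)) / 2"
  proof -
    have "\<parallel>?Z (D x)\<parallel> \<le> ?z * \<parallel>D x\<parallel>" using B contr D by (intro sqrt_iter_norm) auto
    also have "\<dots> \<le> ?z * ((?z - ?y) * \<parallel>x\<parallel>)"
      using Suc.IH[OF Suc.prems] nn unfolding D_def by (intro mult_left_mono) auto
    finally have 1: "\<parallel>?Z (D x)\<parallel> \<le> ?z * ((?z - ?y) * \<parallel>x\<parallel>)" .
    have "\<parallel>D (?Y x)\<parallel> \<le> (?z - ?y) * \<parallel>?Y x\<parallel>" using Y unfolding D_def by (intro Suc.IH) auto
    also have "\<dots> \<le> (?z - ?y) * (?y * \<parallel>x\<parallel>)"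
      using nn by (intro mult_left_mono sqrt_iter_norm B contr Suc.prems) auto
    finally show ?thesis using 1 by simp
  qed
  also have "\<dots> = (sqrt_iter_real (Suc (Suc n)) - ?z) * \<parallel>x\<parallel>"
  proof -
    have "sqrt_iter_real (Suc (Suc n)) - ?z = (?z\<^sup>2 - ?y\<^sup>2) / 2" by (simp add: field_simps)
    moreover have "(z * ((z - y) * r) + (z - y) * (y * r)) / 2 = (z\<^sup>2 - y\<^sup>2) / 2 * r" for r y z :: real
      by (simp add: power2_eq_square field_simps)
    ultimately show ?thesis by (simp only:)
  qed
  finally show ?case .
qed

lemma sqrt_iter_diff:
  assumes B: "B \<in> bounded_ops H" and contr: "\<And>x. x \<in> hcarrier H \<Longrightarrow> \<parallel>B x\<parallel> \<le> \<parallel>x\<parallel>"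
    and x: "x \<in> hcarrier H"
  shows "\<parallel>sqrt_iter B (n + k) x - sqrt_iter B n x\<parallel> \<le> (sqrt_iter_real (n + k) - sqrt_iter_real n) * \<parallel>x\<parallel>"
proof (induction k)
  case (Suc k)
  have "\<parallel>sqrt_iter B (Suc (n + k)) x - sqrt_iter B n x\<parallel>
      \<le> \<parallel>sqrt_iter B (Suc (n + k)) x - sqrt_iter B (n + k) x\<parallel> + \<parallel>sqrt_iter B (n + k) x - sqrt_iter B n x\<parallel>"
    using B by (intro triangle_diff op_mem sqrt_iter_bounded)
  also have "\<dots> \<le> (sqrt_iter_real (Suc (n + k)) - sqrt_iter_real (n + k)) * \<parallel>x\<parallel> + (sqrt_iter_real (n + k) - sqrt_iter_real n) * \<parallel>x\<parallel>"
    by (rule add_mono[OF sqrt_iter_step[OF assms] Suc])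
  finally show ?case by (simp add: algebra_simps del: sqrt_iter.simps sqrt_iter_real.simps)
qed simp

lemma sqrt_iter_converges:
  assumes B: "B \<in> bounded_ops H" and contr: "\<And>x. x \<in> hcarrier H \<Longrightarrow> \<parallel>B x\<parallel> \<le> \<parallel>x\<parallel>"
  obtains L where "L \<in> bounded_ops H" "\<And>x. x \<in> hcarrier H \<Longrightarrow> converges (\<lambda>n. sqrt_iter B n x) (L x)"
    "\<And>x. x \<in> hcarrier H \<Longrightarrow> \<parallel>L x\<parallel> \<le> \<parallel>x\<parallel>"
proof -
  have Y: "sqrt_iter B n \<in> bounded_ops H" for n using B by (rule sqrt_iter_bounded)
  have "\<exists>l\<in>hcarrier H. (\<lambda>n. \<parallel>sqrt_iter B n x - l\<parallel>) \<longlonglongrightarrow> 0" if x: "x \<in> hcarrier H" for x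
  proof (rule Cauchy_converges)
    fix e :: real assume e: "e > 0"
    \<comment> \<open>The summand 1 in the denominator takes care of \<open>x = 0\<close>.\<close>
    define e' where "e' = e / (\<parallel>x\<parallel> + 1)"
    have "e' > 0" using e x by (simp add: e'_def add_nonneg_pos)
    then obtain N where N: "\<And>m n. m \<ge> N \<Longrightarrow> n \<ge> N \<Longrightarrow> \<bar>sqrt_iter_real m - sqrt_iter_real n\<bar> < e'"
      using sqrt_iter_real_Cauchy unfolding Cauchy_def dist_real_def by metis
    have le: "\<parallel>sqrt_iter B m x - sqrt_iter B n x\<parallel> < e" if mn: "n \<ge> N" "m \<ge> n" for m n
    proof -
      obtain k where k: "m = n + k" using mn le_Suc_ex by blast
      have "\<parallel>sqrt_iter B m x - sqrt_iter B n x\<parallel> \<le> (sqrt_iter_real m - sqrt_iter_real n) * \<parallel>x\<parallel>"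
        unfolding k by (rule sqrt_iter_diff[OF B contr x])
      also have "\<dots> \<le> e' * \<parallel>x\<parallel>" using N[of m n] mn x by (intro mult_right_mono) auto
      also have "\<dots> < e"
      proof -
        have "\<parallel>x\<parallel> + 1 > 0" using x by (simp add: add_nonneg_pos)
        then show ?thesis using e by (simp add: e'_def pos_divide_less_eq distrib_left)
      qed
      finally show ?thesis .
    qed
    show "\<exists>N. \<forall>m\<ge>N. \<forall>n\<ge>N. \<parallel>sqrt_iter B m x - sqrt_iter B n x\<parallel> < e"
      using le hnorm_minus_commute[OF op_mem[OF Y] op_mem[OF Y]] by (metis nle_le)
  qed (use Y in simp)
  then obtain f where f: "\<And>x. x \<in> hcarrier H \<Longrightarrow> f x \<in> hcarrier H \<and> (\<lambda>n. \<parallel>sqrt_iter B n x - f x\<parallel>) \<longlonglongrightarrow> 0"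
    by metis
  define L where "L x = (if x \<in> hcarrier H then f x else 0)" for x
  have conv: "converges (\<lambda>n. sqrt_iter B n x) (L x)" if "x \<in> hcarrier H" for x
    using f[OF that] Y that by (simp add: converges_def L_def)
  have bd: "\<parallel>sqrt_iter B n x\<parallel> \<le> 1 * \<parallel>x\<parallel>" if x: "x \<in> hcarrier H" for n x
    using sqrt_iter_norm[OF B contr x, of n] mult_left_le_one_le[of "\<parallel>x\<parallel>" "sqrt_iter_real n"]
      sqrt_iter_real_bounds[of n] x by simp
  note lim = pointwise_limit_bounded[where Y = "sqrt_iter B" and L = L and C = 1, OF Y conv bd]
  show thesis using lim conv by (intro that[of L]) (auto simp: L_def)
qed

text \<open>Strong limits can be multiplied when the operators are uniformly bounded:
  \<open>Y n (Y n x)\<close> and \<open>Y n (L x)\<close> differ by at most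
  \<open>\<parallel>Y n x - L x\<parallel>\<close>.\<close>

lemma converges_iterate:
  assumes Y: "\<And>n. Y n \<in> bounded_ops H" and L: "L \<in> bounded_ops H"
    and bd: "\<And>n x. x \<in> hcarrier H \<Longrightarrow> \<parallel>Y n x\<parallel> \<le> \<parallel>x\<parallel>"
    and conv: "\<And>x. x \<in> hcarrier H \<Longrightarrow> converges (\<lambda>n. Y n x) (L x)" and x: "x \<in> hcarrier H"
  shows "converges (\<lambda>n. Y n (Y n x)) (L (L x))"
proof -
  have "(\<lambda>n. \<parallel>Y n x - L x\<parallel> + \<parallel>Y n (L x) - L (L x)\<parallel>) \<longlonglongrightarrow> 0"
    using conv[OF x] conv[OF op_mem[OF L, of x]] by (intro tendsto_add_zero) (auto simp: converges_def)
  moreover have "norm \<parallel>Y n (Y n x) - L (L x)\<parallel> \<le> \<parallel>Y n x - L x\<parallel> + \<parallel>Y n (L x) - L (L x)\<parallel>" for n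
  proof -
    have "\<parallel>Y n (Y n x) - L (L x)\<parallel> \<le> \<parallel>Y n (Y n x) - Y n (L x)\<parallel> + \<parallel>Y n (L x) - L (L x)\<parallel>"
      using Y L by (intro triangle_diff) auto
    also have "\<parallel>Y n (Y n x) - Y n (L x)\<parallel> = \<parallel>Y n (Y n x - L x)\<parallel>" using Y L by (simp add: op_diff)
    also have "\<dots> \<le> \<parallel>Y n x - L x\<parallel>" using Y L by (intro bd) simp
    finally show ?thesis using Y L by simp
  qed
  ultimately have "(\<lambda>n. \<parallel>Y n (Y n x) - L (L x)\<parallel>) \<longlonglongrightarrow> 0"
    by (rule Lim_null_comparison[OF always_eventually[OF allI], rotated])
  then show ?thesis using Y L by (simp add: converges_def)
qed

lemma sqrt_exists_contraction:
  assumes A: "positive_op H A" and le: "\<And>x. x \<in> hcarrier H \<Longrightarrow> \<parallel>A x\<parallel> \<le> \<parallel>x\<parallel>"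
  obtains R where "positive_op H R" "R \<circ> R = A"
    "\<And>C. C \<in> bounded_ops H \<Longrightarrow> C \<circ> A = A \<circ> C \<Longrightarrow> C \<circ> R = R \<circ> C"
proof -
  have A': "A \<in> bounded_ops H" using A by simp
  define B where "B = ident - A"
  have B: "B \<in> bounded_ops H" using A' by (simp add: B_def)
  have Bx: "B x = x - A x" if "x \<in> hcarrier H" for x using that by (simp add: B_def)
  \<comment> \<open>The point is \<open>A\<^sup>2 \<le> A\<close>, that is \<open>\<parallel>A
    x\<parallel>\<^sup>2 \<le> Re \<langle>x, A x\<rangle>\<close>. It follows from Cauchy-Schwarz
    for the form of \<open>A\<close> at \<open>A x\<close> and \<open>x\<close>, after cancelling
    \<open>\<parallel>A x\<parallel>\<^sup>2\<close>.\<close>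
  have contr: "\<parallel>B x\<parallel> \<le> \<parallel>x\<parallel>" if x: "x \<in> hcarrier H" for x
  proof -
    have "(cmod \<langle>A x, A x\<rangle>)\<^sup>2 \<le> Re \<langle>A x, A (A x)\<rangle> * Re \<langle>x, A x\<rangle>"
      using A x by (intro positive_Cauchy_Schwarz) auto
    also have "\<dots> \<le> \<parallel>A x\<parallel>\<^sup>2 * Re \<langle>x, A x\<rangle>"
    proof (intro mult_right_mono positive_Re A x)
      have "Re \<langle>A x, A (A x)\<rangle> \<le> \<parallel>A x\<parallel> * \<parallel>A (A x)\<parallel>"
        using complex_Re_le_cmod Cauchy_Schwarz A' order_trans op_mem by meson
      also have "\<dots> \<le> \<parallel>A x\<parallel> * \<parallel>A x\<parallel>" using A' by (intro mult_left_mono le) auto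
      finally show "Re \<langle>A x, A (A x)\<rangle> \<le> \<parallel>A x\<parallel>\<^sup>2" by (simp add: power2_eq_square)
    qed
    finally have "(\<parallel>A x\<parallel>\<^sup>2)\<^sup>2 \<le> \<parallel>A x\<parallel>\<^sup>2 * Re \<langle>x, A x\<rangle>"
      using A' by (simp add: inner_self norm_power)
    then have "\<parallel>A x\<parallel>\<^sup>2 \<le> Re \<langle>x, A x\<rangle>"
      using positive_Re[OF A x] by (cases "\<parallel>A x\<parallel> = 0") (auto simp: power2_eq_square mult_le_cancel_left)
    then have "\<parallel>B x\<parallel>\<^sup>2 \<le> \<parallel>x\<parallel>\<^sup>2"
      using A' x positive_Re[OF A x] by (simp add: Bx hnorm_diff_sq)
    then show ?thesis by (rule power2_le_imp_le) (simp add: x)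
  qed
  from sqrt_iter_converges[OF B contr] obtain L where L: "L \<in> bounded_ops H"
    and conv: "\<And>x. x \<in> hcarrier H \<Longrightarrow> converges (\<lambda>n. sqrt_iter B n x) (L x)"
    and Lle: "\<And>x. x \<in> hcarrier H \<Longrightarrow> \<parallel>L x\<parallel> \<le> \<parallel>x\<parallel>" by blast
  have Y: "sqrt_iter B n \<in> bounded_ops H" for n using B by (rule sqrt_iter_bounded)
  have Yle: "\<parallel>sqrt_iter B n x\<parallel> \<le> \<parallel>x\<parallel>" if x: "x \<in> hcarrier H" for n x
    using sqrt_iter_norm[OF B contr x, of n] mult_left_le_one_le[of "\<parallel>x\<parallel>" "sqrt_iter_real n"]
      sqrt_iter_real_bounds[of n] x by simp
  \<comment> \<open>With \<open>R = ident - L\<close> and \<open>B = ident - A\<close>, this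
    fixed-point equation is \<open>R \<circ> R = A\<close> multiplied out.\<close>
  have fix_eq: "L x = (1/2) *\<^sub>C (B x + L (L x))" if x: "x \<in> hcarrier H" for x
  proof (rule converges_unique)
    show "converges (\<lambda>n. sqrt_iter B (Suc n) x) (L x)"
      using conv[OF x] LIMSEQ_Suc unfolding converges_def by blast
    have "converges (\<lambda>n. (1/2) *\<^sub>C (B x + sqrt_iter B n (sqrt_iter B n x))) ((1/2) *\<^sub>C (B x + L (L x)))"
      by (rule converges_scale[OF converges_add[OF converges_const[OF op_mem[OF B]]
              converges_iterate[OF Y L Yle conv x]]])
    then show "converges (\<lambda>n. sqrt_iter B (Suc n) x) ((1/2) *\<^sub>C (B x + L (L x)))" by simp
  qed
  have L_sa: "\<langle>L x, y\<rangle> = \<langle>x, L y\<rangle>" if x: "x \<in> hcarrier H" and y: "y \<in> hcarrier H" for x y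
  proof -
    have "\<langle>sqrt_iter B n x, y\<rangle> = \<langle>x, sqrt_iter B n y\<rangle>" for n
      using x y A' positive_self_adjoint[OF A]
      by (intro sqrt_iter_self_adjoint B) (simp_all add: Bx inner_simps)
    then show ?thesis
      using converges_inner[OF conv[OF x] converges_const[OF y]] converges_inner[OF converges_const[OF x] conv[OF y]]
      by (simp add: LIMSEQ_unique)
  qed
  have L_comm: "C \<circ> L = L \<circ> C" if C: "C \<in> bounded_ops H" and CA: "C \<circ> A = A \<circ> C" for C
  proof (rule op_ext)
    fix x assume x: "x \<in> hcarrier H"
    have "C \<circ> B = B \<circ> C"
      using C A' CA by (intro op_ext comp_bounded B) (simp_all add: Bx op_diff fun_eq_iff)
    then have comm: "C (sqrt_iter B n y) = sqrt_iter B n (C y)" for n y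
      using sqrt_iter_commute[OF B C] by (metis comp_apply)
    show "(C \<circ> L) x = (L \<circ> C) x"
      using converges_op[OF C conv[OF x]] conv[OF op_mem[OF C], of x] converges_unique by (simp add: comm)
  qed (use C L in auto)
  define R where "R = ident - L"
  have R: "R \<in> bounded_ops H" using L by (simp add: R_def)
  have Rx: "R x = x - L x" if "x \<in> hcarrier H" for x using that by (simp add: R_def)
  show thesis
  proof (rule that)
    show "positive_op H R"
      unfolding positive_op_def
    proof (intro conjI R ballI)
      fix x assume x: "x \<in> hcarrier H"
      have "Im \<langle>x, L x\<rangle> = 0"
        using L_sa[OF x x] inner_commute[OF x op_mem[OF L, of x]] by (simp add: complex_eq_iff)
      then show "Im \<langle>x, R x\<rangle> = 0" using x L by (simp add: Rx inner_simps inner_self flip: of_real_power)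
      have "Re \<langle>x, L x\<rangle> \<le> \<parallel>x\<parallel> * \<parallel>L x\<parallel>"
        using complex_Re_le_cmod Cauchy_Schwarz L x order_trans op_mem by meson
      also have "\<dots> \<le> \<parallel>x\<parallel> * \<parallel>x\<parallel>" using x by (intro mult_left_mono Lle) auto
      finally show "Re \<langle>x, R x\<rangle> \<ge> 0" using x L by (simp add: Rx inner_simps power2_eq_square flip: hnorm_sq)
    qed
    show "R \<circ> R = A"
    proof (rule op_ext)
      fix x assume x: "x \<in> hcarrier H"
      have "L x + L x = (1/2 + 1/2) *\<^sub>C (B x + L (L x))"
        unfolding scaleC_add_left using fix_eq[OF x] by simp
      then have "L x + L x = B x + L (L x)" by (simp add: scaleC_one)
      then have "A x = x - L x - (L x - L (L x))"
        unfolding Bx[OF x] by (simp add: algebra_simps)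
      then show "(R \<circ> R) x = A x" using x L by (simp add: Rx op_diff)
    qed (use R A' in auto)
    show "C \<circ> R = R \<circ> C" if C: "C \<in> bounded_ops H" and CA: "C \<circ> A = A \<circ> C" for C
      using C R L L_comm[OF C CA]
      by (intro op_ext comp_bounded R C) (simp_all add: Rx op_diff fun_eq_iff)
  qed
qed

text \<open>An operator bound \<open>c\<close> scales \<open>A\<close> to a contraction, and the
  root is scaled back by \<open>sqrt c\<close>. The last clause, that \<open>R\<close> commutes with
  whatever commutes with \<open>A\<close>, is carried along for the sake of uniqueness.\<close>

theorem sqrt_exists:
  assumes A: "positive_op H A"
  obtains R where "positive_op H R" "R \<circ> R = A"
    "\<And>C. C \<in> bounded_ops H \<Longrightarrow> C \<circ> A = A \<circ> C \<Longrightarrow> C \<circ> R = R \<circ> C"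
proof -
  have A': "A \<in> bounded_ops H" using A by simp
  from op_bound[OF A'] obtain c where c: "c > 0" "\<And>x. x \<in> hcarrier H \<Longrightarrow> \<parallel>A x\<parallel> \<le> c * \<parallel>x\<parallel>" by blast
  let ?A = "of_real (1 / c) *\<^sub>C A"
  have A1: "positive_op H ?A" using c by (intro positive_scale A) auto
  have A2: "\<parallel>?A x\<parallel> \<le> \<parallel>x\<parallel>" if "x \<in> hcarrier H" for x
    using c that A' by (simp add: hnorm_scale norm_divide field_simps)
  show thesis
  proof (rule sqrt_exists_contraction[OF A1 A2])
    fix R assume R: "positive_op H R" "R \<circ> R = ?A"
      and comm: "\<And>C. C \<in> bounded_ops H \<Longrightarrow> C \<circ> ?A = ?A \<circ> C \<Longrightarrow> C \<circ> R = R \<circ> C"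
    let ?R = "of_real (sqrt c) *\<^sub>C R"
    have R': "R \<in> bounded_ops H" using R by simp
    have sq: "of_real (sqrt c) * of_real (sqrt c) = (of_real c :: complex)"
      using c by (simp flip: of_real_mult)
    show thesis
    proof (rule that)
      show "positive_op H ?R" using c by (intro positive_scale R) auto
      have "R (R x) = of_real (1 / c) *\<^sub>C A x" for x using R(2) by (metis comp_apply scaleC_fun_apply)
      then show "?R \<circ> ?R = A"
        using c R' by (simp add: fun_eq_iff op_scale scaleC_scaleC sq scaleC_one flip: mult.assoc)
      show "C \<circ> ?R = ?R \<circ> C" if C: "C \<in> bounded_ops H" and CA: "C \<circ> A = A \<circ> C" for C
      proof -
        have "C (A x) = A (C x)" for x using CA by (metis comp_apply)
        then have "C \<circ> R = R \<circ> C" using A' C by (intro comm C) (simp add: fun_eq_iff op_scale)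
        then have "C (R x) = R (C x)" for x by (metis comp_apply)
        then show ?thesis using R' C by (simp add: fun_eq_iff op_scale)
      qed
    qed
  qed
qed

text \<open>Any root \<open>S\<close> commutes with its own square, hence with the root
  \<open>R\<close> from \<open>sqrt_exists\<close>, so \<open>(R + S) (R - S) = 0\<close>. For
  \<open>d = (R - S) x\<close> positivity then forces \<open>R d = S d = 0\<close>, and moving
  \<open>R - S\<close> across the inner product shows \<open>\<langle>d, d\<rangle> = 0\<close>.
  Both given roots therefore equal \<open>R\<close>.\<close>

lemma sqrt_unique:
  assumes P: "positive_op H P" and Q: "positive_op H Q" and eq: "P \<circ> P = Q \<circ> Q"
  shows "P = Q"
proof -
  have "positive_op H (P \<circ> P)"
    using P positive_self_adjoint[OF P] by (intro positive_conj[of P]) auto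
  from sqrt_exists[OF this] obtain R where R: "positive_op H R" "R \<circ> R = P \<circ> P"
    and comm: "\<And>C. C \<in> bounded_ops H \<Longrightarrow> C \<circ> (P \<circ> P) = P \<circ> P \<circ> C \<Longrightarrow> C \<circ> R = R \<circ> C" by blast
  have "R = S" if S: "positive_op H S" and S2: "S \<circ> S = P \<circ> P" for S
  proof (rule op_ext)
    have bS: "S \<in> bounded_ops H" and bR: "R \<in> bounded_ops H" using S R by auto
    have "S \<circ> R = R \<circ> S" unfolding S2[symmetric] by (rule comm) (simp_all add: bS comp_assoc flip: S2)
    then have SR: "S (R x) = R (S x)" for x by (metis comp_apply)
    have SS: "S (S x) = R (R x)" for x using S2 R(2) by (metis comp_apply)
    fix x assume x: "x \<in> hcarrier H"
    define d where "d = R x - S x"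
    have d: "d \<in> hcarrier H" using bS bR by (simp add: d_def)
    have "R d + S d = 0" using bS bR by (simp add: d_def op_diff SR SS)
    then have "\<langle>d, R d\<rangle> + \<langle>d, S d\<rangle> = 0"
      using inner_add_right[OF d op_mem[OF bR] op_mem[OF bS], of d d] d by simp
    then have "Re \<langle>d, R d\<rangle> + Re \<langle>d, S d\<rangle> = 0" by (metis plus_complex.sel(1) zero_complex.sel(1))
    then have z: "Re \<langle>d, R d\<rangle> = 0" "Re \<langle>d, S d\<rangle> = 0"
      using positive_Re[OF R(1) d] positive_Re[OF S d] by auto
    have "R d = 0" "S d = 0"
      using positive_zero_iff[OF R(1) d z(1)] positive_zero_iff[OF S d z(2)] by auto
    then have "\<langle>d, d\<rangle> = 0"
      using d x bS bR positive_self_adjoint[OF R(1) x d] positive_self_adjoint[OF S x d]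
      by (subst (1) d_def) (simp add: inner_diff_left)
    then have "d = 0" using d by (intro inner_eq_zero)
    then show "R x = S x" by (simp add: d_def)
  qed (use S R in auto)
  then show ?thesis using P Q eq by metis
qed

subsection \<open>The absolute value\<close>

lemma abs_op_eqI:
  assumes T: "T \<in> bounded_ops H" and P: "positive_op H P"
    and eq: "\<And>x y. x \<in> hcarrier H \<Longrightarrow> y \<in> hcarrier H \<Longrightarrow> \<langle>x, P (P y)\<rangle> = \<langle>T x, T y\<rangle>"
  shows "abs_op H T = P"
  unfolding abs_op_def
proof (rule the_equality)
  fix Q assume Q: "positive_op H Q \<and> (\<forall>x\<in>hcarrier H. \<forall>y\<in>hcarrier H. \<langle>x, Q (Q y)\<rangle> = \<langle>T x, T y\<rangle>)"
  have "Q \<circ> Q = P \<circ> P" using Q P eq by (intro op_ext_inner) auto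
  then show "Q = P" using sqrt_unique[OF conjunct1[OF Q] P] by blast
qed (use P eq in auto)

lemma
  assumes T: "T \<in> bounded_ops H"
  shows abs_op_positive: "positive_op H (abs_op H T)"
    and abs_op_square: "\<And>x y. x \<in> hcarrier H \<Longrightarrow> y \<in> hcarrier H \<Longrightarrow>
      \<langle>abs_op H T x, abs_op H T y\<rangle> = \<langle>T x, T y\<rangle>"
proof -
  obtain T' where T': "T' \<in> bounded_ops H"
    "\<And>x y. x \<in> hcarrier H \<Longrightarrow> y \<in> hcarrier H \<Longrightarrow> \<langle>T' x, y\<rangle> = \<langle>x, T y\<rangle>"
    using adjoint_exists[OF T] by blast
  have T'': "\<langle>x, T' y\<rangle> = \<langle>T x, y\<rangle>" if "x \<in> hcarrier H" "y \<in> hcarrier H" for x y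
    using T'(2)[OF that(2,1)] T T'(1) that inner_commute by (metis op_mem)
  have pos: "positive_op H (T' \<circ> T)" using T T' T'' by (intro positive_conj[of T]) auto
  obtain P where P: "positive_op H P" "P \<circ> P = T' \<circ> T" by (rule sqrt_exists[OF pos]) (rule that)
  have "\<langle>x, P (P y)\<rangle> = \<langle>T x, T y\<rangle>" if "x \<in> hcarrier H" "y \<in> hcarrier H" for x y
    using P(2) T T'' that by (metis comp_apply op_mem)
  then have "abs_op H T = P" "\<And>x y. x \<in> hcarrier H \<Longrightarrow> y \<in> hcarrier H \<Longrightarrow> \<langle>P x, P y\<rangle> = \<langle>T x, T y\<rangle>"
    using abs_op_eqI[OF T P(1)] positive_self_adjoint[OF P(1)] P(1) by auto
  then show "positive_op H (abs_op H T)" "\<And>x y. x \<in> hcarrier H \<Longrightarrow> y \<in> hcarrier H \<Longrightarrow>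
      \<langle>abs_op H T x, abs_op H T y\<rangle> = \<langle>T x, T y\<rangle>"
    using P by auto
qed

lemma abs_op_of_positive: "positive_op H P \<Longrightarrow> abs_op H P = P"
  by (intro abs_op_eqI) (auto simp: positive_self_adjoint)

text \<open>\<open>V\<close> is the adjoint of the partial isometry in the polar decomposition of \<open>T\<close>.\<close>

lemma polar_decomposition:
  assumes T: "T \<in> bounded_ops H"
  obtains V where "V \<in> bounded_ops H" "\<And>x. x \<in> hcarrier H \<Longrightarrow> \<parallel>V x\<parallel> \<le> \<parallel>x\<parallel>"
    "\<And>x y. x \<in> hcarrier H \<Longrightarrow> y \<in> hcarrier H \<Longrightarrow> \<langle>V y, abs_op H T x\<rangle> = \<langle>y, T x\<rangle>"
    "\<And>x. x \<in> hcarrier H \<Longrightarrow> V (T x) = abs_op H T x"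
proof -
  let ?P = "abs_op H T"
  have P: "?P \<in> bounded_ops H" using abs_op_positive[OF T] by simp
  have norm: "\<parallel>?P x\<parallel> = \<parallel>T x\<parallel>" if "x \<in> hcarrier H" for x
    using abs_op_square[OF T that that] by (simp add: hnorm_def)
  define W where "W = ?P ` hcarrier H"
  have W: "complex_vector.subspace W" "W \<subseteq> hcarrier H"
  proof -
    show "W \<subseteq> hcarrier H" using P by (auto simp: W_def)
    show "complex_vector.subspace W"
      unfolding complex_vector.subspace_def W_def
      using P by (auto simp flip: op_add op_scale intro: image_eqI[of _ _ 0])
  qed
  \<comment> \<open>Equality of norms makes \<open>abs_op H T x \<mapsto> T x\<close> well defined;
    \<open>G\<close> is this isometry on the range \<open>W\<close>.\<close>
  have inj: "T x = T x'" if "?P x = ?P x'" "x \<in> hcarrier H" "x' \<in> hcarrier H" for x x'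
  proof -
    have "\<parallel>T (x - x')\<parallel> = 0" using norm[of "x - x'"] that P by (simp add: op_diff)
    then show ?thesis using hnorm_eq_zero[of "T (x - x')"] T that by (simp add: op_diff)
  qed
  define G where "G w = T (SOME x. x \<in> hcarrier H \<and> ?P x = w)" for w
  have G: "G (?P x) = T x" if x: "x \<in> hcarrier H" for x
  proof -
    have "(SOME z. z \<in> hcarrier H \<and> ?P z = ?P x) \<in> hcarrier H \<and> ?P (SOME z. z \<in> hcarrier H \<and> ?P z = ?P x) = ?P x"
      by (rule someI[of _ x]) (use x in auto)
    then show ?thesis unfolding G_def using x by (intro inj) auto
  qed
  \<comment> \<open>The adjoint of the isometry \<open>G\<close> is obtained directly: its value at
    \<open>y\<close> represents \<open>w \<mapsto> \<langle>y, G w\<rangle>\<close> on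
    \<open>W\<close>. In this way \<open>G\<close> need not be extended to the closure of
    \<open>W\<close>.\<close>
  have "\<exists>v X. converges X v \<and> (\<forall>n. X n \<in> W) \<and> (\<forall>x\<in>hcarrier H. \<langle>v, ?P x\<rangle> = \<langle>y, T x\<rangle>)"
    if y: "y \<in> hcarrier H" for y
  proof -
    have 1: "\<langle>y, G (a + b)\<rangle> = \<langle>y, G a\<rangle> + \<langle>y, G b\<rangle>" if ab: "a \<in> W" "b \<in> W" for a b
    proof -
      from ab obtain u v where uv: "u \<in> hcarrier H" "v \<in> hcarrier H" "a = ?P u" "b = ?P v"
        unfolding W_def by blast
      then have "G (a + b) = T (u + v)" using G[of "u + v"] by (simp add: op_add[OF P])
      then show ?thesis using uv y T by (simp add: G op_add inner_add_right)
    qed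
    have 2: "\<langle>y, G (c *\<^sub>C a)\<rangle> = c * \<langle>y, G a\<rangle>" if a: "a \<in> W" for a c
    proof -
      from a obtain u where u: "u \<in> hcarrier H" "a = ?P u" unfolding W_def by blast
      then have "G (c *\<^sub>C a) = T (c *\<^sub>C u)" using G[of "c *\<^sub>C u"] by (simp add: op_scale[OF P])
      then show ?thesis using u y T by (simp add: G op_scale inner_scale_right)
    qed
    have 3: "cmod \<langle>y, G a\<rangle> \<le> \<parallel>y\<parallel> * \<parallel>a\<parallel>" if "a \<in> W" for a
      using that y T Cauchy_Schwarz[OF y] unfolding W_def by (auto simp: G norm)
    show ?thesis
    proof (rule Riesz_representation[OF W, of "\<lambda>w. \<langle>y, G w\<rangle>" "\<parallel>y\<parallel>"])
      fix v X assume *: "converges X v" "\<And>n. X n \<in> W" "\<And>h. h \<in> W \<Longrightarrow> \<langle>y, G h\<rangle> = \<langle>v, h\<rangle>"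
      have "\<langle>v, ?P x\<rangle> = \<langle>y, T x\<rangle>" if "x \<in> hcarrier H" for x
        using *(3)[of "?P x"] G[OF that] that unfolding W_def by simp
      then show ?thesis using * by blast
    qed (fact 1 2 3)+
  qed
  then obtain V0 where V0: "\<And>y. y \<in> hcarrier H \<Longrightarrow> \<exists>X. converges X (V0 y) \<and> (\<forall>n. X n \<in> W)"
    "\<And>x y. x \<in> hcarrier H \<Longrightarrow> y \<in> hcarrier H \<Longrightarrow> \<langle>V0 y, ?P x\<rangle> = \<langle>y, T x\<rangle>"
    by metis
  \<comment> \<open>The closure of \<open>W\<close>. The Riesz vectors lie in it, and a vector of
    \<open>cl\<close> is determined by its inner products with \<open>W\<close>; linearity of
    \<open>V0\<close> and its values on the range of \<open>T\<close> are deduced from this.\<close>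
  define cl where "cl = {v. \<exists>X. converges X v \<and> (\<forall>n. X n \<in> W)}"
  have cl_mem: "v \<in> hcarrier H" if "v \<in> cl" for v using that by (auto simp: cl_def converges_def)
  have cl_add: "u + v \<in> cl" if "u \<in> cl" "v \<in> cl" for u v
    using that converges_add complex_vector.subspace_add[OF W(1)] unfolding cl_def by blast
  have cl_scale: "c *\<^sub>C v \<in> cl" if "v \<in> cl" for c v
    using that converges_scale complex_vector.subspace_scale[OF W(1)] unfolding cl_def by blast
  have cl_W: "v \<in> cl" if "v \<in> W" for v
    using that W(2) converges_const unfolding cl_def by blast
  have cl_eq: "u = v" if u: "u \<in> cl" and v: "v \<in> cl"
    and eq: "\<And>x. x \<in> hcarrier H \<Longrightarrow> \<langle>u, ?P x\<rangle> = \<langle>v, ?P x\<rangle>" for u v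
  proof -
    have uv: "u \<in> hcarrier H" "v \<in> hcarrier H" using cl_mem u v by auto
    have "u + (-1) *\<^sub>C v \<in> cl" using u v by (intro cl_add cl_scale)
    then obtain X where X: "converges X (u - v)" "\<And>n. X n \<in> W" by (auto simp: cl_def scaleC_one)
    have "\<langle>u - v, X n\<rangle> = 0" for n
      using X(2)[of n] uv eq P unfolding W_def by (auto simp: inner_diff_left)
    then have "\<langle>u - v, u - v\<rangle> = 0"
      using converges_inner[OF converges_const[of "u - v"] X(1)] uv by (simp add: LIMSEQ_const_iff)
    then show ?thesis using inner_eq_zero[of "u - v"] uv by simp
  qed
  have V0cl: "V0 y \<in> cl" if "y \<in> hcarrier H" for y using V0(1)[OF that] by (simp add: cl_def)
  define V where "V y = (if y \<in> hcarrier H then V0 y else 0)" for y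
  have V0H: "V0 y \<in> hcarrier H" if "y \<in> hcarrier H" for y using V0cl cl_mem that by blast
  \<comment> \<open>\<open>V0 y\<close> is tested against vectors of \<open>W\<close> converging to
    it, on which \<open>\<langle>V0 y, _\<rangle>\<close> is bounded by
    \<open>\<parallel>y\<parallel>\<close> times the norm.\<close>
  have le: "\<parallel>V0 y\<parallel> \<le> \<parallel>y\<parallel>" if y: "y \<in> hcarrier H" for y
  proof -
    obtain X where X: "converges X (V0 y)" "\<And>n. X n \<in> W" using V0(1)[OF y] by blast
    have XH: "X n \<in> hcarrier H" for n using X(2) W(2) by blast
    have "cmod \<langle>V0 y, X n\<rangle> \<le> \<parallel>y\<parallel> * \<parallel>X n\<parallel>" for n
      using X(2)[of n] V0(2)[OF _ y] T Cauchy_Schwarz[OF y] unfolding W_def by (auto simp: norm)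
    moreover have "(\<lambda>n. cmod \<langle>V0 y, X n\<rangle>) \<longlonglongrightarrow> cmod \<langle>V0 y, V0 y\<rangle>"
      by (intro tendsto_norm converges_inner converges_const X(1) V0H y)
    moreover have "(\<lambda>n. \<parallel>y\<parallel> * \<parallel>X n\<parallel>) \<longlonglongrightarrow> \<parallel>y\<parallel> * \<parallel>V0 y\<parallel>"
      by (intro tendsto_mult tendsto_const converges_norm X(1))
    ultimately have "cmod \<langle>V0 y, V0 y\<rangle> \<le> \<parallel>y\<parallel> * \<parallel>V0 y\<parallel>" using LIMSEQ_le by blast
    then have "\<parallel>V0 y\<parallel> * \<parallel>V0 y\<parallel> \<le> \<parallel>y\<parallel> * \<parallel>V0 y\<parallel>"
      using V0H[OF y] by (simp add: inner_self norm_power power2_eq_square norm_mult)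
    then show ?thesis using hnorm_nonneg[OF V0H[OF y]] y
      by (cases "\<parallel>V0 y\<parallel> = 0") (auto simp: mult_le_cancel_right)
  qed
  have "V \<in> bounded_ops H"
  proof (rule bounded_opsI[where C = 1])
    fix x y assume x: "x \<in> hcarrier H" and y: "y \<in> hcarrier H"
    have "V0 (x + y) = V0 x + V0 y"
      using x y P T V0H by (intro cl_eq cl_add V0cl add_mem) (auto simp: V0(2) inner_add_left)
    then show "V (x + y) = V x + V y" using x y by (simp add: V_def)
  next
    fix x c assume x: "x \<in> hcarrier H"
    have "V0 (c *\<^sub>C x) = c *\<^sub>C V0 x"
      using x P T V0H by (intro cl_eq cl_scale V0cl scale_mem) (auto simp: V0(2) inner_scale_left)
    then show "V (c *\<^sub>C x) = c *\<^sub>C V x" using x by (simp add: V_def)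
  qed (use le V0H in \<open>auto simp: V_def\<close>)
  moreover have "V0 (T x) = ?P x" if x: "x \<in> hcarrier H" for x
  proof (rule cl_eq)
    show "?P x \<in> cl" using x by (intro cl_W) (simp add: W_def)
  qed (use x T V0cl in \<open>auto simp: V0(2) abs_op_square\<close>)
  ultimately show thesis using le V0 T by (intro that[of V]) (auto simp: V_def)
qed

end

section \<open>Orthonormal bases\<close>

context inner_product_space
begin

definition orthonormal :: "'v set \<Rightarrow> bool" where
  "orthonormal B \<longleftrightarrow> B \<subseteq> hcarrier H \<and> (\<forall>e\<in>B. \<forall>f\<in>B. \<langle>e, f\<rangle> = (if e = f then 1 else 0))"

lemma orthonormal_basis_iff:
  "orthonormal_basis H B \<longleftrightarrow> orthonormal B \<and> dense_in H (complex_vector.span B)"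
  by (auto simp: orthonormal_basis_def orthonormal_def)

lemma onb_mem: "orthonormal_basis H B \<Longrightarrow> e \<in> B \<Longrightarrow> e \<in> hcarrier H"
  by (auto simp: orthonormal_basis_def)

text \<open>Completing the square in the coefficients. Taking the Fourier coefficients for
  \<open>r\<close> gives Bessel's inequality; dropping the last sum shows that no other combination
  over \<open>F\<close> approximates better.\<close>

lemma norm_diff_combination:
  assumes B: "orthonormal B" and F: "finite F" "F \<subseteq> B" and x: "x \<in> hcarrier H"
  shows "\<parallel>x - (\<Sum>e\<in>F. r e *\<^sub>C e)\<parallel>\<^sup>2 =
    \<parallel>x\<parallel>\<^sup>2 - (\<Sum>e\<in>F. (cmod \<langle>e, x\<rangle>)\<^sup>2) + (\<Sum>e\<in>F. (cmod (\<langle>e, x\<rangle> - r e))\<^sup>2)"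
proof -
  have FH: "e \<in> hcarrier H" if "e \<in> F" for e using that B F by (auto simp: orthonormal_def)
  let ?y = "\<Sum>e\<in>F. r e *\<^sub>C e"
  have y: "?y \<in> hcarrier H" using FH by (intro sum_mem) auto
  have xy: "\<langle>x, ?y\<rangle> = (\<Sum>e\<in>F. r e * \<langle>x, e\<rangle>)"
    using x FH by (simp add: inner_sum_right inner_scale_right)
  have ey: "\<langle>e, ?y\<rangle> = r e" if e: "e \<in> F" for e
  proof -
    have "\<langle>e, ?y\<rangle> = (\<Sum>f\<in>F. r f * \<langle>e, f\<rangle>)"
      using FH e by (simp add: inner_sum_right inner_scale_right)
    also have "\<dots> = (\<Sum>f\<in>F. if f = e then r f else 0)"
    proof (rule sum.cong[OF refl])
      fix f assume "f \<in> F"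
      then have "e \<in> B" "f \<in> B" using e F by auto
      then show "r f * \<langle>e, f\<rangle> = (if f = e then r f else 0)" using B by (auto simp: orthonormal_def)
    qed
    finally show ?thesis using e F by simp
  qed
  have "\<langle>?y, ?y\<rangle> = (\<Sum>e\<in>F. cnj (r e) * \<langle>e, ?y\<rangle>)"
    using FH y by (subst inner_sum_left) (simp_all add: inner_scale_left)
  also have "\<dots> = (\<Sum>e\<in>F. of_real ((cmod (r e))\<^sup>2))"
    using ey by (intro sum.cong) (simp_all add: complex_norm_square mult.commute del: of_real_power)
  finally have yy: "\<parallel>?y\<parallel>\<^sup>2 = (\<Sum>e\<in>F. (cmod (r e))\<^sup>2)"
    using y by (simp add: hnorm_sq del: of_real_power)
  have "(cmod (\<langle>e, x\<rangle> - r e))\<^sup>2 = (cmod \<langle>e, x\<rangle>)\<^sup>2 - 2 * Re (r e * \<langle>x, e\<rangle>) + (cmod (r e))\<^sup>2" if "e \<in> F" for e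
    using inner_commute[OF x FH[OF that]]
    unfolding cmod_power2 by (simp add: power2_eq_square algebra_simps)
  then have "(\<Sum>e\<in>F. (cmod (\<langle>e, x\<rangle> - r e))\<^sup>2) =
      (\<Sum>e\<in>F. (cmod \<langle>e, x\<rangle>)\<^sup>2) - 2 * Re \<langle>x, ?y\<rangle> + \<parallel>?y\<parallel>\<^sup>2"
    unfolding xy yy by (simp add: sum.distrib sum_subtractf sum_distrib_left)
  then show ?thesis unfolding hnorm_diff_sq[OF x y] by simp
qed

lemma Parseval:
  assumes B: "orthonormal_basis H B" and x: "x \<in> hcarrier H"
  shows "((\<lambda>e. (cmod \<langle>e, x\<rangle>)\<^sup>2) has_sum \<parallel>x\<parallel>\<^sup>2) B"
proof -
  have on: "orthonormal B" and dense: "dense_in H (complex_vector.span B)"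
    using B by (auto simp: orthonormal_basis_iff)
  have Bessel: "(\<Sum>e\<in>F. (cmod \<langle>e, x\<rangle>)\<^sup>2) \<le> \<parallel>x\<parallel>\<^sup>2" if F: "finite F" "F \<subseteq> B" for F
    using norm_diff_combination[OF on F x, of "\<lambda>e. \<langle>e, x\<rangle>"]
      zero_le_power2[of "\<parallel>x - (\<Sum>e\<in>F. \<langle>e, x\<rangle> *\<^sub>C e)\<parallel>"] by simp
  have summ: "(\<lambda>e. (cmod \<langle>e, x\<rangle>)\<^sup>2) summable_on B"
    using Bessel by (intro nonneg_bdd_above_summable_on bdd_aboveI2[of _ _ "\<parallel>x\<parallel>\<^sup>2"]) auto
  \<comment> \<open>A vector of the span near \<open>x\<close> involves finitely many basis vectors,
    and their Fourier coefficients approximate at least as well. Distances enter squared, whence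
    \<open>sqrt \<epsilon>\<close>.\<close>
  have ge: "\<parallel>x\<parallel>\<^sup>2 \<le> infsum (\<lambda>e. (cmod \<langle>e, x\<rangle>)\<^sup>2) B"
  proof (rule field_le_epsilon)
    fix \<epsilon> :: real assume \<epsilon>: "\<epsilon> > 0"
    then obtain y where y: "y \<in> complex_vector.span B" "\<parallel>x - y\<parallel> < sqrt \<epsilon>"
      using dense x unfolding dense_in_def by (meson real_sqrt_gt_zero)
    then obtain F r where F: "finite F" "F \<subseteq> B" and yF: "y = (\<Sum>a\<in>F. r a *\<^sub>C a)"
      unfolding complex_vector.span_explicit by blast
    have yH: "y \<in> hcarrier H" using y(1) dense unfolding dense_in_def by blast
    have "\<parallel>x\<parallel>\<^sup>2 - (\<Sum>e\<in>F. (cmod \<langle>e, x\<rangle>)\<^sup>2) \<le> \<parallel>x - y\<parallel>\<^sup>2"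
      unfolding yF norm_diff_combination[OF on F x] by (simp add: sum_nonneg)
    also have "\<dots> \<le> (sqrt \<epsilon>)\<^sup>2" using y(2) x yH by (intro power_mono) auto
    finally have "\<parallel>x\<parallel>\<^sup>2 \<le> (\<Sum>e\<in>F. (cmod \<langle>e, x\<rangle>)\<^sup>2) + \<epsilon>" using \<epsilon> by simp
    also have "(\<Sum>e\<in>F. (cmod \<langle>e, x\<rangle>)\<^sup>2) \<le> infsum (\<lambda>e. (cmod \<langle>e, x\<rangle>)\<^sup>2) B"
      using F by (intro finite_sum_le_infsum summ) auto
    finally show "\<parallel>x\<parallel>\<^sup>2 \<le> infsum (\<lambda>e. (cmod \<langle>e, x\<rangle>)\<^sup>2) B + \<epsilon>" by simp
  qed
  have "infsum (\<lambda>e. (cmod \<langle>e, x\<rangle>)\<^sup>2) B \<le> \<parallel>x\<parallel>\<^sup>2"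
    using summ Bessel by (rule infsum_le_finite_sums)
  with ge have "infsum (\<lambda>e. (cmod \<langle>e, x\<rangle>)\<^sup>2) B = \<parallel>x\<parallel>\<^sup>2" by simp
  then show ?thesis using has_sum_infsum[OF summ] by simp
qed

text \<open>The rank-one operator |v><v|, which is an orthogonal projection when \<open>v\<close> is
  a unit vector.\<close>

definition proj :: "'v \<Rightarrow> 'v \<Rightarrow> 'v" where
  "proj v x = (if x \<in> hcarrier H then \<langle>v, x\<rangle> *\<^sub>C v else 0)"

lemma proj_apply: "x \<in> hcarrier H \<Longrightarrow> proj v x = \<langle>v, x\<rangle> *\<^sub>C v"
  by (simp add: proj_def)

lemma proj_bounded [simp]:
  assumes v: "v \<in> hcarrier H" shows "proj v \<in> bounded_ops H"
proof (rule bounded_opsI)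
  fix x assume x: "x \<in> hcarrier H"
  show "\<parallel>proj v x\<parallel> \<le> (\<parallel>v\<parallel> * \<parallel>v\<parallel>) * \<parallel>x\<parallel>"
    using mult_right_mono[OF Cauchy_Schwarz[OF v x] hnorm_nonneg[OF v]] v x
    by (simp add: proj_def hnorm_scale mult_ac)
qed (use v in \<open>auto simp: proj_def inner_simps scaleC_add_left scaleC_scaleC\<close>)

lemma inner_proj: "\<lbrakk>v \<in> hcarrier H; x \<in> hcarrier H; y \<in> hcarrier H\<rbrakk> \<Longrightarrow> \<langle>x, proj v y\<rangle> = \<langle>x, v\<rangle> * \<langle>v, y\<rangle>"
  by (simp add: proj_def inner_simps)

lemma inner_proj_self: "\<lbrakk>v \<in> hcarrier H; x \<in> hcarrier H\<rbrakk> \<Longrightarrow> \<langle>x, proj v x\<rangle> = of_real ((cmod \<langle>v, x\<rangle>)\<^sup>2)"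
  using inner_commute[of x v] complex_norm_square[of "\<langle>v, x\<rangle>"] by (simp add: inner_proj mult.commute)

text \<open>Parseval is polarized. As \<open>(cmod \<langle>e, z\<rangle>)\<^sup>2\<close> is the
  quadratic form of \<open>proj e\<close>, the general \<open>polarization\<close> serves on both
  sides, with \<open>ident\<close> for the total and \<open>proj e\<close> for each summand.\<close>

lemma Parseval_inner:
  assumes B: "orthonormal_basis H B" and x: "x \<in> hcarrier H" and y: "y \<in> hcarrier H"
  shows "((\<lambda>e. \<langle>x, e\<rangle> * \<langle>e, y\<rangle>) has_sum \<langle>x, y\<rangle>) B"
proof -
  define z where "z k = x + \<i> ^ k *\<^sub>C y" for k :: nat
  have z: "z k \<in> hcarrier H" for k using x y by (simp add: z_def)
  have "((\<lambda>e. (-\<i>) ^ k * of_real ((cmod \<langle>e, z k\<rangle>)\<^sup>2)) has_sum ((-\<i>) ^ k * of_real (\<parallel>z k\<parallel>\<^sup>2))) B" for k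
    by (intro has_sum_cmult_right has_sum_of_real Parseval B z)
  then have sum: "((\<lambda>e. \<Sum>k<4. (-\<i>) ^ k * of_real ((cmod \<langle>e, z k\<rangle>)\<^sup>2)) has_sum (\<Sum>k<4. (-\<i>) ^ k * of_real (\<parallel>z k\<parallel>\<^sup>2))) B"
    unfolding sum_lessThan_4 by (intro has_sum_add)
  have eq1: "(\<Sum>k<4. (-\<i>) ^ k * of_real (\<parallel>z k\<parallel>\<^sup>2)) = 4 * \<langle>x, y\<rangle>"
    using polarization[OF ident_bounded x y] z y unfolding z_def[symmetric]
    by (simp add: inner_self del: of_real_power)
  have eq2: "(\<Sum>k<4. (-\<i>) ^ k * of_real ((cmod \<langle>e, z k\<rangle>)\<^sup>2)) = 4 * (\<langle>x, e\<rangle> * \<langle>e, y\<rangle>)" if "e \<in> B" for e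
    using polarization[OF proj_bounded x y, of e] onb_mem[OF B that] z x y unfolding z_def[symmetric]
    by (simp add: inner_proj_self inner_proj del: of_real_power)
  have "((\<lambda>e. 4 * (\<langle>x, e\<rangle> * \<langle>e, y\<rangle>)) has_sum (4 * \<langle>x, y\<rangle>)) B"
    using iffD1[OF has_sum_cong[OF eq2] sum] unfolding eq1 .
  from has_sum_cmult_right[OF this, of "1/4"] show ?thesis by simp
qed

text \<open>The nonnegative double family \<open>(cmod \<langle>f, A e\<rangle>)\<^sup>2\<close> is
  summed in both orders. Having two bases in the statement yields invariance under adjoints and
  independence of the basis at once.\<close>

lemma HilbertSchmidt_adjoint:
  assumes A: "A \<in> bounded_ops H" "A' \<in> bounded_ops H"
    and adj: "\<And>x y. x \<in> hcarrier H \<Longrightarrow> y \<in> hcarrier H \<Longrightarrow> \<langle>A' x, y\<rangle> = \<langle>x, A y\<rangle>"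
    and B: "orthonormal_basis H B" and C: "orthonormal_basis H C"
    and sum: "((\<lambda>f. \<parallel>A' f\<parallel>\<^sup>2) has_sum s) C"
  shows "((\<lambda>e. \<parallel>A e\<parallel>\<^sup>2) has_sum s) B"
proof -
  define g where "g = (\<lambda>(f, e). (cmod \<langle>f, A e\<rangle>)\<^sup>2)"
  have 1: "((\<lambda>e. g (f, e)) has_sum \<parallel>A' f\<parallel>\<^sup>2) B" if f: "f \<in> C" for f
  proof -
    have "cmod \<langle>e, A' f\<rangle> = cmod \<langle>f, A e\<rangle>" if "e \<in> B" for e
      using adj[OF onb_mem[OF C f] onb_mem[OF B that]] inner_commute[of e "A' f"] A onb_mem[OF B that]
      by simp
    then show ?thesis
      using Parseval[OF B, of "A' f"] A by (simp add: g_def cong: has_sum_cong)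
  qed
  have "g summable_on (C \<times> B)"
    using 1 sum by (intro summable_on_SigmaI[where g = "\<lambda>f. \<parallel>A' f\<parallel>\<^sup>2"]) (auto simp: g_def summable_on_def)
  then have "(g has_sum s) (C \<times> B)" using 1 sum by (intro has_sum_SigmaI)
  then have "((\<lambda>(e, f). g (f, e)) has_sum s) (B \<times> C)" by (subst (asm) has_sum_swap)
  then show ?thesis
  proof (rule has_sum_SigmaD)
    fix e assume e: "e \<in> B"
    show "((\<lambda>f. case (e, f) of (e, f) \<Rightarrow> g (f, e)) has_sum \<parallel>A e\<parallel>\<^sup>2) C"
      using Parseval[OF C, of "A e"] A by (simp add: g_def)
  qed
qed

end

lemma (in hilbert_space) orthonormal_basis_exists: "\<exists>B. orthonormal_basis H B"
proof -
  have "\<exists>M\<in>Collect orthonormal. \<forall>X\<in>Collect orthonormal. M \<subseteq> X \<longrightarrow> X = M"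
  proof (rule subset_Zorn_nonempty)
    show "Collect orthonormal \<noteq> {}" by (auto simp: orthonormal_def intro: exI[of _ "{}"])
    fix \<C> assume ne: "\<C> \<noteq> {}" and ch: "subset.chain (Collect orthonormal) \<C>"
    have "\<langle>e, f\<rangle> = (if e = f then 1 else 0)" if "e \<in> X" "f \<in> Y" "X \<in> \<C>" "Y \<in> \<C>" for e f X Y
    proof -
      have "X \<subseteq> Y \<or> Y \<subseteq> X" "orthonormal X" "orthonormal Y"
        using ch that by (auto simp: subset_chain_def)
      then show ?thesis using that unfolding orthonormal_def by blast
    qed
    moreover have "\<Union>\<C> \<subseteq> hcarrier H"
      using ch unfolding subset_chain_def orthonormal_def by blast
    ultimately show "\<Union>\<C> \<in> Collect orthonormal" by (auto simp: orthonormal_def)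
  qed
  then obtain B where B: "orthonormal B" and max: "\<And>X. orthonormal X \<Longrightarrow> B \<subseteq> X \<Longrightarrow> X = B" by auto
  have BH: "B \<subseteq> hcarrier H" using B by (simp add: orthonormal_def)
  let ?W = "complex_vector.span B"
  have W: "complex_vector.subspace ?W" "?W \<subseteq> hcarrier H"
    using complex_vector.span_minimal[OF BH subspace] complex_vector.subspace_span by auto
  have "\<exists>y\<in>?W. \<parallel>x - y\<parallel> < \<epsilon>" if x: "x \<in> hcarrier H" and \<epsilon>: "\<epsilon> > 0" for x \<epsilon>
  proof -
    \<comment> \<open>Representing \<open>\<langle>x, _\<rangle>\<close> on the span produces the
      projection \<open>y\<close> of \<open>x\<close> onto its closure, along with approximants
      \<open>X n\<close> in the span. A nonzero remainder \<open>x - y\<close> could be normalized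
      and added to \<open>B\<close>.\<close>
    obtain y X where y: "converges X y" and X: "\<And>n. X n \<in> ?W" and eq: "\<And>h. h \<in> ?W \<Longrightarrow> \<langle>x, h\<rangle> = \<langle>y, h\<rangle>"
    proof (rule Riesz_representation[OF W, of "\<lambda>h. \<langle>x, h\<rangle>" "\<parallel>x\<parallel>"])
      show "cmod \<langle>x, h\<rangle> \<le> \<parallel>x\<parallel> * \<parallel>h\<parallel>" if "h \<in> ?W" for h
        using that W(2) x by (intro Cauchy_Schwarz) auto
    qed (use W(2) x in \<open>auto simp: inner_add_right inner_scale_right subset_iff\<close>)
    have yH: "y \<in> hcarrier H" using y by (simp add: converges_def)
    define d where "d = x - y"
    have d: "d \<in> hcarrier H" using x yH by (simp add: d_def)
    have dB: "\<langle>d, e\<rangle> = 0" "\<langle>e, d\<rangle> = 0" if "e \<in> B" for e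
    proof -
      have e: "e \<in> hcarrier H" using that BH by blast
      show "\<langle>d, e\<rangle> = 0"
        using eq[OF complex_vector.span_base[OF that]] e x yH by (simp add: d_def inner_diff_left)
      then show "\<langle>e, d\<rangle> = 0" using inner_commute[OF e d] by simp
    qed
    have "d = 0"
    proof (rule ccontr)
      assume "d \<noteq> 0"
      then have nd: "\<parallel>d\<parallel> > 0" using hnorm_eq_zero[OF d] hnorm_nonneg[OF d] by linarith
      define u where "u = of_real (1 / \<parallel>d\<parallel>) *\<^sub>C d"
      have u: "u \<in> hcarrier H" using d by (simp add: u_def)
      have uu: "\<langle>u, u\<rangle> = 1"
        using nd d by (simp add: u_def inner_simps) (simp add: inner_self power2_eq_square)
      have uB: "\<langle>u, e\<rangle> = 0" "\<langle>e, u\<rangle> = 0" if "e \<in> B" for e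
        using dB[OF that] d that BH by (auto simp: u_def inner_simps)
      have "u \<notin> B" using uB uu by force
      moreover have "orthonormal (insert u B)"
        using B u uu uB \<open>u \<notin> B\<close> by (auto simp: orthonormal_def)
      ultimately show False using max[of "insert u B"] by blast
    qed
    then have "x = y" by (simp add: d_def)
    then have "(\<lambda>n. \<parallel>X n - x\<parallel>) \<longlonglongrightarrow> 0" using y by (simp add: converges_def)
    then have "eventually (\<lambda>n. \<parallel>X n - x\<parallel> < \<epsilon>) sequentially" using \<epsilon> by (rule order_tendstoD(2))
    then obtain n where "\<parallel>X n - x\<parallel> < \<epsilon>" by (auto simp: eventually_sequentially)
    then show ?thesis using X[of n] W(2) x by (intro bexI[of _ "X n"]) (auto simp: hnorm_minus_commute)
  qed
  then have "orthonormal_basis H B" using B W(2) by (simp add: orthonormal_basis_iff dense_in_def)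
  then show ?thesis by blast
qed

section \<open>Trace-class operators\<close>

text \<open>For positive operators the trace does not depend on the basis.  Every trace-class operator is
  a combination \<open>\<Sum>k<4. \<i> ^ k *\<^sub>C P k\<close> of positive ones, which reduces the general theory to
  that case.\<close>

definition positive_trace :: "'v::complex_vector hspace \<Rightarrow> ('v \<Rightarrow> 'v) \<Rightarrow> real \<Rightarrow> bool" where
  "positive_trace H P s \<longleftrightarrow> positive_op H P \<and>
     (\<forall>B. orthonormal_basis H B \<longrightarrow> ((\<lambda>e. Re (hinner H e (P e))) has_sum s) B)"

context hilbert_space
begin

lemma positive_trace_positive: "positive_trace H P s \<Longrightarrow> positive_op H P"
  by (simp add: positive_trace_def)

lemma positive_trace_bounded: "positive_trace H P s \<Longrightarrow> P \<in> bounded_ops H"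
  by (simp add: positive_trace_def)

lemma positive_trace_sum: "positive_trace H P s \<Longrightarrow> orthonormal_basis H B \<Longrightarrow>
    ((\<lambda>e. Re \<langle>e, P e\<rangle>) has_sum s) B"
  by (simp add: positive_trace_def)

lemma positive_sqrt:
  assumes P: "positive_op H P"
  obtains R where "positive_op H R" "\<And>x. P x = R (R x)"
    "\<And>x y. x \<in> hcarrier H \<Longrightarrow> y \<in> hcarrier H \<Longrightarrow> \<langle>x, P y\<rangle> = \<langle>R x, R y\<rangle>"
proof -
  obtain R where R: "positive_op H R" "R \<circ> R = P" by (rule sqrt_exists[OF P]) (rule that)
  then have eq: "P x = R (R x)" for x by auto
  then show thesis using R(1) positive_self_adjoint[OF R(1)] by (intro that[of R]) auto
qed

text \<open>With \<open>R\<close> the square root of \<open>P\<close>, each diagonal entry is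
  \<open>\<parallel>R e\<parallel>\<^sup>2\<close>, and \<open>HilbertSchmidt_adjoint\<close> for
  the self-adjoint \<open>R\<close> transfers the sum from one basis to any other.\<close>

lemma positive_traceI:
  assumes P: "positive_op H P" and C: "orthonormal_basis H C" and s: "((\<lambda>e. Re \<langle>e, P e\<rangle>) has_sum s) C"
  shows "positive_trace H P s"
proof -
  obtain R where R: "positive_op H R"
    and eq: "\<And>x y. x \<in> hcarrier H \<Longrightarrow> y \<in> hcarrier H \<Longrightarrow> \<langle>x, P y\<rangle> = \<langle>R x, R y\<rangle>"
    by (rule positive_sqrt[OF P]) (rule that)
  have Re: "Re \<langle>x, P x\<rangle> = \<parallel>R x\<parallel>\<^sup>2" if "x \<in> hcarrier H" for x
    using eq[OF that that] R by (simp add: hnorm_sq)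
  have "((\<lambda>e. Re \<langle>e, P e\<rangle>) has_sum s) B" if B: "orthonormal_basis H B" for B
  proof -
    have "((\<lambda>e. \<parallel>R e\<parallel>\<^sup>2) has_sum s) C"
      using s onb_mem[OF C] Re by (simp cong: has_sum_cong)
    then have "((\<lambda>e. \<parallel>R e\<parallel>\<^sup>2) has_sum s) B"
      using R by (intro HilbertSchmidt_adjoint[OF _ _ positive_self_adjoint[OF R] B C]) auto
    then show ?thesis using onb_mem[OF B] Re by (simp cong: has_sum_cong)
  qed
  then show ?thesis using P by (simp add: positive_trace_def)
qed

lemma positive_trace_nonneg: "positive_trace H P s \<Longrightarrow> 0 \<le> s"
  using orthonormal_basis_exists positive_trace_sum positive_trace_positive
  by (meson has_sum_nonneg onb_mem positive_Re)

lemma positive_trace_add: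
  assumes "positive_trace H P s" "positive_trace H Q t"
  shows "positive_trace H (P + Q) (s + t)"
  unfolding positive_trace_def
proof (intro conjI allI impI)
  show "positive_op H (P + Q)" using assms by (intro positive_add positive_trace_positive)
  fix B assume B: "orthonormal_basis H B"
  then have "((\<lambda>e. Re \<langle>e, P e\<rangle> + Re \<langle>e, Q e\<rangle>) has_sum (s + t)) B"
    using assms by (intro has_sum_add positive_trace_sum)
  then show "((\<lambda>e. Re \<langle>e, (P + Q) e\<rangle>) has_sum (s + t)) B"
    using onb_mem[OF B] assms[THEN positive_trace_bounded]
    by (simp add: inner_add_right cong: has_sum_cong)
qed

lemma positive_trace_scale:
  assumes "positive_trace H P s" "0 \<le> r"
  shows "positive_trace H (of_real r *\<^sub>C P) (r * s)"
  unfolding positive_trace_def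
proof (intro conjI allI impI)
  show "positive_op H (of_real r *\<^sub>C P)" using assms by (intro positive_scale positive_trace_positive)
  fix B assume B: "orthonormal_basis H B"
  then have "((\<lambda>e. r * Re \<langle>e, P e\<rangle>) has_sum (r * s)) B"
    using assms by (intro has_sum_cmult_right positive_trace_sum)
  then show "((\<lambda>e. Re \<langle>e, (of_real r *\<^sub>C P) e\<rangle>) has_sum (r * s)) B"
    using onb_mem[OF B] assms(1)[THEN positive_trace_bounded]
    by (simp add: inner_scale_right cong: has_sum_cong)
qed

lemma positive_trace_zero: "positive_trace H 0 0"
  unfolding positive_trace_def using onb_mem by (auto intro!: has_sum_0)

text \<open>The square root vanishes on a basis; being self-adjoint, it then has all its values
  orthogonal to the basis, so Parseval makes them 0.\<close>

lemma positive_trace_eq_zero: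
  assumes P: "positive_trace H P 0"
  shows "P = 0"
proof -
  obtain R where R: "positive_op H R" and PR: "\<And>x. P x = R (R x)"
    and eq: "\<And>x y. x \<in> hcarrier H \<Longrightarrow> y \<in> hcarrier H \<Longrightarrow> \<langle>x, P y\<rangle> = \<langle>R x, R y\<rangle>"
    by (rule positive_sqrt[OF positive_trace_positive[OF P]]) (rule that)
  obtain B where B: "orthonormal_basis H B" using orthonormal_basis_exists by blast
  have Re0: "R e = 0" if e: "e \<in> B" for e
  proof -
    have "Re \<langle>e, P e\<rangle> = 0"
      using nonneg_has_sum_le_0D[OF positive_trace_sum[OF P B]] positive_Re[OF positive_trace_positive[OF P]]
        onb_mem[OF B] e by auto
    then have "\<parallel>R e\<parallel>\<^sup>2 = 0" using eq[OF onb_mem[OF B e] onb_mem[OF B e]] R by (simp add: hnorm_sq)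
    then show ?thesis using hnorm_eq_zero[of "R e"] R by simp
  qed
  have "R x = 0" if x: "x \<in> hcarrier H" for x
  proof -
    have "\<langle>e, R x\<rangle> = 0" if "e \<in> B" for e
      using positive_self_adjoint[OF R onb_mem[OF B that] x] Re0[OF that] x by simp
    then have "((\<lambda>e. 0) has_sum \<parallel>R x\<parallel>\<^sup>2) B"
      using Parseval[OF B, of "R x"] R by (simp cong: has_sum_cong)
    then have "\<parallel>R x\<parallel>\<^sup>2 = 0" using has_sum_unique[OF _ has_sum_0] by metis
    then show ?thesis using hnorm_eq_zero[of "R x"] R by simp
  qed
  then have "P x = 0" for x using R op_outside[of P x] positive_trace_bounded[OF P] PR
    by (cases "x \<in> hcarrier H") simp_all
  then show ?thesis by (simp add: fun_eq_iff)
qed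

lemma some_basis: "orthonormal_basis H (SOME B. orthonormal_basis H B)"
  using orthonormal_basis_exists by (rule someI_ex)

text \<open>\<open>op_trace\<close> is an unordered sum over a chosen basis and can be split only
  where the pieces are summable. Combinations of positive operators of finite trace are the form in
  which its linearity gets used.\<close>

lemma op_trace_combination:
  assumes I: "finite I" and P: "\<And>k. k \<in> I \<Longrightarrow> positive_trace H (P k) (s k)"
  shows "op_trace H (\<Sum>k\<in>I. c k *\<^sub>C P k) = (\<Sum>k\<in>I. c k * of_real (s k))"
proof -
  define B where "B = (SOME B. orthonormal_basis H B)"
  have B: "orthonormal_basis H B" unfolding B_def by (rule some_basis)
  have summand: "((\<lambda>e. \<langle>e, (c k *\<^sub>C P k) e\<rangle>) has_sum (c k * of_real (s k))) B" if k: "k \<in> I" for k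
  proof -
    have "((\<lambda>e. c k * of_real (Re \<langle>e, P k e\<rangle>)) has_sum (c k * of_real (s k))) B"
      by (intro has_sum_cmult_right has_sum_of_real positive_trace_sum[OF P[OF k] B])
    moreover have "c k * of_real (Re \<langle>e, P k e\<rangle>) = \<langle>e, (c k *\<^sub>C P k) e\<rangle>" if "e \<in> B" for e
      using positive_inner[OF positive_trace_positive[OF P[OF k]] onb_mem[OF B that]]
        positive_trace_bounded[OF P[OF k]] onb_mem[OF B that] by (simp add: inner_scale_right)
    ultimately show ?thesis by (simp cong: has_sum_cong)
  qed
  have "((\<lambda>e. \<langle>e, (\<Sum>k\<in>J. c k *\<^sub>C P k) e\<rangle>) has_sum (\<Sum>k\<in>J. c k * of_real (s k))) B" if "finite J" "J \<subseteq> I" for J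
    using that
  proof (induction J)
    case empty
    then show ?case using onb_mem[OF B] by (auto intro!: has_sum_0)
  next
    case (insert k J)
    have b: "(\<Sum>k\<in>J. c k *\<^sub>C P k) \<in> bounded_ops H" "P k \<in> bounded_ops H"
      using insert.prems positive_trace_bounded[OF P] by (auto intro!: sum_bounded scale_bounded)
    have sum: "((\<lambda>e. \<langle>e, (c k *\<^sub>C P k) e\<rangle> + \<langle>e, (\<Sum>k\<in>J. c k *\<^sub>C P k) e\<rangle>) has_sum
        (c k * of_real (s k) + (\<Sum>k\<in>J. c k * of_real (s k)))) B"
      by (intro has_sum_add summand insert.IH) (use insert.prems in auto)
    have eq: "\<langle>e, (c k *\<^sub>C P k) e\<rangle> + \<langle>e, (\<Sum>k\<in>J. c k *\<^sub>C P k) e\<rangle> = \<langle>e, (\<Sum>k\<in>insert k J. c k *\<^sub>C P k) e\<rangle>"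
      if "e \<in> B" for e
      using b insert.hyps onb_mem[OF B that] by (simp add: inner_add_right)
    show ?case
      by (subst sum.insert[OF insert.hyps, of "\<lambda>k. c k * of_real (s k)"])
        (rule iffD1[OF has_sum_cong[OF eq] sum])
  qed
  from infsumI[OF this[OF I order_refl]] show ?thesis unfolding op_trace_def B_def .
qed

lemma op_trace_positive: "positive_trace H P s \<Longrightarrow> op_trace H P = of_real s"
  using op_trace_combination[of "{()}" "\<lambda>_. P" "\<lambda>_. s" "\<lambda>_. 1"] by (simp add: scaleC_one)

lemma trace_norm_positive: "positive_trace H P s \<Longrightarrow> trace_norm H P = s"
  by (simp add: trace_norm_def abs_op_of_positive[OF positive_trace_positive] op_trace_positive)

lemma trace_class_iff: "T \<in> trace_class H \<longleftrightarrow> T \<in> bounded_ops H \<and> (\<exists>s. positive_trace H (abs_op H T) s)"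
proof -
  have "(\<forall>B. orthonormal_basis H B \<longrightarrow> (\<lambda>e. \<langle>e, P e\<rangle>) summable_on B) \<longleftrightarrow> (\<exists>s. positive_trace H P s)"
    if P: "positive_op H P" for P
  proof
    assume *: "\<forall>B. orthonormal_basis H B \<longrightarrow> (\<lambda>e. \<langle>e, P e\<rangle>) summable_on B"
    obtain B where B: "orthonormal_basis H B" using orthonormal_basis_exists by blast
    then have "(\<lambda>e. Re \<langle>e, P e\<rangle>) summable_on B" using * by (intro summable_on_Re) auto
    then show "\<exists>s. positive_trace H P s" using positive_traceI[OF P B] has_sum_infsum by blast
  next
    assume "\<exists>s. positive_trace H P s"
    then obtain s where s: "positive_trace H P s" by blast
    show "\<forall>B. orthonormal_basis H B \<longrightarrow> (\<lambda>e. \<langle>e, P e\<rangle>) summable_on B"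
    proof (intro allI impI)
      fix B assume B: "orthonormal_basis H B"
      have "((\<lambda>e. complex_of_real (Re \<langle>e, P e\<rangle>)) has_sum of_real s) B"
        using positive_trace_sum[OF s B] by (rule has_sum_of_real)
      then have "((\<lambda>e. \<langle>e, P e\<rangle>) has_sum of_real s) B"
        using positive_inner[OF P onb_mem[OF B], symmetric] by (simp cong: has_sum_cong)
      then show "(\<lambda>e. \<langle>e, P e\<rangle>) summable_on B" by (auto simp: summable_on_def)
    qed
  qed
  from this[OF abs_op_positive] show ?thesis unfolding trace_class_def by blast
qed

lemma trace_class_bounded: "T \<in> trace_class H \<Longrightarrow> T \<in> bounded_ops H"
  by (simp add: trace_class_iff)

lemma positive_trace_trace_class: "positive_trace H P s \<Longrightarrow> P \<in> trace_class H"
  by (auto simp: trace_class_iff abs_op_of_positive positive_trace_positive positive_trace_bounded)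

lemma trace_class_positive_trace: "P \<in> trace_class H \<Longrightarrow> positive_op H P \<Longrightarrow> \<exists>s. positive_trace H P s"
  by (simp add: trace_class_iff abs_op_of_positive)

section \<open>Decomposing trace-class operators into positive ones\<close>

lemma contraction_adjoint:
  assumes V: "V \<in> bounded_ops H" "\<And>x. x \<in> hcarrier H \<Longrightarrow> \<parallel>V x\<parallel> \<le> \<parallel>x\<parallel>"
  obtains V' where "V' \<in> bounded_ops H" "\<And>x. x \<in> hcarrier H \<Longrightarrow> \<parallel>V' x\<parallel> \<le> \<parallel>x\<parallel>"
    "\<And>x y. x \<in> hcarrier H \<Longrightarrow> y \<in> hcarrier H \<Longrightarrow> \<langle>V' x, y\<rangle> = \<langle>x, V y\<rangle>"
    "\<And>x y. x \<in> hcarrier H \<Longrightarrow> y \<in> hcarrier H \<Longrightarrow> \<langle>V x, y\<rangle> = \<langle>x, V' y\<rangle>"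
proof -
  obtain V' where V': "V' \<in> bounded_ops H"
    and adj: "\<And>x y. x \<in> hcarrier H \<Longrightarrow> y \<in> hcarrier H \<Longrightarrow> \<langle>V' x, y\<rangle> = \<langle>x, V y\<rangle>"
    by (rule adjoint_exists[OF V(1)]) (rule that)
  have "\<parallel>V' x\<parallel> \<le> \<parallel>x\<parallel>" if x: "x \<in> hcarrier H" for x
  proof -
    have "\<parallel>V' x\<parallel> * \<parallel>V' x\<parallel> = cmod \<langle>V' x, V' x\<rangle>"
      using V' by (simp add: inner_self norm_power power2_eq_square flip: of_real_mult)
    also have "\<dots> = cmod \<langle>x, V (V' x)\<rangle>" using adj x V' by simp
    also have "\<dots> \<le> \<parallel>x\<parallel> * \<parallel>V (V' x)\<parallel>" using x V by (intro Cauchy_Schwarz) auto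
    also have "\<dots> \<le> \<parallel>x\<parallel> * \<parallel>V' x\<parallel>" using x V V' by (intro mult_left_mono) auto
    finally show ?thesis using hnorm_nonneg[OF op_mem[OF V', of x]] x
      by (cases "\<parallel>V' x\<parallel> = 0") (auto simp: mult_le_cancel_right)
  qed
  moreover have "\<langle>V x, y\<rangle> = \<langle>x, V' y\<rangle>" if "x \<in> hcarrier H" "y \<in> hcarrier H" for x y
    using adj[OF that(2,1)] inner_commute[of "V x" y] inner_commute[of x "V' y"] that V V' by simp
  ultimately show thesis using V' adj that by blast
qed

text \<open>The terms \<open>\<parallel>R (V e)\<parallel>\<close> are not bounded one by one by
  \<open>\<parallel>R e\<parallel>\<close>, but those of the adjoint \<open>V' \<circ> R\<close>
  are, and passing to the adjoint preserves the sum.\<close>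

lemma HilbertSchmidt_contraction:
  assumes R: "positive_op H R" and V: "V \<in> bounded_ops H" "\<And>x. x \<in> hcarrier H \<Longrightarrow> \<parallel>V x\<parallel> \<le> \<parallel>x\<parallel>"
    and B: "orthonormal_basis H B" and s: "((\<lambda>e. \<parallel>R e\<parallel>\<^sup>2) has_sum s) B"
  obtains u where "u \<le> s" "((\<lambda>e. \<parallel>R (V e)\<parallel>\<^sup>2) has_sum u) B"
proof -
  obtain V' where V': "V' \<in> bounded_ops H" "\<And>x. x \<in> hcarrier H \<Longrightarrow> \<parallel>V' x\<parallel> \<le> \<parallel>x\<parallel>"
    and adj: "\<And>x y. x \<in> hcarrier H \<Longrightarrow> y \<in> hcarrier H \<Longrightarrow> \<langle>V' x, y\<rangle> = \<langle>x, V y\<rangle>"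
    by (rule contraction_adjoint[OF V], assumption, rule that)
  have R': "R \<in> bounded_ops H" using R by simp
  have le: "\<parallel>V' (R e)\<parallel>\<^sup>2 \<le> \<parallel>R e\<parallel>\<^sup>2" for e
    using V' R' by (intro power_mono) auto
  have "(\<lambda>e. \<parallel>V' (R e)\<parallel>\<^sup>2) summable_on B"
    by (rule summable_on_comparison_test[OF has_sum_imp_summable[OF s]]) (simp_all add: le)
  then obtain u where u: "((\<lambda>e. \<parallel>(V' \<circ> R) e\<parallel>\<^sup>2) has_sum u) B" by (auto simp: summable_on_def)
  have "((\<lambda>e. \<parallel>(R \<circ> V) e\<parallel>\<^sup>2) has_sum u) B"
    using R' V V' adj positive_self_adjoint[OF R]
    by (intro HilbertSchmidt_adjoint[where A = "R \<circ> V" and A' = "V' \<circ> R", OF _ _ _ B B u]) auto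
  moreover have "u \<le> s" by (rule has_sum_mono[OF u s]) (simp add: le)
  ultimately show thesis by (intro that[of u]) auto
qed

text \<open>With \<open>S\<close> the root of \<open>abs_op H T\<close> and \<open>V\<close> from
  the polar decomposition, \<open>\<langle>x, T y\<rangle> = \<langle>S (V x), S y\<rangle>\<close>.
  Polarizing this product with \<open>D k = S + \<i> ^ k *\<^sub>C (S \<circ> V)\<close> writes
  \<open>T\<close> through the positive operators given by
  \<open>\<langle>D k x, D k y\<rangle> / 4\<close>. The control of \<open>s\<close> by the trace
  norm later makes instruments bounded.\<close>

theorem trace_class_decomposition:
  assumes T: "T \<in> trace_class H"
  obtains P s where "\<And>k. positive_trace H (P k) (s k)" "\<And>k. s k \<le> trace_norm H T"
    "T = (\<Sum>k<4. \<i> ^ k *\<^sub>C P k)"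
proof -
  have T': "T \<in> bounded_ops H" using T by (rule trace_class_bounded)
  obtain t where t: "positive_trace H (abs_op H T) t" using T by (auto simp: trace_class_iff)
  have tn: "trace_norm H T = t" by (simp add: trace_norm_def op_trace_positive[OF t])
  obtain S where S: "positive_op H S" and SS: "\<And>x. abs_op H T x = S (S x)"
    and Seq: "\<And>x y. x \<in> hcarrier H \<Longrightarrow> y \<in> hcarrier H \<Longrightarrow> \<langle>x, abs_op H T y\<rangle> = \<langle>S x, S y\<rangle>"
    by (rule positive_sqrt[OF abs_op_positive[OF T']]) (rule that)
  have S': "S \<in> bounded_ops H" using S by simp
  obtain V where V: "V \<in> bounded_ops H" "\<And>x. x \<in> hcarrier H \<Longrightarrow> \<parallel>V x\<parallel> \<le> \<parallel>x\<parallel>"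
    and VT: "\<And>x y. x \<in> hcarrier H \<Longrightarrow> y \<in> hcarrier H \<Longrightarrow> \<langle>V y, abs_op H T x\<rangle> = \<langle>y, T x\<rangle>"
    by (rule polar_decomposition[OF T']) (rule that)
  obtain B where B: "orthonormal_basis H B" using orthonormal_basis_exists by blast
  have sumS: "((\<lambda>e. \<parallel>S e\<parallel>\<^sup>2) has_sum t) B"
    using positive_trace_sum[OF t B] Seq onb_mem[OF B] S' by (simp add: hnorm_sq cong: has_sum_cong)
  obtain u where u: "u \<le> t" "((\<lambda>e. \<parallel>S (V e)\<parallel>\<^sup>2) has_sum u) B"
    by (rule HilbertSchmidt_contraction[OF S V B sumS], assumption, rule that)
  define D where "D k = S + \<i> ^ k *\<^sub>C (S \<circ> V)" for k :: nat
  have D: "D k \<in> bounded_ops H" for k using S' V by (simp add: D_def)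
  have "\<exists>P. P \<in> bounded_ops H \<and> (\<forall>x\<in>hcarrier H. \<forall>y\<in>hcarrier H. \<langle>x, P y\<rangle> = (1/4) * \<langle>D k x, D k y\<rangle>)" for k
  proof -
    obtain D' where D': "D' \<in> bounded_ops H"
      and adj: "\<And>x y. x \<in> hcarrier H \<Longrightarrow> y \<in> hcarrier H \<Longrightarrow> \<langle>D' x, y\<rangle> = \<langle>x, D k y\<rangle>"
      by (rule adjoint_exists[OF D]) (rule that)
    have "\<langle>x, D' (D k y)\<rangle> = \<langle>D k x, D k y\<rangle>" if "x \<in> hcarrier H" "y \<in> hcarrier H" for x y
      using adj[of "D k y" x] inner_commute[of x "D' (D k y)"] inner_commute[of "D k x" "D k y"] that D D' by simp
    then show ?thesis
      using D D' by (intro exI[of _ "(1/4) *\<^sub>C (D' \<circ> D k)"]) (simp add: inner_scale_right)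
  qed
  then obtain P where P: "\<And>k. P k \<in> bounded_ops H"
    and Pin: "\<And>k x y. x \<in> hcarrier H \<Longrightarrow> y \<in> hcarrier H \<Longrightarrow> \<langle>x, P k y\<rangle> = (1/4) * \<langle>D k x, D k y\<rangle>"
    by metis
  have Pself: "\<langle>x, P k x\<rangle> = of_real (\<parallel>D k x\<parallel>\<^sup>2 / 4)" if "x \<in> hcarrier H" for k x
    using Pin[OF that that, of k] D by (simp add: inner_self)
  have pos: "positive_op H (P k)" for k
    using P by (simp add: positive_op_def Pself del: of_real_power of_real_divide)
  have "\<exists>s. positive_trace H (P k) s \<and> s \<le> t" for k
  proof -
    \<comment> \<open>Summing over the basis gives \<open>(t + u) / 2 \<le> t\<close>, so no
      constant is lost in the trace of \<open>P k\<close>.\<close>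
    have le: "\<parallel>D k e\<parallel>\<^sup>2 / 4 \<le> (\<parallel>S e\<parallel>\<^sup>2 + \<parallel>S (V e)\<parallel>\<^sup>2) / 2" for e
    proof -
      have "\<parallel>D k e\<parallel> \<le> \<parallel>S e\<parallel> + \<parallel>S (V e)\<parallel>"
        using triangle[of "S e" "\<i> ^ k *\<^sub>C S (V e)"] S' by (simp add: D_def hnorm_scale norm_power)
      then have "\<parallel>D k e\<parallel>\<^sup>2 \<le> (\<parallel>S e\<parallel> + \<parallel>S (V e)\<parallel>)\<^sup>2" using D by (intro power_mono) auto
      also have "\<dots> \<le> 2 * \<parallel>S e\<parallel>\<^sup>2 + 2 * \<parallel>S (V e)\<parallel>\<^sup>2"
        using sum_squares_bound[of "\<parallel>S e\<parallel>" "\<parallel>S (V e)\<parallel>"] by (simp add: power2_sum)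
      finally show ?thesis by simp
    qed
    have sum2: "((\<lambda>e. (1/2) * (\<parallel>S e\<parallel>\<^sup>2 + \<parallel>S (V e)\<parallel>\<^sup>2)) has_sum (1/2) * (t + u)) B"
      by (intro has_sum_cmult_right has_sum_add sumS u)
    have "(\<lambda>e. \<parallel>D k e\<parallel>\<^sup>2 / 4) summable_on B"
      by (rule summable_on_comparison_test[OF has_sum_imp_summable[OF sum2]]) (use le in simp_all)
    then obtain s where s: "((\<lambda>e. \<parallel>D k e\<parallel>\<^sup>2 / 4) has_sum s) B" by (auto simp: summable_on_def)
    have "s \<le> (1/2) * (t + u)" by (rule has_sum_mono[OF s sum2]) (use le in simp)
    moreover have "positive_trace H (P k) s"
      using s onb_mem[OF B] by (intro positive_traceI[OF pos B]) (simp add: Pself del: of_real_power of_real_divide cong: has_sum_cong)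
    ultimately show ?thesis using u(1) by (intro exI[of _ s]) auto
  qed
  then obtain s where s: "\<And>k. positive_trace H (P k) (s k)" "\<And>k. s k \<le> t" by metis
  have "T = (\<Sum>k<4. \<i> ^ k *\<^sub>C P k)"
  proof (rule op_ext_inner[OF T'])
    show "(\<Sum>k<4. \<i> ^ k *\<^sub>C P k) \<in> bounded_ops H" using P by (intro sum_bounded scale_bounded)
    fix x y assume x: "x \<in> hcarrier H" and y: "y \<in> hcarrier H"
    let ?a = "\<langle>S x, S y\<rangle>" and ?b = "\<langle>S x, S (V y)\<rangle>" and ?c = "\<langle>S (V x), S y\<rangle>" and ?d = "\<langle>S (V x), S (V y)\<rangle>"
    have "\<langle>x, T y\<rangle> = ?c" using VT[OF y x] Seq[of "V x" y] V y by simp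
    moreover have "\<langle>D k x, D k y\<rangle> = ?a + \<i> ^ k * ?b + cnj (\<i> ^ k) * ?c + cnj (\<i> ^ k) * \<i> ^ k * ?d" for k
      using S' by (simp add: D_def inner_simps distrib_left mult_ac)
    then have "\<langle>x, (\<Sum>k<4. \<i> ^ k *\<^sub>C P k) y\<rangle> =
        (\<Sum>k<4. \<i> ^ k * ((1/4) * (?a + \<i> ^ k * ?b + cnj (\<i> ^ k) * ?c + cnj (\<i> ^ k) * \<i> ^ k * ?d)))"
      using x y P by (simp add: sum_fun_apply inner_sum_right inner_scale_right Pin)
    \<comment> \<open>Summation over the fourth roots of unity kills \<open>?a\<close>,
      \<open>?b\<close> and \<open>?d\<close> and keeps \<open>?c\<close>.\<close>
    then have "\<langle>x, (\<Sum>k<4. \<i> ^ k *\<^sub>C P k) y\<rangle> = ?c"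
      unfolding sum_lessThan_4 by (simp add: power3_eq_cube power2_eq_square distrib_left right_diff_distrib)
    ultimately show "\<langle>x, T y\<rangle> = \<langle>x, (\<Sum>k<4. \<i> ^ k *\<^sub>C P k) y\<rangle>" by simp
  qed
  then show thesis using s tn that by blast
qed

text \<open>A triangle inequality obtained without knowing beforehand that the sum \<open>T\<close>
  is trace class. Since \<open>V (T x) = abs_op H T x\<close>, the diagonal entry of the absolute
  value at \<open>e\<close> is the sum of the \<open>c k * \<langle>V' e, P k e\<rangle>\<close>,
  and each of these has a summable majorant.\<close>

theorem trace_class_combination:
  assumes I: "finite I" and P: "\<And>k. k \<in> I \<Longrightarrow> positive_trace H (P k) (s k)"
  shows "(\<Sum>k\<in>I. c k *\<^sub>C P k) \<in> trace_class H"
    and "trace_norm H (\<Sum>k\<in>I. c k *\<^sub>C P k) \<le> (\<Sum>k\<in>I. cmod (c k) * s k)"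
proof -
  define T where "T = (\<Sum>k\<in>I. c k *\<^sub>C P k)"
  have Pb: "P k \<in> bounded_ops H" if "k \<in> I" for k using positive_trace_bounded[OF P[OF that]] .
  have T: "T \<in> bounded_ops H" unfolding T_def using Pb by (intro sum_bounded scale_bounded)
  obtain V where V: "V \<in> bounded_ops H" "\<And>x. x \<in> hcarrier H \<Longrightarrow> \<parallel>V x\<parallel> \<le> \<parallel>x\<parallel>"
    and VT: "\<And>x. x \<in> hcarrier H \<Longrightarrow> V (T x) = abs_op H T x"
    by (rule polar_decomposition[OF T]) (rule that)
  obtain V' where V': "V' \<in> bounded_ops H" "\<And>x. x \<in> hcarrier H \<Longrightarrow> \<parallel>V' x\<parallel> \<le> \<parallel>x\<parallel>"
    and adj: "\<And>x y. x \<in> hcarrier H \<Longrightarrow> y \<in> hcarrier H \<Longrightarrow> \<langle>V' x, y\<rangle> = \<langle>x, V y\<rangle>"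
    by (rule contraction_adjoint[OF V], assumption, rule that)
  obtain B where B: "orthonormal_basis H B" using orthonormal_basis_exists by blast
  \<comment> \<open>Factor \<open>P k\<close> through its root \<open>R\<close> and split the
    product of norms into squares: \<open>\<parallel>R (V' e)\<parallel>\<^sup>2\<close> and
    \<open>\<parallel>R e\<parallel>\<^sup>2\<close> both have sums at most \<open>s k\<close>, so
    their mean does too.\<close>
  have "\<exists>g u. (g has_sum u) B \<and> u \<le> s k \<and> (\<forall>e\<in>B. cmod \<langle>V' e, P k e\<rangle> \<le> g e)" if k: "k \<in> I" for k
  proof -
    obtain R where R: "positive_op H R"
      and eq: "\<And>x y. x \<in> hcarrier H \<Longrightarrow> y \<in> hcarrier H \<Longrightarrow> \<langle>x, P k y\<rangle> = \<langle>R x, R y\<rangle>"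
      by (rule positive_sqrt[OF positive_trace_positive[OF P[OF k]]]) (rule that)
    have R': "R \<in> bounded_ops H" using R by simp
    have sumR: "((\<lambda>e. \<parallel>R e\<parallel>\<^sup>2) has_sum s k) B"
      using positive_trace_sum[OF P[OF k] B] eq onb_mem[OF B] R' by (simp add: hnorm_sq cong: has_sum_cong)
    obtain u where u: "u \<le> s k" "((\<lambda>e. \<parallel>R (V' e)\<parallel>\<^sup>2) has_sum u) B"
      by (rule HilbertSchmidt_contraction[OF R V' B sumR], assumption, rule that)
    have "cmod \<langle>V' e, P k e\<rangle> \<le> (1/2) * (\<parallel>R (V' e)\<parallel>\<^sup>2 + \<parallel>R e\<parallel>\<^sup>2)" if e: "e \<in> B" for e
    proof -
      have "cmod \<langle>V' e, P k e\<rangle> \<le> \<parallel>R (V' e)\<parallel> * \<parallel>R e\<parallel>"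
        using eq[of "V' e" e] Cauchy_Schwarz[of "R (V' e)" "R e"] onb_mem[OF B e] V' R' by simp
      then show ?thesis using sum_squares_bound[of "\<parallel>R (V' e)\<parallel>" "\<parallel>R e\<parallel>"] by simp
    qed
    moreover have "((\<lambda>e. (1/2) * (\<parallel>R (V' e)\<parallel>\<^sup>2 + \<parallel>R e\<parallel>\<^sup>2)) has_sum (1/2) * (u + s k)) B"
      by (intro has_sum_cmult_right has_sum_add sumR u)
    ultimately show ?thesis using u(1)
      by (intro exI[of _ "\<lambda>e. (1/2) * (\<parallel>R (V' e)\<parallel>\<^sup>2 + \<parallel>R e\<parallel>\<^sup>2)"] exI[of _ "(1/2) * (u + s k)"]) auto
  qed
  then obtain g u where g: "\<And>k. k \<in> I \<Longrightarrow> (g k has_sum u k) B" and u: "\<And>k. k \<in> I \<Longrightarrow> u k \<le> s k"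
    and ge: "\<And>k e. k \<in> I \<Longrightarrow> e \<in> B \<Longrightarrow> cmod \<langle>V' e, P k e\<rangle> \<le> g k e" by metis
  have G: "((\<lambda>e. \<Sum>k\<in>J. cmod (c k) * g k e) has_sum (\<Sum>k\<in>J. cmod (c k) * u k)) B" if "finite J" "J \<subseteq> I" for J
    using that
  proof (induction J)
    case (insert k J)
    then show ?case by (auto intro!: has_sum_add has_sum_cmult_right g)
  qed (auto intro!: has_sum_0)
  have le: "Re \<langle>e, abs_op H T e\<rangle> \<le> (\<Sum>k\<in>I. cmod (c k) * g k e)" if e: "e \<in> B" for e
  proof -
    have "\<langle>e, abs_op H T e\<rangle> = \<langle>V' e, T e\<rangle>"
      using VT adj[of e "T e"] onb_mem[OF B e] T by simp
    also have "\<dots> = (\<Sum>k\<in>I. c k * \<langle>V' e, P k e\<rangle>)"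
      unfolding T_def using V' Pb by (simp add: sum_fun_apply inner_sum_right inner_scale_right)
    finally have eq: "\<langle>e, abs_op H T e\<rangle> = (\<Sum>k\<in>I. c k * \<langle>V' e, P k e\<rangle>)" .
    have "Re \<langle>e, abs_op H T e\<rangle> \<le> cmod (\<Sum>k\<in>I. c k * \<langle>V' e, P k e\<rangle>)"
      unfolding eq by (rule complex_Re_le_cmod)
    also have "\<dots> \<le> (\<Sum>k\<in>I. cmod (c k * \<langle>V' e, P k e\<rangle>))" by (rule norm_sum)
    also have "\<dots> \<le> (\<Sum>k\<in>I. cmod (c k) * g k e)"
      unfolding norm_mult using ge e by (intro sum_mono mult_left_mono) auto
    finally show ?thesis .
  qed
  have "(\<lambda>e. Re \<langle>e, abs_op H T e\<rangle>) summable_on B"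
    by (rule summable_on_comparison_test[OF has_sum_imp_summable[OF G[OF I order_refl]]])
      (use le onb_mem[OF B] positive_Re[OF abs_op_positive[OF T]] in auto)
  then obtain t where t: "((\<lambda>e. Re \<langle>e, abs_op H T e\<rangle>) has_sum t) B" by (auto simp: summable_on_def)
  have pt: "positive_trace H (abs_op H T) t" by (rule positive_traceI[OF abs_op_positive[OF T] B t])
  have "t \<le> (\<Sum>k\<in>I. cmod (c k) * u k)"
    using t G[OF I order_refl] le by (rule has_sum_mono)
  also have "\<dots> \<le> (\<Sum>k\<in>I. cmod (c k) * s k)" using u by (intro sum_mono mult_left_mono) auto
  finally have "trace_norm H T \<le> (\<Sum>k\<in>I. cmod (c k) * s k)"
    by (simp add: trace_norm_def op_trace_positive[OF pt])
  then show "trace_norm H (\<Sum>k\<in>I. c k *\<^sub>C P k) \<le> (\<Sum>k\<in>I. cmod (c k) * s k)" by (simp add: T_def)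
  show "(\<Sum>k\<in>I. c k *\<^sub>C P k) \<in> trace_class H" using T pt by (auto simp: trace_class_iff T_def)
qed

end

section \<open>Linear maps on the trace class\<close>

context hilbert_space
begin

lemma trace_class_cases:
  assumes "T \<in> trace_class H"
  obtains P s where "\<And>k. positive_trace H (P k) (s k)" "T = (\<Sum>k<4. \<i> ^ k *\<^sub>C P k)"
  by (rule trace_class_decomposition[OF assms]) (rule that)

lemma trace_class_zero [simp]: "0 \<in> trace_class H"
  using positive_trace_zero by (rule positive_trace_trace_class)

lemma trace_class_add [simp]:
  assumes S: "S \<in> trace_class H" and T: "T \<in> trace_class H"
  shows "S + T \<in> trace_class H"
proof -
  obtain P s where P: "\<And>k. positive_trace H (P k) (s k)" and SP: "S = (\<Sum>k<4. \<i> ^ k *\<^sub>C P k)"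
    by (rule trace_class_cases[OF S]) (rule that)
  obtain Q t where Q: "\<And>k. positive_trace H (Q k) (t k)" and TQ: "T = (\<Sum>k<4. \<i> ^ k *\<^sub>C Q k)"
    by (rule trace_class_cases[OF T]) (rule that)
  have "S + T = (\<Sum>k<4. \<i> ^ k *\<^sub>C (P k + Q k))"
    unfolding SP TQ by (simp add: complex_vector.scale_right_distrib sum.distrib)
  then show ?thesis
    using trace_class_combination(1)[of "{..<4}" "\<lambda>k. P k + Q k" "\<lambda>k. s k + t k" "\<lambda>k. \<i> ^ k"]
      positive_trace_add[OF P Q] by simp
qed

lemma trace_class_scale [simp]:
  assumes S: "S \<in> trace_class H"
  shows "c *\<^sub>C S \<in> trace_class H"
proof -
  obtain P s where P: "\<And>k. positive_trace H (P k) (s k)" and SP: "S = (\<Sum>k<4. \<i> ^ k *\<^sub>C P k)"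
    by (rule trace_class_cases[OF S]) (rule that)
  have "c *\<^sub>C S = (\<Sum>k<4. (c * \<i> ^ k) *\<^sub>C P k)"
    unfolding SP by (simp add: complex_vector.scale_sum_right scaleC_scaleC)
  then show ?thesis
    using trace_class_combination(1)[of "{..<4}" P s "\<lambda>k. c * \<i> ^ k"] P by simp
qed

lemma trace_class_sum: "(\<And>i. i \<in> I \<Longrightarrow> f i \<in> trace_class H) \<Longrightarrow> (\<Sum>i\<in>I. f i) \<in> trace_class H"
  by (induction I rule: infinite_finite_induct) auto

lemma linear_on_trace_class_zero:
  assumes "linear_on_trace_class H \<Phi>" shows "\<Phi> 0 = 0"
  using assms trace_class_zero unfolding linear_on_trace_class_def
  by (metis complex_vector.scale_zero_left)

lemma linear_on_trace_class_sum:
  assumes \<Phi>: "linear_on_trace_class H \<Phi>" and f: "\<And>i. i \<in> I \<Longrightarrow> f i \<in> trace_class H"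
  shows "\<Phi> (\<Sum>i\<in>I. c i *\<^sub>C f i) = (\<Sum>i\<in>I. c i *\<^sub>C \<Phi> (f i))"
proof -
  have scale: "\<Phi> (a *\<^sub>C T) = a *\<^sub>C \<Phi> T" if "T \<in> trace_class H" for a T
    using \<Phi> that unfolding linear_on_trace_class_def by blast
  have add: "\<Phi> (S + T) = \<Phi> S + \<Phi> T" if "S \<in> trace_class H" "T \<in> trace_class H" for S T
    using \<Phi> that unfolding linear_on_trace_class_def by blast
  show ?thesis using linear_on_trace_class_zero[OF \<Phi>] f
    by (induction I rule: infinite_finite_induct) (simp_all add: add scale trace_class_sum)
qed

text \<open>The four positive parts are not unique, only the hermitian differences
  \<open>P 0 - P 2\<close> and \<open>P 1 - P 3\<close> are. They are compared as sums, so that a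
  map which is additive only on positive operators can be applied to the equations.\<close>

lemma positive_combination_unique:
  assumes P: "\<And>k. positive_op H (P k)" and Q: "\<And>k. positive_op H (Q k)"
    and eq: "(\<Sum>k<4. \<i> ^ k *\<^sub>C P k) = (\<Sum>k<4. \<i> ^ k *\<^sub>C Q k)"
  shows "P 0 + Q 2 = Q 0 + P 2" "P 1 + Q 3 = Q 1 + P 3"
proof -
  have Pb: "P k \<in> bounded_ops H" and Qb: "Q k \<in> bounded_ops H" for k using P Q by auto
  have c: "Re \<langle>x, P 0 x\<rangle> - Re \<langle>x, P 2 x\<rangle> = Re \<langle>x, Q 0 x\<rangle> - Re \<langle>x, Q 2 x\<rangle> \<and>
      Re \<langle>x, P 1 x\<rangle> - Re \<langle>x, P 3 x\<rangle> = Re \<langle>x, Q 1 x\<rangle> - Re \<langle>x, Q 3 x\<rangle>" if x: "x \<in> hcarrier H" for x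
  proof -
    have im: "Im \<langle>x, P k x\<rangle> = 0" "Im \<langle>x, Q k x\<rangle> = 0" for k using P Q x by (auto simp: positive_op_def)
    have "\<langle>x, (\<Sum>k<4. \<i> ^ k *\<^sub>C P k) x\<rangle> = \<langle>x, (\<Sum>k<4. \<i> ^ k *\<^sub>C Q k) x\<rangle>" unfolding eq ..
    then have "\<langle>x, P 0 x\<rangle> + \<i> * \<langle>x, P 1 x\<rangle> - \<langle>x, P 2 x\<rangle> - \<i> * \<langle>x, P 3 x\<rangle> =
        \<langle>x, Q 0 x\<rangle> + \<i> * \<langle>x, Q 1 x\<rangle> - \<langle>x, Q 2 x\<rangle> - \<i> * \<langle>x, Q 3 x\<rangle>"
      unfolding i_combination using x Pb Qb by (simp add: inner_simps)
    then show ?thesis by (simp add: complex_eq_iff im)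
  qed
  have r: "\<langle>x, P k x\<rangle> = of_real (Re \<langle>x, P k x\<rangle>)" "\<langle>x, Q k x\<rangle> = of_real (Re \<langle>x, Q k x\<rangle>)"
    if "x \<in> hcarrier H" for x k
    using positive_inner P Q that by blast+
  show "P 0 + Q 2 = Q 0 + P 2"
  proof (rule op_ext_quadratic)
    fix x assume x: "x \<in> hcarrier H"
    show "\<langle>x, (P 0 + Q 2) x\<rangle> = \<langle>x, (Q 0 + P 2) x\<rangle>"
      using c[OF x] r[OF x, of 0] r[OF x, of 2] x Pb Qb by (simp add: inner_add_right complex_eq_iff)
  qed (use Pb Qb in auto)
  show "P 1 + Q 3 = Q 1 + P 3"
  proof (rule op_ext_quadratic)
    fix x assume x: "x \<in> hcarrier H"
    show "\<langle>x, (P 1 + Q 3) x\<rangle> = \<langle>x, (Q 1 + P 3) x\<rangle>"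
      using c[OF x] r[OF x, of 1] r[OF x, of 3] x Pb Qb by (simp add: inner_add_right complex_eq_iff)
  qed (use Pb Qb in auto)
qed

text \<open>The value on a decomposition is forced, and it does not depend on the decomposition
  because \<open>F\<close> is additive on the equations of
  \<open>positive_combination_unique\<close>. Complex homogeneity is assembled from nonnegative
  scalars, \<open>\<i>\<close>, and \<open>-1\<close> as its square.\<close>

theorem positive_map_extension:
  assumes F_pos: "\<And>P s. positive_trace H P s \<Longrightarrow> \<exists>t. positive_trace H (F P) t"
    and F_add: "\<And>P Q s t. positive_trace H P s \<Longrightarrow> positive_trace H Q t \<Longrightarrow> F (P + Q) = F P + F Q"
    and F_scale: "\<And>P s r. positive_trace H P s \<Longrightarrow> 0 \<le> r \<Longrightarrow> F (of_real r *\<^sub>C P) = of_real r *\<^sub>C F P"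
  obtains \<Phi> where "linear_on_trace_class H \<Phi>" "\<And>P s. positive_trace H P s \<Longrightarrow> \<Phi> P = F P"
    "\<And>T. T \<notin> trace_class H \<Longrightarrow> \<Phi> T = 0"
proof -
  define dec :: "('a \<Rightarrow> 'a) \<Rightarrow> (nat \<Rightarrow> 'a \<Rightarrow> 'a) \<Rightarrow> bool" where "dec T P \<longleftrightarrow> (\<forall>k. \<exists>s. positive_trace H (P k) s) \<and> T = (\<Sum>k<4. \<i> ^ k *\<^sub>C P k)" for T P
  have dec_ex: "\<exists>P. dec T P" if "T \<in> trace_class H" for T
  proof (rule trace_class_cases[OF that])
    fix P s assume "\<And>k. positive_trace H (P k) (s k)" "T = (\<Sum>k<4. \<i> ^ k *\<^sub>C P k)"
    then have "dec T P" unfolding dec_def by blast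
    then show "\<exists>P. dec T P" by (intro exI[of _ P])
  qed
  \<comment> \<open>The value 0 outside the trace class is what the first clause of
    \<open>DL_instrument\<close> will demand.\<close>
  define \<Phi> where "\<Phi> T = (if T \<in> trace_class H then \<Sum>k<4. \<i> ^ k *\<^sub>C F ((SOME P. dec T P) k) else 0)" for T
  have dec_tc: "T \<in> trace_class H" if D: "dec T P" for T P
  proof -
    obtain s where "\<And>k. positive_trace H (P k) (s k)" using D unfolding dec_def by metis
    then show ?thesis using D trace_class_combination(1)[of "{..<4}" P s "\<lambda>k. \<i> ^ k"] by (simp add: dec_def)
  qed
  have \<Phi>: "\<Phi> T = (\<Sum>k<4. \<i> ^ k *\<^sub>C F (P k))" if D: "dec T P" for T P
  proof -
    let ?Q = "SOME P. dec T P"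
    have Q: "dec T ?Q" using D by (rule someI[of "dec T"])
    have pt: "\<exists>s. positive_trace H (P k) s" "\<exists>s. positive_trace H (?Q k) s" for k
      using D Q unfolding dec_def by blast+
    have pos: "positive_op H (P k)" "positive_op H (?Q k)" for k using pt[of k] positive_trace_positive by blast+
    have "(\<Sum>k<4. \<i> ^ k *\<^sub>C P k) = (\<Sum>k<4. \<i> ^ k *\<^sub>C ?Q k)" using D Q unfolding dec_def by metis
    note * = positive_combination_unique[OF pos this]
    have "F (A + B) = F A + F B" if "\<exists>s. positive_trace H A s" "\<exists>s. positive_trace H B s" for A B
      using F_add that by blast
    then have "F (P 0) + F (?Q 2) = F (?Q 0) + F (P 2)" "F (P 1) + F (?Q 3) = F (?Q 1) + F (P 3)"
      using * pt by metis+
    then have "F (P 0) - F (P 2) = F (?Q 0) - F (?Q 2)" "F (P 1) - F (P 3) = F (?Q 1) - F (?Q 3)"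
      by (simp_all add: algebra_simps)
    moreover have "(\<Sum>k<4. \<i> ^ k *\<^sub>C F (R k)) = (F (R 0) - F (R 2)) + \<i> *\<^sub>C (F (R 1) - F (R 3))" for R
      unfolding i_combination by (simp add: complex_vector.scale_right_diff_distrib)
    ultimately show ?thesis using dec_tc[OF D] by (simp add: \<Phi>_def)
  qed
  have F0: "F 0 = 0" using F_scale[OF positive_trace_zero, of 0] by simp
  have Fpt: "\<exists>t. positive_trace H (F P) t" if "\<exists>s. positive_trace H P s" for P using F_pos that by blast
  have add: "\<Phi> (S + T) = \<Phi> S + \<Phi> T" if ST: "S \<in> trace_class H" "T \<in> trace_class H" for S T
  proof -
    obtain P where P: "dec S P" using dec_ex[OF ST(1)] ..
    obtain Q where Q: "dec T Q" using dec_ex[OF ST(2)] ..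
    have "dec (S + T) (\<lambda>k. P k + Q k)"
      using P Q positive_trace_add unfolding dec_def
      by (auto simp: complex_vector.scale_right_distrib sum.distrib) blast
    moreover have "F (P k + Q k) = F (P k) + F (Q k)" for k
      using P Q F_add unfolding dec_def by blast
    ultimately show ?thesis
      using \<Phi> P Q by (simp add: complex_vector.scale_right_distrib sum.distrib)
  qed
  have scale_nonneg: "\<Phi> (of_real r *\<^sub>C T) = of_real r *\<^sub>C \<Phi> T" if T: "T \<in> trace_class H" and r: "0 \<le> r" for r T
  proof -
    obtain P where P: "dec T P" using dec_ex[OF T] ..
    have "dec (of_real r *\<^sub>C T) (\<lambda>k. of_real r *\<^sub>C P k)"
      using P positive_trace_scale[OF _ r] unfolding dec_def
      by (auto simp: complex_vector.scale_sum_right scaleC_scaleC mult.commute) blast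
    moreover have "F (of_real r *\<^sub>C P k) = of_real r *\<^sub>C F (P k)" for k
      using P F_scale[OF _ r] unfolding dec_def by blast
    ultimately show ?thesis
      using \<Phi> P by (simp add: complex_vector.scale_sum_right scaleC_scaleC mult.commute)
  qed
  have scale_i: "\<Phi> (\<i> *\<^sub>C T) = \<i> *\<^sub>C \<Phi> T" if T: "T \<in> trace_class H" for T
  proof -
    obtain P where P: "dec T P" using dec_ex[OF T] ..
    \<comment> \<open>Multiplication by \<open>\<i>\<close> rotates the four parts cyclically;
      \<open>(k + 3) mod 4\<close> is \<open>k - 1\<close> modulo 4 in natural numbers.\<close>
    have rot: "\<i> *\<^sub>C (\<Sum>k<4. \<i> ^ k *\<^sub>C f k) = (\<Sum>k<4. \<i> ^ k *\<^sub>C f ((k + 3) mod 4))" for f :: "nat \<Rightarrow> 'a \<Rightarrow> 'a"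
      unfolding i_combination
      by (simp add: scaleC_scaleC complex_vector.scale_right_distrib complex_vector.scale_right_diff_distrib scaleC_one)
    have "dec (\<i> *\<^sub>C T) (\<lambda>k. P ((k + 3) mod 4))"
      using P rot[of P] unfolding dec_def by auto
    then show ?thesis using \<Phi>[OF P] rot[of "\<lambda>k. F (P k)"] by (simp add: \<Phi>)
  qed
  have scale_minus: "\<Phi> (- T) = - \<Phi> T" if T: "T \<in> trace_class H" for T
    using scale_i[OF trace_class_scale[OF T], of \<i>] scale_i[OF T] by (simp add: scaleC_scaleC scaleC_one)
  have scale_real: "\<Phi> (of_real r *\<^sub>C T) = of_real r *\<^sub>C \<Phi> T" if T: "T \<in> trace_class H" for r T
    using scale_nonneg[OF T, of r] scale_minus[OF trace_class_scale[OF T], of "of_real (- r)"] scale_nonneg[OF T, of "- r"]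
    by (cases "0 \<le> r") auto
  have scale: "\<Phi> (c *\<^sub>C T) = c *\<^sub>C \<Phi> T" if T: "T \<in> trace_class H" for c T
  proof -
    have split: "c *\<^sub>C X = of_real (Re c) *\<^sub>C X + of_real (Im c) *\<^sub>C \<i> *\<^sub>C X" for X :: "'a \<Rightarrow> 'a"
      using complex_eq[of c] by (metis scaleC_add_left scaleC_scaleC mult.commute)
    show ?thesis
      unfolding split by (simp add: add T scale_real scale_i del: complex_vector.scale_scale)
  qed
  have "linear_on_trace_class H \<Phi>"
    unfolding linear_on_trace_class_def
  proof (intro conjI ballI allI)
    fix T assume T: "T \<in> trace_class H"
    obtain P where P: "dec T P" using dec_ex[OF T] ..
    then have "\<forall>k. \<exists>t. positive_trace H (F (P k)) t" using Fpt unfolding dec_def by blast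
    then obtain t where "\<And>k. positive_trace H (F (P k)) (t k)" by metis
    then show "\<Phi> T \<in> trace_class H"
      unfolding \<Phi>[OF P] by (intro trace_class_combination(1)[where s = t]) auto
  qed (auto simp: add scale)
  moreover have "\<Phi> P = F P" if P: "positive_trace H P s" for P s
  proof -
    have "dec P (\<lambda>k. if k = 0 then P else 0)"
      unfolding dec_def i_combination using P positive_trace_zero by auto
    from \<Phi>[OF this] show ?thesis unfolding i_combination by (simp add: F0)
  qed
  moreover have "\<Phi> T = 0" if "T \<notin> trace_class H" for T using that by (simp add: \<Phi>_def)
  ultimately show thesis using that by blast
qed

section \<open>Density operators and the cone they generate\<close>

lemma density_iff: "\<rho> \<in> density_ops H \<longleftrightarrow> positive_trace H \<rho> 1"
proof
  assume \<rho>: "\<rho> \<in> density_ops H"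
  then obtain s where s: "positive_trace H \<rho> s"
    using trace_class_positive_trace unfolding density_ops_def by blast
  then show "positive_trace H \<rho> 1" using \<rho> op_trace_positive[OF s] by (simp add: density_ops_def)
next
  assume "positive_trace H \<rho> 1"
  then show "\<rho> \<in> density_ops H"
    by (simp add: density_ops_def positive_trace_trace_class positive_trace_positive op_trace_positive)
qed

text \<open>The positively homogeneous extension of a map on density operators; on positive
  operators \<open>trace_norm\<close> is the trace. At 0 the normalization is meaningless
  (\<open>1 / 0 = 0\<close>), but the factor in front is then 0.\<close>

definition cone_extension :: "(('a \<Rightarrow> 'a) \<Rightarrow> 'b \<Rightarrow> 'b) \<Rightarrow> ('a \<Rightarrow> 'a) \<Rightarrow> 'b \<Rightarrow> 'b::complex_vector" where
  "cone_extension J P = of_real (trace_norm H P) *\<^sub>C J (of_real (1 / trace_norm H P) *\<^sub>C P)"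

lemma cone_extension_eq: "positive_trace H P s \<Longrightarrow> cone_extension J P = of_real s *\<^sub>C J (of_real (1 / s) *\<^sub>C P)"
  by (simp add: cone_extension_def trace_norm_positive)

lemma positive_trace_normalize:
  assumes P: "positive_trace H P s" and s: "s \<noteq> 0"
  shows "of_real (1 / s) *\<^sub>C P \<in> density_ops H" "s > 0"
proof -
  show s': "s > 0" using positive_trace_nonneg[OF P] s by simp
  then show "of_real (1 / s) *\<^sub>C P \<in> density_ops H"
    using positive_trace_scale[OF P, of "1 / s"] by (simp add: density_iff)
qed

text \<open>Density operators span the trace class. Identities between linear maps are thereby
  reduced to states, the only operators on which apparatuses are specified.\<close>

lemma trace_class_induct [consumes 1, case_names zero density add scale]:
  assumes T: "T \<in> trace_class H"
    and zero: "Q 0"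
    and density: "\<And>\<rho>. \<rho> \<in> density_ops H \<Longrightarrow> Q \<rho>"
    and add: "\<And>S T. S \<in> trace_class H \<Longrightarrow> T \<in> trace_class H \<Longrightarrow> Q S \<Longrightarrow> Q T \<Longrightarrow> Q (S + T)"
    and scale: "\<And>c T. T \<in> trace_class H \<Longrightarrow> Q T \<Longrightarrow> Q (c *\<^sub>C T)"
  shows "Q T"
proof -
  have pos: "Q P" if P: "positive_trace H P s" for P s
  proof (cases "s = 0")
    case True
    then show ?thesis using P positive_trace_eq_zero zero by auto
  next
    case False
    have d: "of_real (1 / s) *\<^sub>C P \<in> density_ops H" by (rule positive_trace_normalize[OF P False])
    then have "of_real (1 / s) *\<^sub>C P \<in> trace_class H" unfolding density_ops_def by blast
    then have "Q (of_real s *\<^sub>C of_real (1 / s) *\<^sub>C P)" using density[OF d] by (rule scale)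
    then show ?thesis using False by (simp add: scaleC_scaleC scaleC_one)
  qed
  obtain P s where P: "\<And>k. positive_trace H (P k) (s k)" and TP: "T = (\<Sum>k<4. \<i> ^ k *\<^sub>C P k)"
    by (rule trace_class_cases[OF T]) (rule that)
  note tc = positive_trace_trace_class[OF P]
  show ?thesis
    unfolding TP sum_lessThan_4 by (intro add scale pos[OF P] trace_class_add trace_class_scale tc)
qed

lemma cone_extension_density: "\<rho> \<in> density_ops H \<Longrightarrow> cone_extension J \<rho> = J \<rho>"
  by (simp add: density_iff cone_extension_eq scaleC_one)

lemma cone_extension_scale:
  assumes P: "positive_trace H P s" and r: "0 \<le> r"
  shows "cone_extension J (of_real r *\<^sub>C P) = of_real r *\<^sub>C cone_extension J P"
proof (cases "r = 0")
  case True
  then show ?thesis using cone_extension_eq[OF positive_trace_zero] by simp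
next
  case False
  then show ?thesis
    unfolding cone_extension_eq[OF positive_trace_scale[OF P r]] cone_extension_eq[OF P]
    by (simp add: scaleC_scaleC)
qed

text \<open>Normalizing \<open>P + Q\<close> gives the mixture of the normalized summands with
  weights \<open>s / (s + t)\<close> and \<open>t / (s + t)\<close>, to which affinity applies. A
  summand of trace 0 is the zero operator and is treated apart, having no normalization.\<close>

lemma cone_extension_add:
  assumes affine: "\<And>\<rho> \<sigma> p. \<rho> \<in> density_ops H \<Longrightarrow> \<sigma> \<in> density_ops H \<Longrightarrow> p \<in> {0..1} \<Longrightarrow>
      J (of_real p *\<^sub>C \<rho> + of_real (1 - p) *\<^sub>C \<sigma>) = of_real p *\<^sub>C J \<rho> + of_real (1 - p) *\<^sub>C J \<sigma>"
    and P: "positive_trace H P s" and Q: "positive_trace H Q t"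
  shows "cone_extension J (P + Q) = cone_extension J P + cone_extension J Q"
proof (cases "s = 0 \<or> t = 0")
  case True
  then have "P = 0 \<or> Q = 0" using P Q positive_trace_eq_zero by blast
  then show ?thesis using cone_extension_eq[OF positive_trace_zero, of J] by auto
next
  case False
  then have s: "s > 0" "of_real (1 / s) *\<^sub>C P \<in> density_ops H" and t: "t > 0" "of_real (1 / t) *\<^sub>C Q \<in> density_ops H"
    using positive_trace_normalize[OF P] positive_trace_normalize[OF Q] by auto
  let ?p = "s / (s + t)"
  have p: "?p \<in> {0..1}" "1 - ?p = t / (s + t)" using s t by (auto simp: field_simps)
  have "of_real (1 / (s + t)) *\<^sub>C (P + Q) =
      of_real ?p *\<^sub>C of_real (1 / s) *\<^sub>C P + of_real (1 - ?p) *\<^sub>C of_real (1 / t) *\<^sub>C Q"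
    unfolding p(2) using s t by (simp add: scaleC_scaleC complex_vector.scale_right_distrib)
  then have "J (of_real (1 / (s + t)) *\<^sub>C (P + Q)) =
      of_real ?p *\<^sub>C J (of_real (1 / s) *\<^sub>C P) + of_real (1 - ?p) *\<^sub>C J (of_real (1 / t) *\<^sub>C Q)"
    using affine[OF s(2) t(2) p(1)] by simp
  moreover have "complex_of_real (s + t) \<noteq> 0" using s t by (simp flip: of_real_add)
  ultimately show ?thesis
    unfolding cone_extension_eq[OF positive_trace_add[OF P Q]] cone_extension_eq[OF P] cone_extension_eq[OF Q] p(2)
    by (simp add: scaleC_scaleC complex_vector.scale_right_distrib)
qed

end

section \<open>Rank-one projections as observables\<close>

context inner_product_space
begin

text \<open>For a unit vector \<open>v\<close>, the spectral measure of \<open>proj v\<close>,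
  concentrated on the eigenvalues 1 and 0; they contribute \<open>proj v\<close> and its
  complement.\<close>

definition proj_measure :: "'v \<Rightarrow> real set \<Rightarrow> 'v \<Rightarrow> 'v" where
  "proj_measure v \<Delta> = complex_of_real (indicator \<Delta> 1) *\<^sub>C proj v + complex_of_real (indicator \<Delta> 0) *\<^sub>C (ident - proj v)"

context
  fixes v assumes v: "v \<in> hcarrier H" and unit: "\<parallel>v\<parallel> = 1"
begin

lemma proj_self_adjoint: "\<lbrakk>x \<in> hcarrier H; y \<in> hcarrier H\<rbrakk> \<Longrightarrow> \<langle>proj v x, y\<rangle> = \<langle>x, proj v y\<rangle>"
  using v inner_commute[of x v] by (simp add: proj_apply inner_simps mult.commute)

lemma proj_idem: "x \<in> hcarrier H \<Longrightarrow> proj v (proj v x) = proj v x"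
  using v unit by (simp add: proj_apply inner_scale_right inner_self)

lemma proj_measure_bounded: "proj_measure v \<Delta> \<in> bounded_ops H"
  using v by (simp add: proj_measure_def)

lemma proj_measure_apply: "x \<in> hcarrier H \<Longrightarrow>
    proj_measure v \<Delta> x = complex_of_real (indicator \<Delta> 1) *\<^sub>C proj v x + complex_of_real (indicator \<Delta> 0) *\<^sub>C (x - proj v x)"
  by (simp add: proj_measure_def)

lemma inner_proj_measure:
  assumes x: "x \<in> hcarrier H"
  shows "Re \<langle>x, proj_measure v \<Delta> x\<rangle> = indicator \<Delta> 1 * \<parallel>proj v x\<parallel>\<^sup>2 + indicator \<Delta> 0 * \<parallel>x - proj v x\<parallel>\<^sup>2"
proof -
  have p: "proj v x \<in> hcarrier H" using v x by simp
  have "\<langle>proj v x, proj v x\<rangle> = \<langle>x, proj v x\<rangle>"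
    using proj_self_adjoint[OF x p] proj_idem[OF x] by simp
  then have 1: "\<langle>x, proj v x\<rangle> = of_real (\<parallel>proj v x\<parallel>\<^sup>2)" using inner_self[OF p] by simp
  then have "\<langle>x, x - proj v x\<rangle> = of_real (\<parallel>x - proj v x\<parallel>\<^sup>2)"
    using hnorm_diff_sq[OF x p] x p by (simp add: inner_diff_right inner_self flip: of_real_power of_real_diff)
  with 1 show ?thesis using x p by (simp add: proj_measure_apply inner_add_right inner_scale_right)
qed

lemma proj_valued_measure: "projection_valued_measure H (proj_measure v)"
  unfolding projection_valued_measure_def
proof (intro conjI ballI allI impI)
  fix \<Delta> :: "real set"
  show "proj_measure v \<Delta> \<in> bounded_ops H" by (rule proj_measure_bounded)
  show "proj_measure v \<Delta> \<circ> proj_measure v \<Delta> = proj_measure v \<Delta>"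
  proof (rule op_ext)
    fix x assume x: "x \<in> hcarrier H"
    have "proj v x \<in> hcarrier H" "proj v (x - proj v x) = 0" using x v proj_idem[OF x] by (simp_all add: op_diff)
    then show "(proj_measure v \<Delta> \<circ> proj_measure v \<Delta>) x = proj_measure v \<Delta> x"
      using x v proj_idem[OF x]
      by (simp add: proj_measure_apply op_diff scaleC_one split: split_indicator)
  qed (use proj_measure_bounded in auto)
  fix x y assume x: "x \<in> hcarrier H" and y: "y \<in> hcarrier H"
  show "\<langle>proj_measure v \<Delta> x, y\<rangle> = \<langle>x, proj_measure v \<Delta> y\<rangle>"
    using x y v proj_self_adjoint[OF x y] by (simp add: proj_measure_apply inner_simps)
next
  fix x assume "x \<in> hcarrier H"
  then show "proj_measure v UNIV x = x" by (simp add: proj_measure_apply scaleC_one)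
next
  fix \<Delta> :: "nat \<Rightarrow> real set" and x
  assume disj: "disjoint_family \<Delta>" and x: "x \<in> hcarrier H"
  \<comment> \<open>The remainder of the indicator series at \<open>t\<close>. Only the two atoms
    enter, so convergence of \<open>c 1\<close> and \<open>c 0\<close> settles the matter.\<close>
  define c where "c t n = (indicator (\<Union>j. \<Delta> j) t - (\<Sum>j<n. indicator (\<Delta> j) t) :: real)" for t n
  have c: "c t \<longlonglongrightarrow> 0" for t
    using indicator_sums[of \<Delta> t] disj unfolding c_def sums_def
    by (intro tendsto_eq_intros) (auto simp: disjoint_family_on_def)
  have p: "proj v x \<in> hcarrier H" using v x by simp
  have S: "(\<Sum>j<n. proj_measure v (\<Delta> j) x) =
      complex_of_real (\<Sum>j<n. indicator (\<Delta> j) 1) *\<^sub>C proj v x + complex_of_real (\<Sum>j<n. indicator (\<Delta> j) 0) *\<^sub>C (x - proj v x)" for n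
    using x by (simp add: proj_measure_apply sum.distrib complex_vector.scale_sum_left)
  have "\<parallel>proj_measure v (\<Union>j. \<Delta> j) x - (\<Sum>j<n. proj_measure v (\<Delta> j) x)\<parallel>
      \<le> \<bar>c 1 n\<bar> * \<parallel>proj v x\<parallel> + \<bar>c 0 n\<bar> * \<parallel>x - proj v x\<parallel>" for n
  proof -
    have "proj_measure v (\<Union>j. \<Delta> j) x - (\<Sum>j<n. proj_measure v (\<Delta> j) x) =
        complex_of_real (c 1 n) *\<^sub>C proj v x + complex_of_real (c 0 n) *\<^sub>C (x - proj v x)"
      unfolding S unfolding proj_measure_apply[OF x] c_def of_real_diff complex_vector.scale_left_diff_distrib
      by (simp only: add_diff_add)
    then show ?thesis
      using triangle[of "complex_of_real (c 1 n) *\<^sub>C proj v x" "complex_of_real (c 0 n) *\<^sub>C (x - proj v x)"] x p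
      by (simp add: hnorm_scale)
  qed
  then have le: "norm \<parallel>proj_measure v (\<Union>j. \<Delta> j) x - (\<Sum>j<n. proj_measure v (\<Delta> j) x)\<parallel>
      \<le> \<bar>c 1 n\<bar> * \<parallel>proj v x\<parallel> + \<bar>c 0 n\<bar> * \<parallel>x - proj v x\<parallel>" for n
    using proj_measure_bounded by (simp add: sum_mem)
  have "(\<lambda>n. \<bar>c 1 n\<bar> * \<parallel>proj v x\<parallel> + \<bar>c 0 n\<bar> * \<parallel>x - proj v x\<parallel>) \<longlonglongrightarrow> 0"
    by (intro tendsto_add_zero tendsto_mult_left_zero tendsto_rabs_zero c)
  then show "(\<lambda>n. \<parallel>proj_measure v (\<Union>j. \<Delta> j) x - (\<Sum>j<n. proj_measure v (\<Delta> j) x)\<parallel>) \<longlonglongrightarrow> 0"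
    by (rule Lim_null_comparison[OF always_eventually[OF allI[OF le]]])
qed

text \<open>Identification with a measure carrying two atoms turns integrals into finite sums.
  \<open>vector_measure\<close> is a bare \<open>measure_of\<close>, and equating its set function
  with that of an actual measure also shows countable additivity. The \<open>distr\<close> passes
  from the discrete sigma-algebra on the atoms to the Borel sets.\<close>

lemma vector_measure_proj:
  assumes x: "x \<in> hcarrier H"
  shows "vector_measure H (proj_measure v) x =
    distr (point_measure {0, 1} (\<lambda>t. ennreal (if t = 1 then \<parallel>proj v x\<parallel>\<^sup>2 else \<parallel>x - proj v x\<parallel>\<^sup>2))) borel id"
    (is "_ = ?N")
proof -
  have "vector_measure H (proj_measure v) x = measure_of (space ?N) (sets ?N) (emeasure ?N)"
    unfolding vector_measure_def
  proof (simp only: space_distr sets_distr space_borel, rule measure_of_eq)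
    show "sets borel \<subseteq> Pow (UNIV :: real set)" by simp
    fix \<Delta> :: "real set" assume "\<Delta> \<in> sigma_sets UNIV (sets borel)"
    then have \<Delta>: "\<Delta> \<in> sets borel" using sets.sigma_sets_eq[of "borel :: real measure"] by simp
    have "emeasure ?N \<Delta> = (\<Sum>t\<in>\<Delta> \<inter> {0, 1}. ennreal (if t = 1 then \<parallel>proj v x\<parallel>\<^sup>2 else \<parallel>x - proj v x\<parallel>\<^sup>2))"
      using \<Delta> by (subst emeasure_distr) (auto simp: emeasure_point_measure_finite space_point_measure sets_point_measure measurable_def)
    also have "\<dots> = ennreal (\<Sum>t\<in>\<Delta> \<inter> {0, 1}. if t = 1 then \<parallel>proj v x\<parallel>\<^sup>2 else \<parallel>x - proj v x\<parallel>\<^sup>2)"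
      by (rule sum_ennreal) simp
    also have "(\<Sum>t\<in>\<Delta> \<inter> {0, 1}. if t = 1 then \<parallel>proj v x\<parallel>\<^sup>2 else \<parallel>x - proj v x\<parallel>\<^sup>2) = Re \<langle>x, proj_measure v \<Delta> x\<rangle>"
      unfolding inner_proj_measure[OF x]
      by (cases "0 \<in> \<Delta>"; cases "1 \<in> \<Delta>") (simp_all add: Int_insert_right)
    finally show "ennreal (Re \<langle>x, proj_measure v \<Delta> x\<rangle>) = emeasure ?N \<Delta>" by (rule sym)
  qed
  then show ?thesis unfolding measure_of_of_measure .
qed

lemma spectral_measure_proj: "spectral_measure H (hcarrier H) (proj v) (proj_measure v)"
  unfolding spectral_measure_def
proof (intro conjI ballI)
  show "projection_valued_measure H (proj_measure v)" by (rule proj_valued_measure)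
  have id: "id \<in> point_measure {0, 1} f \<rightarrow>\<^sub>M borel" for f :: "real \<Rightarrow> ennreal"
    by (simp add: measurable_def sets_point_measure space_point_measure)
  show "hcarrier H = {x \<in> hcarrier H. integrable (vector_measure H (proj_measure v) x) (\<lambda>t. t\<^sup>2)}"
    using id by (auto simp: vector_measure_proj integrable_distr_eq integrable_point_measure_finite)
  fix x assume x: "x \<in> hcarrier H"
  have p: "proj v x \<in> hcarrier H" using v x by simp
  have "(\<integral>t. t \<partial>vector_measure H (proj_measure v) x) = \<parallel>proj v x\<parallel>\<^sup>2"
    using id by (simp add: vector_measure_proj[OF x] integral_distr lebesgue_integral_point_measure_finite)
  moreover have "\<langle>x, proj v x\<rangle> = of_real (\<parallel>proj v x\<parallel>\<^sup>2)"
    using proj_self_adjoint[OF x p] proj_idem[OF x] inner_self[OF p] by simp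
  ultimately show "\<langle>x, proj v x\<rangle> = complex_of_real (\<integral>t. t \<partial>vector_measure H (proj_measure v) x)" by simp
qed

lemma self_adjoint_proj: "self_adjoint H (hcarrier H) (proj v)"
  unfolding self_adjoint_def
proof (intro conjI ballI allI)
  show "dense_in H (hcarrier H)" unfolding dense_in_def by (metis diff_self hnorm_zero order_refl)
  show "{y \<in> hcarrier H. \<exists>z\<in>hcarrier H. \<forall>x\<in>hcarrier H. \<langle>proj v x, y\<rangle> = \<langle>x, z\<rangle>} = hcarrier H"
    using v proj_self_adjoint by (auto intro!: bexI[of _ "proj v _"])
qed (use v subspace proj_self_adjoint in \<open>simp_all add: op_simps\<close>)

end

end

context hilbert_space
begin

text \<open>The diagonal entry at \<open>e\<close> is
  \<open>\<langle>\<rho> v, e\<rangle> * \<langle>e, v\<rangle>\<close>, so the trace is the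
  Parseval expansion of \<open>\<langle>\<rho> v, v\<rangle>\<close>.\<close>

lemma op_trace_proj:
  assumes v: "v \<in> hcarrier H" and \<rho>: "positive_op H \<rho>"
  shows "op_trace H (proj v \<circ> \<rho>) = \<langle>v, \<rho> v\<rangle>"
proof -
  let ?B = "SOME B. orthonormal_basis H B"
  note B = some_basis
  have \<rho>': "\<rho> \<in> bounded_ops H" using \<rho> by simp
  have "((\<lambda>e. \<langle>\<rho> v, e\<rangle> * \<langle>e, v\<rangle>) has_sum \<langle>\<rho> v, v\<rangle>) ?B"
    using v \<rho>' by (intro Parseval_inner B) auto
  then have "(\<Sum>\<^sub>\<infinity>e\<in>?B. \<langle>\<rho> v, e\<rangle> * \<langle>e, v\<rangle>) = \<langle>v, \<rho> v\<rangle>"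
    using positive_self_adjoint[OF \<rho> v v] infsumI by metis
  moreover have "\<langle>e, (proj v \<circ> \<rho>) e\<rangle> = \<langle>\<rho> v, e\<rangle> * \<langle>e, v\<rangle>" if "e \<in> ?B" for e
    using onb_mem[OF B that] v \<rho>' positive_self_adjoint[OF \<rho> v, of e] by (simp add: inner_proj mult.commute)
  ultimately show ?thesis unfolding op_trace_def by (simp cong: infsum_cong)
qed

text \<open>Unit vectors are the ones whose \<open>proj\<close> is an observable, so this is the
  form in which measured probabilities identify an operator.\<close>

lemma op_ext_unit:
  assumes S: "S \<in> bounded_ops H" and T: "T \<in> bounded_ops H"
    and eq: "\<And>v. v \<in> hcarrier H \<Longrightarrow> \<parallel>v\<parallel> = 1 \<Longrightarrow> \<langle>v, S v\<rangle> = \<langle>v, T v\<rangle>"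
  shows "S = T"
proof (rule op_ext_quadratic[OF S T])
  fix x assume x: "x \<in> hcarrier H"
  show "\<langle>x, S x\<rangle> = \<langle>x, T x\<rangle>"
  proof (cases "x = 0")
    case False
    then have n: "\<parallel>x\<parallel> > 0" using hnorm_eq_zero[OF x] hnorm_nonneg[OF x] by linarith
    define v where "v = of_real (1 / \<parallel>x\<parallel>) *\<^sub>C x"
    have v: "v \<in> hcarrier H" "\<parallel>v\<parallel> = 1" using n x by (auto simp: v_def hnorm_scale norm_divide)
    have xv: "x = of_real \<parallel>x\<parallel> *\<^sub>C v" using n by (simp add: v_def scaleC_scaleC scaleC_one)
    have "\<langle>of_real r *\<^sub>C v, S (of_real r *\<^sub>C v)\<rangle> = \<langle>of_real r *\<^sub>C v, T (of_real r *\<^sub>C v)\<rangle>" for r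
      using v S T eq[OF v] by (simp add: op_scale inner_simps)
    then show ?thesis using xv by metis
  qed (use S T in simp)
qed

end

section \<open>Unitary maps\<close>

text \<open>Taking the inverse as a parameter makes the notion symmetric, so that
  \<open>inverse\<close> supplies every fact in the opposite direction.\<close>

locale unitary_pair = H: hilbert_space H + K: hilbert_space K
  for H :: "'u::complex_vector hspace" and K :: "'w::complex_vector hspace" +
  fixes U :: "'u \<Rightarrow> 'w" and W :: "'w \<Rightarrow> 'u"
  assumes U_mem [simp]: "x \<in> hcarrier H \<Longrightarrow> U x \<in> hcarrier K"
    and W_mem [simp]: "y \<in> hcarrier K \<Longrightarrow> W y \<in> hcarrier H"
    and WU [simp]: "x \<in> hcarrier H \<Longrightarrow> W (U x) = x"
    and UW [simp]: "y \<in> hcarrier K \<Longrightarrow> U (W y) = y"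
    and U_add: "x \<in> hcarrier H \<Longrightarrow> x' \<in> hcarrier H \<Longrightarrow> U (x + x') = U x + U x'"
    and U_scale: "x \<in> hcarrier H \<Longrightarrow> U (c *\<^sub>C x) = c *\<^sub>C U x"
    and U_inner: "x \<in> hcarrier H \<Longrightarrow> x' \<in> hcarrier H \<Longrightarrow> hinner K (U x) (U x') = hinner H x x'"
begin

lemma inverse: "unitary_pair K H W U"
proof unfold_locales
  fix y y' c assume y: "y \<in> hcarrier K" and y': "y' \<in> hcarrier K"
  show "W (y + y') = W y + W y'" using WU[of "W y + W y'"] y y' by (simp add: U_add)
  show "hinner H (W y) (W y') = hinner K y y'" using U_inner[of "W y" "W y'"] y y' by simp
next
  fix y c assume y: "y \<in> hcarrier K"
  show "W (c *\<^sub>C y) = c *\<^sub>C W y" using WU[of "c *\<^sub>C W y"] y by (simp add: U_scale)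
qed auto

lemma U_sum: "finite I \<Longrightarrow> (\<And>i. i \<in> I \<Longrightarrow> f i \<in> hcarrier H) \<Longrightarrow> U (\<Sum>i\<in>I. f i) = (\<Sum>i\<in>I. U (f i))"
proof (induction I rule: finite_induct)
  case empty
  then show ?case using U_scale[of 0 0] by simp
qed (simp_all add: U_add H.sum_mem)

lemma U_diff: "x \<in> hcarrier H \<Longrightarrow> x' \<in> hcarrier H \<Longrightarrow> U (x - x') = U x - U x'"
  using U_add[of x "- x'"] U_scale[of x' "-1"] by simp

lemma U_norm: "x \<in> hcarrier H \<Longrightarrow> hnorm K (U x) = hnorm H x"
  by (simp add: hnorm_def U_inner)

text \<open>Conjugation by the unitary. The maps \<open>U\<close> and \<open>W\<close> are
  unconstrained off the carriers, hence the explicit 0.\<close>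

definition transport :: "('u \<Rightarrow> 'u) \<Rightarrow> 'w \<Rightarrow> 'w" where
  "transport T y = (if y \<in> hcarrier K then U (T (W y)) else 0)"

lemma transport_apply [simp]: "y \<in> hcarrier K \<Longrightarrow> transport T y = U (T (W y))"
  by (simp add: transport_def)

lemma transport_bounded:
  assumes T: "T \<in> bounded_ops H" shows "transport T \<in> bounded_ops K"
proof -
  interpret inv: unitary_pair K H W U by (rule inverse)
  obtain C where C: "\<And>x. x \<in> hcarrier H \<Longrightarrow> hnorm H (T x) \<le> C * hnorm H x"
    by (rule H.op_bound[OF T]) (rule that)
  show ?thesis
  proof (rule K.bounded_opsI)
    fix y assume y: "y \<in> hcarrier K"
    show "hnorm K (transport T y) \<le> C * hnorm K y"
      using C[of "W y"] y T by (simp add: U_norm inv.U_norm)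
  qed (use T in \<open>auto simp: transport_def inv.U_add inv.U_scale H.op_add H.op_scale U_add U_scale\<close>)
qed

lemma transport_add: "S \<in> bounded_ops H \<Longrightarrow> T \<in> bounded_ops H \<Longrightarrow> transport (S + T) = transport S + transport T"
  by (auto simp: fun_eq_iff transport_def U_add)

lemma transport_scale: "T \<in> bounded_ops H \<Longrightarrow> transport (c *\<^sub>C T) = c *\<^sub>C transport T"
  by (auto simp: fun_eq_iff transport_def U_scale)

lemma transport_positive:
  assumes T: "positive_op H T" shows "positive_op K (transport T)"
  unfolding positive_op_def
proof (intro conjI ballI)
  show "transport T \<in> bounded_ops K" using T by (simp add: transport_bounded)
  fix y assume y: "y \<in> hcarrier K"
  have "hinner K y (transport T y) = hinner H (W y) (T (W y))"
    using U_inner[of "W y" "T (W y)"] T y by simp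
  then show "Im (hinner K y (transport T y)) = 0" "Re (hinner K y (transport T y)) \<ge> 0"
    using T y by (auto simp: positive_op_def)
qed

lemma transport_orthonormal_basis:
  assumes B: "orthonormal_basis H B" shows "orthonormal_basis K (U ` B)"
  unfolding orthonormal_basis_def
proof (intro conjI ballI)
  have BH: "e \<in> hcarrier H" if "e \<in> B" for e using H.onb_mem[OF B that] .
  show sub: "U ` B \<subseteq> hcarrier K" using BH by auto
  fix e f assume "e \<in> U ` B" "f \<in> U ` B"
  then obtain e' f' where ef: "e' \<in> B" "f' \<in> B" "e = U e'" "f = U f'" by blast
  then have "e = f \<longleftrightarrow> e' = f'" using BH WU by metis
  then show "hinner K e f = (if e = f then 1 else 0)"
    using B ef BH by (simp add: U_inner orthonormal_basis_def)
next
  have BH: "e \<in> hcarrier H" if "e \<in> B" for e using H.onb_mem[OF B that] .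
  have dense: "dense_in H (complex_vector.span B)" using B by (simp add: orthonormal_basis_def)
  show "dense_in K (complex_vector.span (U ` B))"
    unfolding dense_in_def
  proof (intro conjI ballI allI impI)
    show "complex_vector.span (U ` B) \<subseteq> hcarrier K"
      using BH by (intro complex_vector.span_minimal K.subspace) auto
    fix y and \<epsilon> :: real assume y: "y \<in> hcarrier K" and \<epsilon>: "\<epsilon> > 0"
    then obtain z where z: "z \<in> complex_vector.span B" "hnorm H (W y - z) < \<epsilon>"
      using dense unfolding dense_in_def by (meson W_mem)
    have zH: "z \<in> hcarrier H" using z(1) dense unfolding dense_in_def by blast
    obtain F r where F: "finite F" "F \<subseteq> B" "z = (\<Sum>a\<in>F. r a *\<^sub>C a)"
      using z(1) unfolding complex_vector.span_explicit by blast
    have "U z = (\<Sum>a\<in>F. r a *\<^sub>C U a)"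
      unfolding F(3) using F(1,2) BH by (subst U_sum) (auto simp: U_scale subset_iff)
    also have "\<dots> \<in> complex_vector.span (U ` B)"
      using F(2) by (intro complex_vector.span_sum complex_vector.span_scale complex_vector.span_base) auto
    finally have "U z \<in> complex_vector.span (U ` B)" .
    moreover have "hnorm K (y - U z) < \<epsilon>"
      using U_norm[of "W y - z"] z(2) y zH by (simp add: U_diff)
    ultimately show "\<exists>z\<in>complex_vector.span (U ` B). hnorm K (y - z) < \<epsilon>" by blast
  qed
qed

lemma transport_positive_trace:
  assumes P: "positive_trace H P s" shows "positive_trace K (transport P) s"
proof -
  obtain B where B: "orthonormal_basis H B" using H.orthonormal_basis_exists by blast
  have BH: "e \<in> hcarrier H" if "e \<in> B" for e using H.onb_mem[OF B that] .
  have inj: "inj_on U B" using BH WU by (metis inj_onI)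
  have eq: "Re (hinner H e (P e)) = Re (hinner K (U e) (transport P (U e)))" if "e \<in> B" for e
    using BH[OF that] H.positive_trace_bounded[OF P] by (simp add: U_inner)
  have "((\<lambda>f. Re (hinner K f (transport P f))) has_sum s) (U ` B)"
    unfolding has_sum_reindex[OF inj] o_def
    using iffD1[OF has_sum_cong[OF eq] H.positive_trace_sum[OF P B]] .
  then show ?thesis
    by (rule K.positive_traceI[OF transport_positive[OF H.positive_trace_positive[OF P]] transport_orthonormal_basis[OF B]])
qed

lemma transport_density: "\<rho> \<in> density_ops H \<Longrightarrow> transport \<rho> \<in> density_ops K"
  by (simp add: H.density_iff K.density_iff transport_positive_trace)

lemma transport_zero: "transport 0 = 0"
  using transport_scale[of 0 0] by simp

lemma transport_trace_class: "T \<in> trace_class H \<Longrightarrow> transport T \<in> trace_class K"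
proof (induction rule: H.trace_class_induct)
  case zero
  show ?case unfolding transport_zero by (rule K.trace_class_zero)
next
  case (density \<rho>)
  then show ?case using transport_density unfolding density_ops_def by blast
next
  case (add S T)
  then show ?case
    unfolding transport_add[OF H.trace_class_bounded[OF add(1)] H.trace_class_bounded[OF add(2)]]
    by (intro K.trace_class_add)
next
  case (scale c T)
  then show ?case unfolding transport_scale[OF H.trace_class_bounded[OF scale(1)]] by (intro K.trace_class_scale)
qed

end

lemma (in unitary_pair) transport_inverse:
  assumes "T \<in> bounded_ops H"
  shows "unitary_pair.transport H W U (transport T) = T"
proof -
  interpret inv: unitary_pair K H W U by (rule inverse)
  show ?thesis
    using assms by (intro H.op_ext inv.transport_bounded transport_bounded) auto
qed

section \<open>Tensor products with finite-dimensional spaces\<close>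

context inner_product_space
begin

lemma tensor_Cn_carrier: "x \<in> hcarrier (tensor_Cn H n) \<longleftrightarrow> (\<forall>i<n. x i \<in> hcarrier H) \<and> (\<forall>i\<ge>n. x i = 0)"
  by (simp add: tensor_Cn_def)

lemma tensor_Cn_mem [simp]: "x \<in> hcarrier (tensor_Cn H n) \<Longrightarrow> x i \<in> hcarrier H"
  by (cases "i < n") (auto simp: tensor_Cn_carrier not_less)

lemma tensor_Cn_inner: "hinner (tensor_Cn H n) x y = (\<Sum>i<n. \<langle>x i, y i\<rangle>)"
  unfolding tensor_Cn_def by simp

lemma tensor_Cn_inner_product_space: "inner_product_space (tensor_Cn H n)"
proof
  show "complex_vector.subspace (hcarrier (tensor_Cn H n))"
    by (auto simp: complex_vector.subspace_def tensor_Cn_carrier)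
next
  fix x y assume "x \<in> hcarrier (tensor_Cn H n)" "y \<in> hcarrier (tensor_Cn H n)"
  then show "hinner (tensor_Cn H n) x y = cnj (hinner (tensor_Cn H n) y x)"
    unfolding tensor_Cn_inner cnj_sum by (intro sum.cong refl inner_commute) simp_all
next
  fix x assume x: "x \<in> hcarrier (tensor_Cn H n)"
  then show "Re (hinner (tensor_Cn H n) x x) \<ge> 0"
    unfolding tensor_Cn_inner by (simp add: sum_nonneg inner_nonneg)
  assume "hinner (tensor_Cn H n) x x = 0"
  then have "(\<Sum>i<n. \<parallel>x i\<parallel>\<^sup>2) = 0"
    using x by (simp add: tensor_Cn_inner inner_self flip: of_real_sum of_real_power)
  then have "\<forall>i<n. \<parallel>x i\<parallel> = 0" by (subst (asm) sum_nonneg_eq_0_iff) auto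
  then show "x = 0" using x hnorm_eq_zero by (auto simp: fun_eq_iff tensor_Cn_carrier not_less[symmetric])
qed (simp_all add: tensor_Cn_inner inner_add_right inner_scale_right sum.distrib sum_distrib_left)

lemma tensor_Cn_norm_sq:
  "x \<in> hcarrier (tensor_Cn H n) \<Longrightarrow> (hnorm (tensor_Cn H n) x)\<^sup>2 = (\<Sum>i<n. \<parallel>x i\<parallel>\<^sup>2)"
  by (simp add: inner_product_space.hnorm_sq[OF tensor_Cn_inner_product_space] tensor_Cn_inner hnorm_sq)

lemma tensor_Cn_norm_ge:
  assumes x: "x \<in> hcarrier (tensor_Cn H n)"
  shows "\<parallel>x i\<parallel> \<le> hnorm (tensor_Cn H n) x"
proof (cases "i < n")
  case True
  have "\<parallel>x i\<parallel>\<^sup>2 \<le> (\<Sum>i<n. \<parallel>x i\<parallel>\<^sup>2)" using True by (intro member_le_sum) auto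
  then have "\<parallel>x i\<parallel>\<^sup>2 \<le> (hnorm (tensor_Cn H n) x)\<^sup>2" by (simp only: tensor_Cn_norm_sq[OF x])
  then show ?thesis
    by (rule power2_le_imp_le) (rule inner_product_space.hnorm_nonneg[OF tensor_Cn_inner_product_space x])
next
  case False
  then show ?thesis
    using x inner_product_space.hnorm_nonneg[OF tensor_Cn_inner_product_space x] by (simp add: tensor_Cn_carrier)
qed

lemma tensor_Cn_norm_le:
  assumes x: "x \<in> hcarrier (tensor_Cn H n)"
  shows "hnorm (tensor_Cn H n) x \<le> (\<Sum>i<n. \<parallel>x i\<parallel>)"
proof -
  have "hnorm (tensor_Cn H n) x = L2_set (\<lambda>i. \<parallel>x i\<parallel>) {..<n}"
    unfolding L2_set_def tensor_Cn_norm_sq[OF x, symmetric]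
    using inner_product_space.hnorm_nonneg[OF tensor_Cn_inner_product_space x] by simp
  then show ?thesis using L2_set_le_sum[of "{..<n}" "\<lambda>i. \<parallel>x i\<parallel>"] x by simp
qed

end

lemma (in hilbert_space) tensor_Cn_hilbert_space: "hilbert_space (tensor_Cn H n)"
proof -
  interpret Hn: inner_product_space "tensor_Cn H n" by (rule tensor_Cn_inner_product_space)
  show ?thesis
  proof
    fix X :: "nat \<Rightarrow> nat \<Rightarrow> 'a"
    assume X: "\<And>m. X m \<in> hcarrier (tensor_Cn H n)"
      and Cauchy: "\<And>\<epsilon>. \<epsilon> > 0 \<Longrightarrow> \<exists>N. \<forall>m\<ge>N. \<forall>k\<ge>N. hnorm (tensor_Cn H n) (X m - X k) < \<epsilon>"
    have "\<exists>l\<in>hcarrier H. (\<lambda>m. \<parallel>X m i - l\<parallel>) \<longlonglongrightarrow> 0" for i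
    proof (rule Cauchy_converges)
      show "X m i \<in> hcarrier H" for m using tensor_Cn_mem[OF X] .
      fix \<epsilon> :: real assume "\<epsilon> > 0"
      then obtain N where "\<And>m k. m \<ge> N \<Longrightarrow> k \<ge> N \<Longrightarrow> hnorm (tensor_Cn H n) (X m - X k) < \<epsilon>" using Cauchy by blast
      then have "\<parallel>X m i - X k i\<parallel> < \<epsilon>" if "m \<ge> N" "k \<ge> N" for m k
        using tensor_Cn_norm_ge[OF Hn.diff_mem[OF X[of m] X[of k]], of i] that by fastforce
      then show "\<exists>N. \<forall>m\<ge>N. \<forall>k\<ge>N. \<parallel>X m i - X k i\<parallel> < \<epsilon>" by blast
    qed
    then obtain l where l: "\<And>i. l i \<in> hcarrier H" "\<And>i. (\<lambda>m. \<parallel>X m i - l i\<parallel>) \<longlonglongrightarrow> 0" by metis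
    define y where "y i = (if i < n then l i else 0)" for i
    have y: "y \<in> hcarrier (tensor_Cn H n)" using l by (simp add: y_def tensor_Cn_carrier)
    have lim: "(\<lambda>m. \<Sum>i<n. \<parallel>(X m - y) i\<parallel>) \<longlonglongrightarrow> 0"
      by (intro tendsto_null_sum) (simp add: y_def l)
    have "norm (hnorm (tensor_Cn H n) (X m - y)) \<le> (\<Sum>i<n. \<parallel>(X m - y) i\<parallel>)" for m
      using tensor_Cn_norm_le[OF Hn.diff_mem[OF X y]] X y by simp
    then have "(\<lambda>m. hnorm (tensor_Cn H n) (X m - y)) \<longlonglongrightarrow> 0"
      by (rule Lim_null_comparison[OF always_eventually[OF allI] lim])
    then show "\<exists>l\<in>hcarrier (tensor_Cn H n). (\<lambda>m. hnorm (tensor_Cn H n) (X m - l)) \<longlonglongrightarrow> 0" using y by blast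
  qed
qed

section \<open>Coordinate spaces\<close>

abbreviation unit_vec :: "nat \<Rightarrow> nat \<Rightarrow> complex" where
  "unit_vec j \<equiv> (\<lambda>i. if i = j then 1 else 0)"

lemma Cn_carrier: "c \<in> hcarrier (Cn n) \<longleftrightarrow> (\<forall>i\<ge>n. c i = 0)"
  by (simp add: Cn_def)

lemma unit_vec_mem [simp]: "j < n \<Longrightarrow> unit_vec j \<in> hcarrier (Cn n)"
  by (auto simp: Cn_carrier)

text \<open>\<open>Cn n\<close> is the tensor product of \<open>Cn n\<close> with the one-dimensional space.\<close>

lemma Cn_hilbert_space: "hilbert_space (Cn n)"
proof -
  let ?H = "\<lparr>hcarrier = UNIV, hinner = \<lambda>c d. cnj c * d\<rparr> :: complex hspace"
  have norm: "hnorm ?H c = cmod c" for c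
    by (simp add: hnorm_def cmod_def power2_eq_square)
  have H: "hilbert_space ?H"
  proof
    fix X :: "nat \<Rightarrow> complex"
    assume "\<And>\<epsilon>. \<epsilon> > 0 \<Longrightarrow> \<exists>N. \<forall>m\<ge>N. \<forall>k\<ge>N. hnorm ?H (X m - X k) < \<epsilon>"
    then have "Cauchy X" by (simp add: Cauchy_def norm dist_norm)
    then obtain l where "X \<longlonglongrightarrow> l" using Cauchy_convergent_iff convergent_def by blast
    then show "\<exists>l\<in>hcarrier ?H. (\<lambda>n. hnorm ?H (X n - l)) \<longlonglongrightarrow> 0"
      unfolding norm by (intro bexI[of _ l] tendsto_norm_zero LIM_zero) simp_all
  qed (auto simp: algebra_simps scaleC_complex_def)
  have "Cn n = tensor_Cn ?H n" by (simp add: Cn_def tensor_Cn_def)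
  then show ?thesis using hilbert_space.tensor_Cn_hilbert_space[OF H] by simp
qed

interpretation Cn: hilbert_space "Cn n" for n
  by (rule Cn_hilbert_space)

lemma Cn_expand: "c \<in> hcarrier (Cn n) \<Longrightarrow> c = (\<Sum>j<n. c j *\<^sub>C unit_vec j)"
  by (auto simp: fun_eq_iff sum_fun_apply scaleC_complex_def Cn_carrier not_less if_distrib cong: if_cong)

lemma Cn_inner_unit: "i < n \<Longrightarrow> hinner (Cn n) (unit_vec i) c = c i"
  by (simp add: Cn_def if_distrib[of cnj] if_distrib[of "\<lambda>x. x * _"] cong: if_cong)

lemma Cn_orthonormal_basis: "orthonormal_basis (Cn n) (unit_vec ` {..<n})"
  unfolding orthonormal_basis_def
proof (intro conjI ballI)
  fix e f :: "nat \<Rightarrow> complex" assume "e \<in> unit_vec ` {..<n}" "f \<in> unit_vec ` {..<n}"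
  then obtain i j where ij: "i < n" "j < n" "e = unit_vec i" "f = unit_vec j" by blast
  have "unit_vec i = unit_vec j \<longleftrightarrow> i = j" by (metis zero_neq_one)
  then show "hinner (Cn n) e f = (if e = f then 1 else 0)"
    unfolding ij(3,4) Cn_inner_unit[OF ij(1)] by simp
next
  have sub: "complex_vector.span (unit_vec ` {..<n}) \<subseteq> hcarrier (Cn n)"
    by (intro complex_vector.span_minimal Cn.subspace) auto
  have "c \<in> complex_vector.span (unit_vec ` {..<n})" if "c \<in> hcarrier (Cn n)" for c
    by (subst Cn_expand[OF that]) (intro complex_vector.span_sum complex_vector.span_scale complex_vector.span_base, simp)
  then show "dense_in (Cn n) (complex_vector.span (unit_vec ` {..<n}))"
    using sub unfolding dense_in_def by (metis diff_self Cn.hnorm_zero)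
qed auto

text \<open>\<open>isolated_systems_exist\<close> supplies systems for separable spaces, so
  \<open>Cn n\<close> has to qualify. The dense set consists of the tuples whose entries have
  rational real and imaginary parts.\<close>

lemma Cn_separable_hilbert_space: "separable_hilbert_space (Cn n)"
proof
  define D where "D = {c \<in> hcarrier (Cn n). \<forall>i. Re (c i) \<in> \<rat> \<and> Im (c i) \<in> \<rat>}"
  define Q where "Q = (\<lambda>(a, b). Complex a b) ` (\<rat> \<times> \<rat>)"
  have "countable Q" unfolding Q_def by (intro countable_image countable_SIGMA countable_rat)
  then have "countable (PiE {..<n} (\<lambda>_. Q))" by (intro countable_PiE) auto
  moreover have "D \<subseteq> (\<lambda>f i. if i < n then f i else 0) ` PiE {..<n} (\<lambda>_. Q)"
  proof
    fix c assume c: "c \<in> D"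
    have "c i \<in> Q" for i
      unfolding Q_def using c by (intro image_eqI[of _ _ "(Re (c i), Im (c i))"]) (auto simp: D_def)
    then have "restrict c {..<n} \<in> PiE {..<n} (\<lambda>_. Q)" by auto
    moreover have "c = (\<lambda>i. if i < n then restrict c {..<n} i else 0)"
      using c by (auto simp: D_def Cn_carrier fun_eq_iff)
    ultimately show "c \<in> (\<lambda>f i. if i < n then f i else 0) ` PiE {..<n} (\<lambda>_. Q)" by blast
  qed
  ultimately have "countable D" using countable_image countable_subset by blast
  moreover have "dense_in (Cn n) D"
    unfolding dense_in_def
  proof (intro conjI ballI allI impI)
    show "D \<subseteq> hcarrier (Cn n)" by (auto simp: D_def)
    fix c and \<epsilon> :: real assume c: "c \<in> hcarrier (Cn n)" and \<epsilon>: "\<epsilon> > 0"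
    \<comment> \<open>Each of the \<open>n\<close> coordinates is off by less than
      \<open>2 * \<delta>\<close>, once for each of its two parts; \<open>real n + 1\<close> keeps
      the total below \<open>\<epsilon>\<close> and covers \<open>n = 0\<close>.\<close>
    define \<delta> where "\<delta> = \<epsilon> / (2 * (real n + 1))"
    have \<delta>: "\<delta> > 0" using \<epsilon> by (simp add: \<delta>_def)
    have rat: "\<exists>q\<in>\<rat>. \<bar>x - q\<bar> < \<delta>" for x :: real
    proof -
      obtain q where "q \<in> \<rat>" "x < q" "q < x + \<delta>" using Rats_dense_in_real[of x "x + \<delta>"] \<delta> by auto
      then show ?thesis by (intro bexI[of _ q]) auto
    qed
    have "\<exists>d. Re d \<in> \<rat> \<and> Im d \<in> \<rat> \<and> cmod (c i - d) < 2 * \<delta>" for i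
    proof -
      obtain p q where pq: "p \<in> \<rat>" "\<bar>Re (c i) - p\<bar> < \<delta>" "q \<in> \<rat>" "\<bar>Im (c i) - q\<bar> < \<delta>"
        using rat[of "Re (c i)"] rat[of "Im (c i)"] by blast
      then show ?thesis using cmod_le[of "c i - Complex p q"] by (intro exI[of _ "Complex p q"]) auto
    qed
    then have "\<forall>i. \<exists>d. Re d \<in> \<rat> \<and> Im d \<in> \<rat> \<and> cmod (c i - d) < 2 * \<delta>" by blast
    from choice[OF this] obtain d where
      d: "\<And>i. Re (d i) \<in> \<rat>" "\<And>i. Im (d i) \<in> \<rat>" "\<And>i. cmod (c i - d i) < 2 * \<delta>" by blast
    define y where "y i = (if i < n then d i else 0)" for i
    have y: "y \<in> D" using d by (auto simp: D_def y_def Cn_carrier)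
    have inner: "hinner (Cn n) u u = of_real (\<Sum>i<n. (cmod (u i))\<^sup>2)" for u
      unfolding Cn_def by (simp add: complex_norm_square mult.commute del: of_real_power)
    have "(hnorm (Cn n) (c - y))\<^sup>2 = (\<Sum>i<n. (cmod ((c - y) i))\<^sup>2)"
      using c y by (subst Cn.hnorm_sq) (simp_all add: inner D_def del: of_real_sum minus_apply)
    also have "\<dots> = (\<Sum>i<n. (cmod (c i - d i))\<^sup>2)" by (simp add: y_def)
    also have "\<dots> = (L2_set (\<lambda>i. cmod (c i - d i)) {..<n})\<^sup>2" by (simp add: L2_set_def sum_nonneg)
    finally have "hnorm (Cn n) (c - y) = L2_set (\<lambda>i. cmod (c i - d i)) {..<n}"
      using c y by (simp add: D_def)
    also have "\<dots> \<le> (\<Sum>i<n. cmod (c i - d i))" by (rule L2_set_le_sum) simp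
    also have "\<dots> \<le> (\<Sum>i<n. 2 * \<delta>)" using d(3) by (intro sum_mono less_imp_le)
    also have "\<dots> < \<epsilon>" using \<epsilon> by (simp add: \<delta>_def field_simps)
    finally show "\<exists>y\<in>D. hnorm (Cn n) (c - y) < \<epsilon>" using y by blast
  qed
  ultimately show "\<exists>X. countable X \<and> dense_in (Cn n) X" by blast
qed (rule Cn.Cauchy_converges)

section \<open>Operators on the tensor product with a coordinate space\<close>

context hilbert_space
begin

interpretation Hn: hilbert_space "tensor_Cn H n" for n
  by (rule tensor_Cn_hilbert_space)

lemma tens_Cn_mem [simp]: "x \<in> hcarrier H \<Longrightarrow> c \<in> hcarrier (Cn n) \<Longrightarrow> tens_Cn x c \<in> hcarrier (tensor_Cn H n)"
  by (auto simp: tensor_Cn_carrier Cn_carrier tens_Cn_def)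

lemma tens_Cn_inner: "\<lbrakk>x \<in> hcarrier H; y \<in> hcarrier H; c \<in> hcarrier (Cn n); d \<in> hcarrier (Cn n)\<rbrakk> \<Longrightarrow>
    hinner (tensor_Cn H n) (tens_Cn x c) (tens_Cn y d) = \<langle>x, y\<rangle> * hinner (Cn n) c d"
  using tensor_product_tensor_Cn[of n] unfolding tensor_product_def by blast

lemma tens_Cn_expand:
  assumes z: "z \<in> hcarrier (tensor_Cn H n)"
  shows "z = (\<Sum>j<n. tens_Cn (z j) (unit_vec j))"
proof
  fix i
  have "(\<Sum>j<n. tens_Cn (z j) (unit_vec j)) i = (\<Sum>j<n. if j = i then z i else 0)"
    unfolding sum_fun_apply by (intro sum.cong) (auto simp: tens_Cn_def scaleC_one)
  then show "z i = (\<Sum>j<n. tens_Cn (z j) (unit_vec j)) i" using z by (auto simp: tensor_Cn_carrier)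
qed

lemma tens_Cn_ext:
  assumes R: "R \<in> bounded_ops (tensor_Cn H n)" "R' \<in> bounded_ops (tensor_Cn H n)"
    and eq: "\<And>x c. x \<in> hcarrier H \<Longrightarrow> c \<in> hcarrier (Cn n) \<Longrightarrow> R (tens_Cn x c) = R' (tens_Cn x c)"
  shows "R = R'"
proof (rule Hn.op_ext[OF R])
  fix z assume z: "z \<in> hcarrier (tensor_Cn H n)"
  have "S z = (\<Sum>j<n. S (tens_Cn (z j) (unit_vec j)))" if S: "S \<in> bounded_ops (tensor_Cn H n)" for S
  proof -
    have "S z = S (\<Sum>j<n. tens_Cn (z j) (unit_vec j))" by (rule arg_cong[OF tens_Cn_expand[OF z]])
    also have "\<dots> = (\<Sum>j<n. S (tens_Cn (z j) (unit_vec j)))" using z by (intro Hn.op_sum[OF S]) simp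
    finally show ?thesis .
  qed
  moreover have "R (tens_Cn (z j) (unit_vec j)) = R' (tens_Cn (z j) (unit_vec j))" if "j < n" for j
    using eq z that by simp
  ultimately show "R z = R' z" using R by simp
qed

text \<open>The Kronecker product as a block matrix, with \<open>T\<close> times the matrix entry
  \<open>S (unit_vec j) i\<close> in block \<open>(i, j)\<close>. An explicit formula stands in for
  the definite description \<open>tensor_op\<close>, and its additivity in either factor needs no
  boundedness.\<close>

definition tensor_matrix :: "nat \<Rightarrow> ('a \<Rightarrow> 'a) \<Rightarrow> ((nat \<Rightarrow> complex) \<Rightarrow> (nat \<Rightarrow> complex)) \<Rightarrow> (nat \<Rightarrow> 'a) \<Rightarrow> nat \<Rightarrow> 'a" where
  "tensor_matrix n T S x = (\<lambda>i. if x \<in> hcarrier (tensor_Cn H n) \<and> i < n then \<Sum>j<n. S (unit_vec j) i *\<^sub>C T (x j) else 0)"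

lemma tensor_matrix_bounded:
  assumes T: "T \<in> bounded_ops H"
  shows "tensor_matrix n T S \<in> bounded_ops (tensor_Cn H n)"
proof -
  obtain C where C: "C > 0" "\<And>x. x \<in> hcarrier H \<Longrightarrow> \<parallel>T x\<parallel> \<le> C * \<parallel>x\<parallel>" by (rule op_bound[OF T]) (rule that)
  have mem: "tensor_matrix n T S x \<in> hcarrier (tensor_Cn H n)" for x
    using T by (auto simp: tensor_Cn_carrier tensor_matrix_def intro!: sum_mem)
  show ?thesis
  proof (rule Hn.bounded_opsI)
    fix x assume x: "x \<in> hcarrier (tensor_Cn H n)"
    have "hnorm (tensor_Cn H n) (tensor_matrix n T S x) \<le> (\<Sum>i<n. \<parallel>tensor_matrix n T S x i\<parallel>)"
      by (rule tensor_Cn_norm_le[OF mem])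
    also have "\<dots> \<le> (\<Sum>i<n. \<Sum>j<n. cmod (S (unit_vec j) i) * (C * hnorm (tensor_Cn H n) x))"
    proof (rule sum_mono)
      fix i assume i: "i \<in> {..<n}"
      have "\<parallel>\<Sum>j<m. S (unit_vec j) i *\<^sub>C T (x j)\<parallel> \<le> (\<Sum>j<m. \<parallel>S (unit_vec j) i *\<^sub>C T (x j)\<parallel>)" for m
      proof (induction m)
        case (Suc m)
        have "\<parallel>(\<Sum>j<m. S (unit_vec j) i *\<^sub>C T (x j)) + S (unit_vec m) i *\<^sub>C T (x m)\<parallel>
            \<le> \<parallel>\<Sum>j<m. S (unit_vec j) i *\<^sub>C T (x j)\<parallel> + \<parallel>S (unit_vec m) i *\<^sub>C T (x m)\<parallel>"
          using T by (intro triangle sum_mem) auto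
        with Suc show ?case by simp
      qed simp
      also have "(\<Sum>j<n. \<parallel>S (unit_vec j) i *\<^sub>C T (x j)\<parallel>) \<le> (\<Sum>j<n. cmod (S (unit_vec j) i) * (C * hnorm (tensor_Cn H n) x))"
      proof (rule sum_mono)
        fix j
        have "\<parallel>T (x j)\<parallel> \<le> C * \<parallel>x j\<parallel>" using C x by simp
        also have "\<dots> \<le> C * hnorm (tensor_Cn H n) x" using C tensor_Cn_norm_ge[OF x] by simp
        finally show "\<parallel>S (unit_vec j) i *\<^sub>C T (x j)\<parallel> \<le> cmod (S (unit_vec j) i) * (C * hnorm (tensor_Cn H n) x)"
          using T by (simp add: hnorm_scale mult_left_mono)
      qed
      finally show "\<parallel>tensor_matrix n T S x i\<parallel> \<le> (\<Sum>j<n. cmod (S (unit_vec j) i) * (C * hnorm (tensor_Cn H n) x))"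
        using i x by (simp add: tensor_matrix_def)
    qed
    also have "\<dots> = (\<Sum>i<n. \<Sum>j<n. cmod (S (unit_vec j) i) * C) * hnorm (tensor_Cn H n) x"
      by (simp add: sum_distrib_right mult.assoc)
    finally show "hnorm (tensor_Cn H n) (tensor_matrix n T S x) \<le> (\<Sum>i<n. \<Sum>j<n. cmod (S (unit_vec j) i) * C) * hnorm (tensor_Cn H n) x" .
  next
    fix x y assume x: "x \<in> hcarrier (tensor_Cn H n)" and y: "y \<in> hcarrier (tensor_Cn H n)"
    show "tensor_matrix n T S (x + y) = tensor_matrix n T S x + tensor_matrix n T S y"
      using x y Hn.add_mem[OF x y] T
      by (auto simp: fun_eq_iff tensor_matrix_def op_add complex_vector.scale_right_distrib sum.distrib)
  next
    fix x c assume x: "x \<in> hcarrier (tensor_Cn H n)"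
    show "tensor_matrix n T S (c *\<^sub>C x) = c *\<^sub>C tensor_matrix n T S x"
      using x Hn.scale_mem[OF x, of c] T
      by (auto simp: fun_eq_iff tensor_matrix_def op_scale complex_vector.scale_sum_right scaleC_scaleC mult.commute)
  next
    fix x assume "x \<notin> hcarrier (tensor_Cn H n)"
    then show "tensor_matrix n T S x = 0" by (simp add: tensor_matrix_def fun_eq_iff)
  qed (rule mem)
qed

lemma tensor_matrix_tens:
  assumes T: "T \<in> bounded_ops H" and S: "S \<in> bounded_ops (Cn n)"
    and x: "x \<in> hcarrier H" and c: "c \<in> hcarrier (Cn n)"
  shows "tensor_matrix n T S (tens_Cn x c) = tens_Cn (T x) (S c)"
proof
  fix i
  have "S c = S (\<Sum>j<n. c j *\<^sub>C unit_vec j)" by (rule arg_cong[OF Cn_expand[OF c]])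
  also have "\<dots> = (\<Sum>j<n. S (c j *\<^sub>C unit_vec j))"
    by (intro Cn.op_sum[OF S] Cn.scale_mem unit_vec_mem) simp
  also have "\<dots> = (\<Sum>j<n. c j *\<^sub>C S (unit_vec j))"
    by (intro sum.cong refl Cn.op_scale[OF S] unit_vec_mem) simp
  finally have "S c = (\<Sum>j<n. c j *\<^sub>C S (unit_vec j))" .
  then have Sc: "S c i = (\<Sum>j<n. c j * S (unit_vec j) i)"
    by (simp add: sum_fun_apply scaleC_complex_def)
  have "(\<Sum>j<n. S (unit_vec j) i *\<^sub>C T (tens_Cn x c j)) = (\<Sum>j<n. (c j * S (unit_vec j) i) *\<^sub>C T x)"
    using T x by (intro sum.cong) (simp_all add: tens_Cn_def op_scale scaleC_scaleC mult.commute)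
  also have "\<dots> = S c i *\<^sub>C T x" unfolding Sc complex_vector.scale_sum_left ..
  finally have "(\<Sum>j<n. S (unit_vec j) i *\<^sub>C T (tens_Cn x c j)) = S c i *\<^sub>C T x" .
  moreover have "S c i = 0" if "\<not> i < n" using Cn.op_mem[OF S, of c] that by (simp add: Cn_carrier)
  ultimately show "tensor_matrix n T S (tens_Cn x c) i = tens_Cn (T x) (S c) i"
    using tens_Cn_mem[OF x c] by (simp add: tensor_matrix_def tens_Cn_def)
qed

lemma tensor_op_Cn:
  assumes T: "T \<in> bounded_ops H" and S: "S \<in> bounded_ops (Cn n)"
  shows "tensor_op H (Cn n) (tensor_Cn H n) tens_Cn T S = tensor_matrix n T S"
  unfolding tensor_op_def
proof (rule the_equality)
  show "tensor_matrix n T S \<in> bounded_ops (tensor_Cn H n) \<and>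
      (\<forall>x\<in>hcarrier H. \<forall>c\<in>hcarrier (Cn n). tensor_matrix n T S (tens_Cn x c) = tens_Cn (T x) (S c))"
    using tensor_matrix_bounded[OF T] tensor_matrix_tens[OF T S] by blast
next
  fix R assume "R \<in> bounded_ops (tensor_Cn H n) \<and>
      (\<forall>x\<in>hcarrier H. \<forall>c\<in>hcarrier (Cn n). R (tens_Cn x c) = tens_Cn (T x) (S c))"
  then show "R = tensor_matrix n T S"
    using tensor_matrix_bounded[OF T] tensor_matrix_tens[OF T S] by (intro tens_Cn_ext) auto
qed

lemma tensor_matrix_add_left: "tensor_matrix n (T + T') S = tensor_matrix n T S + tensor_matrix n T' S"
  by (auto simp: fun_eq_iff tensor_matrix_def complex_vector.scale_right_distrib sum.distrib)

lemma tensor_matrix_add_right: "tensor_matrix n T (S + S') = tensor_matrix n T S + tensor_matrix n T S'"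
  by (auto simp: fun_eq_iff tensor_matrix_def scaleC_add_left sum.distrib)

lemma tensor_matrix_scale_left: "tensor_matrix n (c *\<^sub>C T) S = c *\<^sub>C tensor_matrix n T S"
  by (auto simp: fun_eq_iff tensor_matrix_def complex_vector.scale_sum_right scaleC_scaleC mult.commute)

lemma tensor_matrix_scale_right: "tensor_matrix n T (c *\<^sub>C S) = c *\<^sub>C tensor_matrix n T S"
  by (auto simp: fun_eq_iff tensor_matrix_def complex_vector.scale_sum_right scaleC_scaleC scaleC_complex_def)

lemma tensor_matrix_zero_left: "tensor_matrix n 0 S = 0"
  by (auto simp: fun_eq_iff tensor_matrix_def)

lemma tensor_matrix_zero_right: "tensor_matrix n T 0 = 0"
  by (auto simp: fun_eq_iff tensor_matrix_def)

text \<open>The tensor product of the square roots is self-adjoint and squares to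
  \<open>tensor_matrix n P Q\<close>.\<close>

lemma tensor_matrix_positive:
  assumes P: "positive_op H P" and Q: "positive_op (Cn n) Q"
  shows "positive_op (tensor_Cn H n) (tensor_matrix n P Q)"
proof -
  obtain R where R: "positive_op H R" and PR: "\<And>x. P x = R (R x)" by (rule positive_sqrt[OF P]) (rule that)
  obtain S where S: "positive_op (Cn n) S" and QS: "\<And>c. Q c = S (S c)" by (rule Cn.positive_sqrt[OF Q]) (rule that)
  have bd: "P \<in> bounded_ops H" "R \<in> bounded_ops H" "Q \<in> bounded_ops (Cn n)" "S \<in> bounded_ops (Cn n)"
    using P Q R S by auto
  let ?A = "tensor_matrix n R S"
  have A: "?A \<in> bounded_ops (tensor_Cn H n)" by (rule tensor_matrix_bounded[OF bd(2)])
  have AA: "?A \<circ> ?A = tensor_matrix n P Q"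
  proof (rule tens_Cn_ext)
    fix x c assume x: "x \<in> hcarrier H" and c: "c \<in> hcarrier (Cn n)"
    show "(?A \<circ> ?A) (tens_Cn x c) = tensor_matrix n P Q (tens_Cn x c)"
      unfolding comp_apply tensor_matrix_tens[OF bd(2,4) x c] tensor_matrix_tens[OF bd(1,3) x c]
        tensor_matrix_tens[OF bd(2,4) op_mem[OF bd(2)] Cn.op_mem[OF bd(4)]] PR[of x] QS[of c] ..
  qed (use A tensor_matrix_bounded[OF bd(1)] in simp_all)
  have Scnj: "S (unit_vec j) i = cnj (S (unit_vec i) j)" if "i < n" "j < n" for i j
    using Cn.positive_self_adjoint[OF S unit_vec_mem[OF that(1)] unit_vec_mem[OF that(2)]]
      Cn.inner_commute[OF Cn.op_mem[OF bd(4)] unit_vec_mem[OF that(2)], of "unit_vec i"]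
    by (simp add: Cn_inner_unit that)
  have sa: "hinner (tensor_Cn H n) (?A x) y = hinner (tensor_Cn H n) x (?A y)"
    if x: "x \<in> hcarrier (tensor_Cn H n)" and y: "y \<in> hcarrier (tensor_Cn H n)" for x y
  proof -
    have "hinner (tensor_Cn H n) (?A x) y = (\<Sum>i<n. \<Sum>j<n. cnj (S (unit_vec j) i) * \<langle>R (x j), y i\<rangle>)"
      using x y bd by (simp add: tensor_Cn_inner tensor_matrix_def inner_sum_left inner_scale_left)
    also have "\<dots> = (\<Sum>j<n. \<Sum>i<n. cnj (S (unit_vec j) i) * \<langle>R (x j), y i\<rangle>)" by (rule sum.swap)
    also have "\<dots> = (\<Sum>j<n. \<Sum>i<n. S (unit_vec i) j * \<langle>x j, R (y i)\<rangle>)"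
    proof (intro sum.cong refl)
      fix i j assume "j \<in> {..<n}" "i \<in> {..<n}"
      then have "S (unit_vec i) j = cnj (S (unit_vec j) i)" by (intro Scnj) auto
      then show "cnj (S (unit_vec j) i) * \<langle>R (x j), y i\<rangle> = S (unit_vec i) j * \<langle>x j, R (y i)\<rangle>"
        by (simp only: positive_self_adjoint[OF R tensor_Cn_mem[OF x] tensor_Cn_mem[OF y]])
    qed
    also have "\<dots> = hinner (tensor_Cn H n) x (?A y)"
      using x y bd by (simp add: tensor_Cn_inner tensor_matrix_def inner_sum_right inner_scale_right)
    finally show ?thesis .
  qed
  show ?thesis
  proof (rule Hn.positive_conj[OF A tensor_matrix_bounded[OF bd(1)]])
    fix x y assume x: "x \<in> hcarrier (tensor_Cn H n)" and y: "y \<in> hcarrier (tensor_Cn H n)"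
    show "hinner (tensor_Cn H n) x (tensor_matrix n P Q y) = hinner (tensor_Cn H n) (?A x) (?A y)"
      using sa[OF x Hn.op_mem[OF A, of y]] unfolding AA[symmetric] by simp
  qed
qed

lemma tensor_Cn_orthonormal_basis:
  assumes B: "orthonormal_basis H B"
  shows "orthonormal_basis (tensor_Cn H n) ((\<lambda>(e, i). tens_Cn e (unit_vec i)) ` (B \<times> {..<n}))"
    and "inj_on (\<lambda>(e, i). tens_Cn e (unit_vec i)) (B \<times> {..<n})"
proof -
  let ?f = "\<lambda>(e, i). tens_Cn e (unit_vec i)"
  have BH: "e \<in> hcarrier H" if "e \<in> B" for e using onb_mem[OF B that] .
  have inner: "hinner (tensor_Cn H n) (tens_Cn e (unit_vec i)) (tens_Cn f (unit_vec j)) = (if e = f \<and> i = j then 1 else 0)"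
    if "e \<in> B" "f \<in> B" "i < n" "j < n" for e f i j
  proof -
    have "hinner (tensor_Cn H n) (tens_Cn e (unit_vec i)) (tens_Cn f (unit_vec j)) =
        \<langle>e, f\<rangle> * hinner (Cn n) (unit_vec i) (unit_vec j)"
      using BH that by (intro tens_Cn_inner unit_vec_mem) auto
    then show ?thesis using B that by (auto simp: Cn_inner_unit orthonormal_basis_def)
  qed
  show inj: "inj_on ?f (B \<times> {..<n})"
  proof (rule inj_onI, clarify)
    fix e i f j assume *: "e \<in> B" "f \<in> B" "i < n" "j < n" "tens_Cn e (unit_vec i) = tens_Cn f (unit_vec j)"
    then show "e = f \<and> i = j" using inner[of e e i i] inner[of e f i j] by (auto split: if_splits)
  qed
  show "orthonormal_basis (tensor_Cn H n) (?f ` (B \<times> {..<n}))"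
    unfolding orthonormal_basis_def
  proof (intro conjI ballI)
    show sub: "?f ` (B \<times> {..<n}) \<subseteq> hcarrier (tensor_Cn H n)" using BH by auto
    fix u v assume "u \<in> ?f ` (B \<times> {..<n})" "v \<in> ?f ` (B \<times> {..<n})"
    then obtain e i f j where uv: "e \<in> B" "f \<in> B" "i < n" "j < n" "u = ?f (e, i)" "v = ?f (f, j)" by auto
    then have "u = v \<longleftrightarrow> e = f \<and> i = j" using inj by (auto simp: inj_on_def)
    then show "hinner (tensor_Cn H n) u v = (if u = v then 1 else 0)" using inner[OF uv(1-4)] uv(5,6) by simp
  next
    have sub: "?f ` (B \<times> {..<n}) \<subseteq> hcarrier (tensor_Cn H n)" using BH by auto
    let ?W = "complex_vector.span (?f ` (B \<times> {..<n}))"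
    show "dense_in (tensor_Cn H n) ?W"
      unfolding dense_in_def
    proof (intro conjI ballI allI impI)
      show W: "?W \<subseteq> hcarrier (tensor_Cn H n)" by (rule complex_vector.span_minimal[OF sub Hn.subspace])
      fix z and \<epsilon> :: real assume z: "z \<in> hcarrier (tensor_Cn H n)" and \<epsilon>: "\<epsilon> > 0"
      \<comment> \<open>Approximating each of the \<open>n\<close> components within
        \<open>\<delta>\<close> costs less than \<open>\<epsilon>\<close> in total.\<close>
      define \<delta> where "\<delta> = \<epsilon> / (real n + 1)"
      have \<delta>: "\<delta> > 0" using \<epsilon> by (simp add: \<delta>_def)
      have "\<exists>w\<in>complex_vector.span B. \<parallel>z i - w\<parallel> < \<delta>" for i
        using B z \<delta> unfolding orthonormal_basis_def dense_in_def by simp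
      then obtain w where w: "\<And>i. w i \<in> complex_vector.span B" "\<And>i. \<parallel>z i - w i\<parallel> < \<delta>" by metis
      define y where "y = (\<Sum>i<n. tens_Cn (w i) (unit_vec i))"
      have "tens_Cn (w i) (unit_vec i) \<in> ?W" if i: "i < n" for i
      proof -
        obtain F r where F: "finite F" "F \<subseteq> B" "w i = (\<Sum>a\<in>F. r a *\<^sub>C a)"
          using w(1)[of i] unfolding complex_vector.span_explicit by blast
        have "tens_Cn (w i) (unit_vec i) = (\<Sum>a\<in>F. r a *\<^sub>C tens_Cn a (unit_vec i))"
          unfolding F(3) by (auto simp: fun_eq_iff sum_fun_apply tens_Cn_def scaleC_one)
        also have "\<dots> \<in> ?W"
          using F(2) i by (intro complex_vector.span_sum complex_vector.span_scale complex_vector.span_base) force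
        finally show ?thesis .
      qed
      then have yW: "y \<in> ?W" unfolding y_def by (intro complex_vector.span_sum) auto
      have yi: "y i = w i" if "i < n" for i
      proof -
        have "y i = (\<Sum>j<n. if j = i then w i else 0)"
          unfolding y_def sum_fun_apply by (intro sum.cong) (auto simp: tens_Cn_def scaleC_one)
        then show ?thesis using that by simp
      qed
      have "hnorm (tensor_Cn H n) (z - y) \<le> (\<Sum>i<n. \<parallel>(z - y) i\<parallel>)"
        using z yW W by (intro tensor_Cn_norm_le Hn.diff_mem) auto
      also have "\<dots> \<le> (\<Sum>i<n. \<delta>)" using w(2) yi by (intro sum_mono) (simp add: less_imp_le)
      also have "\<dots> < \<epsilon>" using \<epsilon> by (simp add: \<delta>_def field_simps)
      finally show "\<exists>y\<in>?W. hnorm (tensor_Cn H n) (z - y) < \<epsilon>" using yW by blast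
    qed
  qed
qed

text \<open>On the product basis the diagonal entries are products of diagonal entries of
  \<open>P\<close> and \<open>Q\<close>, and the nonnegative double sum factors.\<close>

lemma tensor_matrix_trace:
  assumes P: "positive_trace H P s" and Q: "positive_trace (Cn n) Q t"
  shows "positive_trace (tensor_Cn H n) (tensor_matrix n P Q) (s * t)"
proof -
  obtain B where B: "orthonormal_basis H B" using orthonormal_basis_exists by blast
  have BH: "e \<in> hcarrier H" if "e \<in> B" for e using onb_mem[OF B that] .
  let ?f = "\<lambda>(e, i). tens_Cn e (unit_vec i)"
  have bd: "P \<in> bounded_ops H" "Q \<in> bounded_ops (Cn n)"
    using P Q positive_trace_bounded Cn.positive_trace_bounded by blast+
  have q: "Q (unit_vec i) i = of_real (Re (Q (unit_vec i) i))" "0 \<le> Re (Q (unit_vec i) i)" if "i < n" for i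
    using Cn.positive_inner[OF Cn.positive_trace_positive[OF Q] unit_vec_mem[OF that]]
      Cn.positive_Re[OF Cn.positive_trace_positive[OF Q] unit_vec_mem[OF that]] by (simp_all add: Cn_inner_unit that)
  have "inj_on unit_vec {..<n}" by (rule inj_onI) (metis zero_neq_one)
  then have "((\<lambda>i. Re (hinner (Cn n) (unit_vec i) (Q (unit_vec i)))) has_sum t) {..<n}"
    using Cn.positive_trace_sum[OF Q Cn_orthonormal_basis] by (simp add: has_sum_reindex o_def)
  then have t: "((\<lambda>i. Re (Q (unit_vec i) i)) has_sum t) {..<n}"
    by (rule iffD1[OF has_sum_cong, rotated]) (simp add: Cn_inner_unit)
  define g where "g = (\<lambda>(e, i). Re \<langle>e, P e\<rangle> * Re (Q (unit_vec i) i))"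
  have g: "Re (hinner (tensor_Cn H n) (?f p) (tensor_matrix n P Q (?f p))) = g p" if pB: "p \<in> B \<times> {..<n}" for p
  proof -
    obtain e i where p: "p = (e, i)" "e \<in> B" "i < n" using pB by auto
    have "hinner (tensor_Cn H n) (tens_Cn e (unit_vec i)) (tens_Cn (P e) (Q (unit_vec i))) =
        \<langle>e, P e\<rangle> * hinner (Cn n) (unit_vec i) (Q (unit_vec i))"
      by (intro tens_Cn_inner BH unit_vec_mem op_mem[OF bd(1)] Cn.op_mem[OF bd(2)] p)
    also have "\<dots> = of_real (Re \<langle>e, P e\<rangle>) * of_real (Re (Q (unit_vec i) i))"
      using positive_inner[OF positive_trace_positive[OF P] BH[OF p(2)]] q(1)[OF p(3)] by (simp add: Cn_inner_unit p(3))
    finally show ?thesis using p BH bd by (simp add: tensor_matrix_tens g_def)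
  qed
  have inner_sum: "((\<lambda>i. g (e, i)) has_sum (Re \<langle>e, P e\<rangle> * t)) {..<n}" for e
    unfolding g_def using t by (simp add: has_sum_cmult_right)
  have outer: "((\<lambda>e. Re \<langle>e, P e\<rangle> * t) has_sum (s * t)) B"
    by (intro has_sum_cmult_left positive_trace_sum[OF P B])
  have "g summable_on B \<times> {..<n}"
    using inner_sum outer positive_Re[OF positive_trace_positive[OF P] BH] q(2)
    by (intro summable_on_SigmaI[where g = "\<lambda>e. Re \<langle>e, P e\<rangle> * t"]) (auto simp: summable_on_def g_def)
  then have "(g has_sum (s * t)) (B \<times> {..<n})"
    using inner_sum outer by (intro has_sum_SigmaI[where g = "\<lambda>e. Re \<langle>e, P e\<rangle> * t"])
  moreover have "((\<lambda>p. Re (hinner (tensor_Cn H n) (?f p) (tensor_matrix n P Q (?f p)))) has_sum (s * t)) (B \<times> {..<n})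
      \<longleftrightarrow> (g has_sum (s * t)) (B \<times> {..<n})"
    by (rule has_sum_cong) (rule g)
  ultimately have "((\<lambda>u. Re (hinner (tensor_Cn H n) u (tensor_matrix n P Q u))) has_sum (s * t)) (?f ` (B \<times> {..<n}))"
    unfolding has_sum_reindex[OF tensor_Cn_orthonormal_basis(2)[OF B]] o_def by blast
  then show ?thesis
    using positive_trace_positive[OF P] Cn.positive_trace_positive[OF Q]
    by (intro Hn.positive_traceI[OF tensor_matrix_positive tensor_Cn_orthonormal_basis(1)[OF B]])
qed

lemma tensor_matrix_density:
  "\<rho> \<in> density_ops H \<Longrightarrow> \<sigma> \<in> density_ops (Cn n) \<Longrightarrow> tensor_matrix n \<rho> \<sigma> \<in> density_ops (tensor_Cn H n)"
  using tensor_matrix_trace[of \<rho> 1 n \<sigma> 1] by (simp add: density_iff Cn.density_iff Hn.density_iff)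

end

section \<open>Operational distributions\<close>

context measurement_theory
begin

sublocale hilbert: separable_hilbert_space "hilb M S" for S
  by (rule hilb)

text \<open>The unnormalized output, meaningful for every outcome set: an arbitrary output state of
  probability zero is multiplied by 0.\<close>

definition raw_output :: "'a \<Rightarrow> real set \<Rightarrow> ('v \<Rightarrow> 'v) \<Rightarrow> 'v \<Rightarrow> 'v" where
  "raw_output a \<Delta> \<rho> = complex_of_real (out_prob M a \<rho> \<Delta>) *\<^sub>C out_state M a \<rho> \<Delta>"

lemma out_prob_nonneg: "0 \<le> out_prob M a \<rho> \<Delta>"
  by (simp add: out_prob_def)

lemma out_prob_le_1: "\<rho> \<in> density_ops (space_of M a) \<Longrightarrow> out_prob M a \<rho> \<Delta> \<le> 1"
  using out_distr[of \<rho> a] by (simp add: out_prob_def prob_space.prob_le_1)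

lemma out_prob_UNIV: "\<rho> \<in> density_ops (space_of M a) \<Longrightarrow> out_prob M a \<rho> UNIV = 1"
  using out_distr[of \<rho> a] prob_space.prob_space[of "out_distr M a \<rho>"]
    sets_eq_imp_space_eq[of "out_distr M a \<rho>" borel] by (simp add: out_prob_def)

lemma output_trace:
  assumes \<rho>: "\<rho> \<in> density_ops (space_of M a)" and \<Delta>: "\<Delta> \<in> sets borel"
  shows "positive_trace (space_of M a) (raw_output a \<Delta> \<rho>) (out_prob M a \<rho> \<Delta>)"
proof (cases "out_prob M a \<rho> \<Delta> = 0")
  case True
  then show ?thesis using hilbert.positive_trace_zero by (simp add: raw_output_def)
next
  case False
  then have "out_prob M a \<rho> \<Delta> > 0" using out_prob_nonneg[of a \<rho> \<Delta>] by simp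
  then have "positive_trace (space_of M a) (out_state M a \<rho> \<Delta>) 1"
    using out_state[OF \<rho> \<Delta>] by (simp add: hilbert.density_iff)
  from hilbert.positive_trace_scale[OF this out_prob_nonneg[of a \<rho> \<Delta>]]
  show ?thesis by (simp add: raw_output_def)
qed

lemma output_bounded: "\<rho> \<in> density_ops (space_of M a) \<Longrightarrow> \<Delta> \<in> sets borel \<Longrightarrow>
    raw_output a \<Delta> \<rho> \<in> bounded_ops (space_of M a)"
  using output_trace hilbert.positive_trace_bounded by blast

lemma density_convex:
  assumes "\<rho> \<in> density_ops (hilb M S)" "\<sigma> \<in> density_ops (hilb M S)" "p \<in> {0..1}"
  shows "complex_of_real p *\<^sub>C \<rho> + complex_of_real (1 - p) *\<^sub>C \<sigma> \<in> density_ops (hilb M S)"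
  using assms hilbert.positive_trace_add[OF hilbert.positive_trace_scale hilbert.positive_trace_scale, of S \<rho> 1 p \<sigma> 1 "1 - p"]
  by (simp add: hilbert.density_iff)

text \<open>Let a precise measurement of the observable \<open>proj v\<close> follow. Its outcome 1
  has probability \<open>\<langle>v, \<sigma> v\<rangle>\<close> in the state
  \<open>\<sigma>\<close>, so weighting by the first outcome turns the matrix element into a joint
  probability, the quantity about which the mixing law speaks.\<close>

lemma output_expectation:
  assumes obs: "observables_measurable M" and v: "v \<in> hcarrier (space_of M a)" "hnorm (space_of M a) v = 1"
  obtains b where "system_of M b = system_of M a"
    "\<And>\<rho> \<Delta>. \<rho> \<in> density_ops (space_of M a) \<Longrightarrow> \<Delta> \<in> sets borel \<Longrightarrow>
      hinner (space_of M a) v (raw_output a \<Delta> \<rho> v) = complex_of_real (joint_prob M a b \<rho> \<Delta> {1})"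
proof -
  let ?H = "space_of M a"
  obtain b where b: "system_of M b = system_of M a"
    and pm: "precisely_measures M b (hcarrier ?H) (inner_product_space.proj ?H v)"
    using obs hilbert.self_adjoint_proj[OF v] unfolding observables_measurable_def by blast
  \<comment> \<open>The spectral projection of \<open>proj v\<close> for the outcome 1 is
    \<open>proj v\<close> again.\<close>
  have eq: "inner_product_space.proj_measure ?H v {1} = inner_product_space.proj ?H v"
    by (simp add: hilbert.proj_measure_def scaleC_one)
  have prob: "complex_of_real (out_prob M b \<sigma> {1}) = hinner ?H v (\<sigma> v)" if \<sigma>: "\<sigma> \<in> density_ops ?H" for \<sigma>
  proof -
    have "complex_of_real (out_prob M b \<sigma> {1}) = op_trace ?H (inner_product_space.proj ?H v \<circ> \<sigma>)"
      using pm hilbert.spectral_measure_proj[OF v] \<sigma> unfolding precisely_measures_def b eq[symmetric]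
      by (simp add: eq)
    also have "\<dots> = hinner ?H v (\<sigma> v)"
      using \<sigma> hilbert.op_trace_proj[OF v(1)] by (simp add: density_ops_def)
    finally show ?thesis .
  qed
  have "hinner ?H v (raw_output a \<Delta> \<rho> v) = complex_of_real (joint_prob M a b \<rho> \<Delta> {1})"
    if \<rho>: "\<rho> \<in> density_ops ?H" and \<Delta>: "\<Delta> \<in> sets borel" for \<rho> \<Delta>
  proof (cases "out_prob M a \<rho> \<Delta> = 0")
    case True
    then show ?thesis using v by (simp add: joint_prob_def raw_output_def)
  next
    case False
    then have "out_state M a \<rho> \<Delta> \<in> density_ops ?H"
      using out_state[OF \<rho> \<Delta>] out_prob_nonneg[of a \<rho> \<Delta>] by simp
    then show ?thesis
      using prob[of "out_state M a \<rho> \<Delta>"] v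
      by (simp add: joint_prob_def raw_output_def hilbert.inner_scale_right hilbert.density_iff hilbert.positive_trace_bounded)
  qed
  then show thesis using b that by blast
qed

text \<open>The mixing law is stated for numbers; it is lifted to operators by testing on unit
  vectors with \<open>output_expectation\<close>.\<close>

lemma output_affine:
  assumes obs: "observables_measurable M" and mix: "mixing_law M" and \<Delta>: "\<Delta> \<in> sets borel"
    and \<rho>: "\<rho> \<in> density_ops (space_of M a)" and \<sigma>: "\<sigma> \<in> density_ops (space_of M a)" and p: "p \<in> {0..1}"
  shows "raw_output a \<Delta> (complex_of_real p *\<^sub>C \<rho> + complex_of_real (1 - p) *\<^sub>C \<sigma>) =
    complex_of_real p *\<^sub>C raw_output a \<Delta> \<rho> + complex_of_real (1 - p) *\<^sub>C raw_output a \<Delta> \<sigma>"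
proof (rule hilbert.op_ext_unit)
  let ?\<tau> = "complex_of_real p *\<^sub>C \<rho> + complex_of_real (1 - p) *\<^sub>C \<sigma>"
  have \<tau>: "?\<tau> \<in> density_ops (space_of M a)" using density_convex[OF \<rho> \<sigma> p] .
  show "raw_output a \<Delta> ?\<tau> \<in> bounded_ops (space_of M a)" using output_bounded[OF \<tau> \<Delta>] .
  note b\<rho> = output_bounded[OF \<rho> \<Delta>] and b\<sigma> = output_bounded[OF \<sigma> \<Delta>]
  show "complex_of_real p *\<^sub>C raw_output a \<Delta> \<rho> + complex_of_real (1 - p) *\<^sub>C raw_output a \<Delta> \<sigma> \<in> bounded_ops (space_of M a)"
    using b\<rho> b\<sigma> by (intro hilbert.add_bounded hilbert.scale_bounded)
  fix v assume v: "v \<in> hcarrier (space_of M a)" "hnorm (space_of M a) v = 1"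
  obtain b where b: "system_of M b = system_of M a"
    and ex: "\<And>\<rho> \<Delta>. \<rho> \<in> density_ops (space_of M a) \<Longrightarrow> \<Delta> \<in> sets borel \<Longrightarrow>
      hinner (space_of M a) v (raw_output a \<Delta> \<rho> v) = complex_of_real (joint_prob M a b \<rho> \<Delta> {1})"
    by (rule output_expectation[OF obs v]) (rule that)
  have "joint_prob M a b ?\<tau> \<Delta> {1} = p * joint_prob M a b \<rho> \<Delta> {1} + (1 - p) * joint_prob M a b \<sigma> \<Delta> {1}"
    using mix b \<rho> \<sigma> p \<Delta> unfolding mixing_law_def by (metis borel_closed closed_singleton)
  then show "hinner (space_of M a) v (raw_output a \<Delta> ?\<tau> v) =
      hinner (space_of M a) v ((complex_of_real p *\<^sub>C raw_output a \<Delta> \<rho> + complex_of_real (1 - p) *\<^sub>C raw_output a \<Delta> \<sigma>) v)"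
    using ex[OF \<tau> \<Delta>] ex[OF \<rho> \<Delta>] ex[OF \<sigma> \<Delta>] v b\<rho> b\<sigma>
    by (simp add: hilbert.inner_add_right hilbert.inner_scale_right)
qed

text \<open>The output states for \<open>A\<close>, \<open>B\<close> and \<open>A \<union> B\<close>
  are unrelated a priori. They are linked by the joint distribution with a later measurement, which
  is additive in its first argument.\<close>

lemma output_Un:
  assumes obs: "observables_measurable M" and \<rho>: "\<rho> \<in> density_ops (space_of M a)"
    and A: "A \<in> sets borel" and B: "B \<in> sets borel" and disj: "A \<inter> B = {}"
  shows "raw_output a (A \<union> B) \<rho> = raw_output a A \<rho> + raw_output a B \<rho>"
proof (rule hilbert.op_ext_unit)
  have AB: "A \<union> B \<in> sets borel" using A B by simp
  note bd = output_bounded[OF \<rho> A] output_bounded[OF \<rho> B]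
  show "raw_output a (A \<union> B) \<rho> \<in> bounded_ops (space_of M a)" using output_bounded[OF \<rho> AB] .
  show "raw_output a A \<rho> + raw_output a B \<rho> \<in> bounded_ops (space_of M a)" using bd by (rule hilbert.add_bounded)
  fix v assume v: "v \<in> hcarrier (space_of M a)" "hnorm (space_of M a) v = 1"
  obtain b where b: "system_of M b = system_of M a"
    and ex: "\<And>\<rho> \<Delta>. \<rho> \<in> density_ops (space_of M a) \<Longrightarrow> \<Delta> \<in> sets borel \<Longrightarrow>
      hinner (space_of M a) v (raw_output a \<Delta> \<rho> v) = complex_of_real (joint_prob M a b \<rho> \<Delta> {1})"
    by (rule output_expectation[OF obs v]) (rule that)
  obtain J :: "(real \<times> real) measure" where J: "prob_space J" "sets J = sets borel"
    and Jp: "\<And>\<Delta> \<Delta>'. \<Delta> \<in> sets borel \<Longrightarrow> \<Delta>' \<in> sets borel \<Longrightarrow> measure J (\<Delta> \<times> \<Delta>') = joint_prob M a b \<rho> \<Delta> \<Delta>'"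
    using joint_distr[OF b[symmetric] \<rho>] by blast
  interpret J: prob_space J by (rule J)
  have "A \<times> {1} \<in> sets J" "B \<times> {1} \<in> sets J" using A B J(2) by (auto simp: borel_prod[symmetric])
  moreover have "(A \<times> {1::real}) \<inter> (B \<times> {1}) = {}" using disj by auto
  ultimately have "measure J ((A \<union> B) \<times> {1}) = measure J (A \<times> {1}) + measure J (B \<times> {1})"
    unfolding Sigma_Un_distrib1 by (rule J.finite_measure_Union)
  then have "joint_prob M a b \<rho> (A \<union> B) {1} = joint_prob M a b \<rho> A {1} + joint_prob M a b \<rho> B {1}"
    using A B AB by (simp add: Jp)
  then show "hinner (space_of M a) v (raw_output a (A \<union> B) \<rho> v) = hinner (space_of M a) v ((raw_output a A \<rho> + raw_output a B \<rho>) v)"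
    using ex[OF \<rho> A] ex[OF \<rho> B] ex[OF \<rho> AB] v bd by (simp add: hilbert.inner_add_right)
qed

section \<open>Construction and uniqueness of the operational distribution\<close>

abbreviation cone_output :: "'a \<Rightarrow> real set \<Rightarrow> ('v \<Rightarrow> 'v) \<Rightarrow> 'v \<Rightarrow> 'v" where
  "cone_output a \<Delta> \<equiv> hilbert_space.cone_extension (space_of M a) (raw_output a \<Delta>)"

lemma cone_output_trace:
  assumes P: "positive_trace (space_of M a) P s" and \<Delta>: "\<Delta> \<in> sets borel"
  shows "positive_trace (space_of M a) (cone_output a \<Delta> P) (s * out_prob M a (complex_of_real (1 / s) *\<^sub>C P) \<Delta>)"
proof (cases "s = 0")
  case True
  then show ?thesis using hilbert.positive_trace_zero by (simp add: hilbert.cone_extension_eq[OF P])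
next
  case False
  note n = hilbert.positive_trace_normalize[OF P False]
  show ?thesis
    unfolding hilbert.cone_extension_eq[OF P]
    using n by (intro hilbert.positive_trace_scale output_trace \<Delta>) auto
qed

lemma cone_output_Un:
  assumes obs: "observables_measurable M" and P: "positive_trace (space_of M a) P s"
    and A: "A \<in> sets borel" and B: "B \<in> sets borel" and disj: "A \<inter> B = {}"
  shows "cone_output a (A \<union> B) P = cone_output a A P + cone_output a B P"
proof (cases "s = 0")
  case True
  then show ?thesis by (simp add: hilbert.cone_extension_eq[OF P])
next
  case False
  show ?thesis
    unfolding hilbert.cone_extension_eq[OF P]
      output_Un[OF obs hilbert.positive_trace_normalize(1)[OF P False] A B disj]
    by (rule complex_vector.scale_right_distrib)
qed

text \<open>\<open>cone_output\<close> is additive and homogeneous on positive operators, so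
  \<open>positive_map_extension\<close> applies for each outcome set. Every estimate then goes
  through the four positive parts of the argument, on which traces of outputs are
  probabilities.\<close>

theorem operational_distribution_exists:
  assumes obs: "observables_measurable M" and mix: "mixing_law M"
  shows "\<exists>\<I>. operational_distribution M a \<I>"
proof -
  let ?H = "space_of M a" and ?F = "cone_output a"
  have "\<exists>\<Phi>. linear_on_trace_class ?H \<Phi> \<and> (\<forall>P s. positive_trace ?H P s \<longrightarrow> \<Phi> P = ?F \<Delta> P) \<and>
      (\<forall>T. T \<notin> trace_class ?H \<longrightarrow> \<Phi> T = 0)" if \<Delta>: "\<Delta> \<in> sets borel" for \<Delta>
  proof (rule hilbert.positive_map_extension[where F = "?F \<Delta>"])
    show "\<exists>t. positive_trace ?H (?F \<Delta> P) t" if "positive_trace ?H P s" for P s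
      using cone_output_trace[OF that \<Delta>] by blast
    show "?F \<Delta> (P + Q) = ?F \<Delta> P + ?F \<Delta> Q" if "positive_trace ?H P s" "positive_trace ?H Q t" for P Q s t
      using output_affine[OF obs mix \<Delta>] that by (rule hilbert.cone_extension_add)
    show "?F \<Delta> (complex_of_real r *\<^sub>C P) = complex_of_real r *\<^sub>C ?F \<Delta> P" if "positive_trace ?H P s" "0 \<le> r" for P s r
      using that by (rule hilbert.cone_extension_scale)
  qed blast
  then obtain \<Phi> where lin: "\<And>\<Delta>. \<Delta> \<in> sets borel \<Longrightarrow> linear_on_trace_class ?H (\<Phi> \<Delta>)"
    and \<Phi>P: "\<And>\<Delta> P s. \<Delta> \<in> sets borel \<Longrightarrow> positive_trace ?H P s \<Longrightarrow> \<Phi> \<Delta> P = ?F \<Delta> P"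
    and out: "\<And>\<Delta> T. \<Delta> \<in> sets borel \<Longrightarrow> T \<notin> trace_class ?H \<Longrightarrow> \<Phi> \<Delta> T = 0" by metis
  \<comment> \<open>Zero on sets that are not Borel, as the first clause of
    \<open>DL_instrument\<close> prescribes.\<close>
  define \<I> where "\<I> \<Delta> = (if \<Delta> \<in> sets borel then \<Phi> \<Delta> else 0)" for \<Delta>
  have \<I>: "\<I> \<Delta> = \<Phi> \<Delta>" if "\<Delta> \<in> sets borel" for \<Delta> using that by (simp add: \<I>_def)
  have trace: "positive_trace ?H (\<I> \<Delta> P) (s * out_prob M a (complex_of_real (1 / s) *\<^sub>C P) \<Delta>)"
    if "\<Delta> \<in> sets borel" "positive_trace ?H P s" for \<Delta> P s
    using cone_output_trace[OF that(2,1)] \<Phi>P[OF that] \<I>[OF that(1)] by simp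
  have comb: "\<I> \<Delta> (\<Sum>k<4. \<i> ^ k *\<^sub>C P k) = (\<Sum>k<4. \<i> ^ k *\<^sub>C \<I> \<Delta> (P k))"
    if "\<Delta> \<in> sets borel" "\<And>k. positive_trace ?H (P k) (s k)" for \<Delta> P s
    using lin[OF that(1)] hilbert.positive_trace_trace_class[OF that(2)] unfolding \<I>[OF that(1)]
    by (rule hilbert.linear_on_trace_class_sum)
  have norm: "trace_norm ?H (\<I> \<Delta> (\<Sum>k<4. \<i> ^ k *\<^sub>C P k)) \<le> (\<Sum>k<4. s k * out_prob M a (complex_of_real (1 / s k) *\<^sub>C P k) \<Delta>)"
    if \<Delta>: "\<Delta> \<in> sets borel" and P: "\<And>k. positive_trace ?H (P k) (s k)" for \<Delta> P s
    unfolding comb[OF \<Delta> P]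
    using hilbert.trace_class_combination(2)[where I = "{..<4}" and c = "\<lambda>k. \<i> ^ k", OF finite_lessThan trace[OF \<Delta> P]]
    by (simp add: norm_power)
  have prob_le: "s * out_prob M a (complex_of_real (1 / s) *\<^sub>C P) \<Delta> \<le> s" if P: "positive_trace ?H P s" for P s \<Delta>
  proof (cases "s = 0")
    case False
    from hilbert.positive_trace_normalize[OF P this] show ?thesis
      using out_prob_le_1[of "complex_of_real (1 / s) *\<^sub>C P" a \<Delta>] by (simp add: mult_left_le)
  qed simp
  \<comment> \<open>The constant counts the positive parts: each has trace at most the trace norm of
    \<open>T\<close>, and probabilities are at most 1.\<close>
  have bound: "trace_norm ?H (\<I> \<Delta> T) \<le> 4 * trace_norm ?H T" if \<Delta>: "\<Delta> \<in> sets borel" and T: "T \<in> trace_class ?H" for \<Delta> T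
  proof -
    obtain P s where P: "\<And>k. positive_trace ?H (P k) (s k)" and le: "\<And>k. s k \<le> trace_norm ?H T"
      and TP: "T = (\<Sum>k<4. \<i> ^ k *\<^sub>C P k)"
      by (rule hilbert.trace_class_decomposition[OF T]) (rule that)
    have "trace_norm ?H (\<I> \<Delta> T) \<le> (\<Sum>k<4. s k * out_prob M a (complex_of_real (1 / s k) *\<^sub>C P k) \<Delta>)"
      unfolding TP by (rule norm[OF \<Delta> P])
    also have "\<dots> \<le> (\<Sum>k<4::nat. trace_norm ?H T)"
      by (intro sum_mono) (rule order_trans[OF prob_le[OF P] le])
    finally show ?thesis by simp
  qed
  have Un: "\<I> (A \<union> B) T = \<I> A T + \<I> B T"
    if A: "A \<in> sets borel" and B: "B \<in> sets borel" and disj: "A \<inter> B = {}" and T: "T \<in> trace_class ?H" for A B T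
  proof -
    obtain P s where P: "\<And>k. positive_trace ?H (P k) (s k)" and TP: "T = (\<Sum>k<4. \<i> ^ k *\<^sub>C P k)"
      by (rule hilbert.trace_class_cases[OF T]) (rule that)
    have AB: "A \<union> B \<in> sets borel" using A B by simp
    have "\<I> (A \<union> B) (P k) = \<I> A (P k) + \<I> B (P k)" for k
      using cone_output_Un[OF obs P A B disj, of k] by (simp add: \<I> \<Phi>P[OF _ P] A B AB)
    then show ?thesis
      unfolding TP comb[OF A P] comb[OF B P] comb[OF AB P]
      by (simp add: complex_vector.scale_right_distrib sum.distrib)
  qed
  have additive: "(\<lambda>n. trace_norm ?H (\<I> (\<Union>j. \<Delta> j) T - (\<Sum>j<n. \<I> (\<Delta> j) T))) \<longlonglongrightarrow> 0"
    if \<Delta>: "range \<Delta> \<subseteq> sets borel" and disj: "disjoint_family \<Delta>" and T: "T \<in> trace_class ?H"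
    for \<Delta> :: "nat \<Rightarrow> real set" and T
  proof -
    \<comment> \<open>The tails of the union. By finite additivity the remainder of the series is
      the instrument at \<open>R n\<close>, so countable additivity becomes convergence to 0 along a
      decreasing sequence with empty intersection.\<close>
    define R where "R n = (\<Union>j\<in>{n..}. \<Delta> j)" for n
    have \<Delta>b: "\<Delta> j \<in> sets borel" for j using \<Delta> by auto
    have Rb: "R n \<in> sets borel" for n using \<Delta>b unfolding R_def by (intro sets.countable_UN'') auto
    have R_Suc: "R n = \<Delta> n \<union> R (Suc n)" for n
    proof -
      have "{n..} = insert n {Suc n..}" by auto
      then show ?thesis unfolding R_def by (simp only: UN_insert)
    qed
    have R_disj: "\<Delta> n \<inter> R (Suc n) = {}" for n
    proof -
      have "\<Delta> n \<inter> \<Delta> j = {}" if "j \<in> {Suc n..}" for j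
        using disj that unfolding disjoint_family_on_def by auto
      then show ?thesis unfolding R_def by blast
    qed
    have "\<I> (\<Union>j. \<Delta> j) T - (\<Sum>j<n. \<I> (\<Delta> j) T) = \<I> (R n) T" for n
    proof (induction n)
      case 0
      then show ?case by (simp add: R_def atLeast_0)
    next
      case (Suc n)
      have "\<I> (\<Union>j. \<Delta> j) T - (\<Sum>j<Suc n. \<I> (\<Delta> j) T) = \<I> (R n) T - \<I> (\<Delta> n) T"
        unfolding Suc.IH[symmetric] by (simp only: sum.lessThan_Suc diff_diff_eq)
      also have "\<dots> = \<I> (R (Suc n)) T"
        unfolding R_Suc[of n] Un[OF \<Delta>b Rb R_disj T] by (simp only: add_diff_cancel_left')
      finally show ?case .
    qed
    moreover obtain P s where P: "\<And>k. positive_trace ?H (P k) (s k)" and TP: "T = (\<Sum>k<4. \<i> ^ k *\<^sub>C P k)"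
      by (rule hilbert.trace_class_cases[OF T]) (rule that)
    \<comment> \<open>Continuity from above of the output distribution in each normalized part. A
      part of trace 0 has no normalization but contributes 0.\<close>
    have lim: "(\<lambda>n. s k * out_prob M a (complex_of_real (1 / s k) *\<^sub>C P k) (R n)) \<longlonglongrightarrow> 0" for k
    proof (cases "s k = 0")
      case False
      let ?\<rho> = "complex_of_real (1 / s k) *\<^sub>C P k"
      have \<rho>: "?\<rho> \<in> density_ops ?H" by (rule hilbert.positive_trace_normalize[OF P False])
      interpret D: prob_space "out_distr M a ?\<rho>" using out_distr[OF \<rho>] by simp
      have "range R \<subseteq> sets (out_distr M a ?\<rho>)" using Rb out_distr[OF \<rho>] by auto
      moreover have "decseq R" using R_Suc by (intro decseq_SucI) blast
      ultimately have "(\<lambda>n. out_prob M a ?\<rho> (R n)) \<longlonglongrightarrow> out_prob M a ?\<rho> (\<Inter>n. R n)"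
        unfolding out_prob_def by (rule D.finite_Lim_measure_decseq)
      moreover have "(\<Inter>n. R n) = {}"
      proof -
        have "\<exists>n. t \<notin> R n" for t
        proof (cases "\<exists>j. t \<in> \<Delta> j")
          case True
          then obtain j where j: "t \<in> \<Delta> j" ..
          have "t \<notin> \<Delta> i" if "i \<noteq> j" for i using disj j that unfolding disjoint_family_on_def by blast
          then have "t \<notin> R (Suc j)" unfolding R_def by fastforce
          then show ?thesis ..
        next
          case False
          then have "t \<notin> R 0" by (simp add: R_def)
          then show ?thesis ..
        qed
        then show ?thesis by blast
      qed
      ultimately have "(\<lambda>n. out_prob M a ?\<rho> (R n)) \<longlonglongrightarrow> 0" by (simp add: out_prob_def)
      then show ?thesis by (rule tendsto_mult_right_zero)
    qed simp
    have "(\<lambda>n. \<Sum>k<4. s k * out_prob M a (complex_of_real (1 / s k) *\<^sub>C P k) (R n)) \<longlonglongrightarrow> (\<Sum>k<4::nat. 0)"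
      by (intro tendsto_sum lim)
    then have lim4: "(\<lambda>n. \<Sum>k<4. s k * out_prob M a (complex_of_real (1 / s k) *\<^sub>C P k) (R n)) \<longlonglongrightarrow> 0" by simp
    have "0 \<le> trace_norm ?H (\<I> (R n) T)" for n
    proof -
      have "\<I> (R n) T \<in> trace_class ?H"
        using lin[OF Rb] T \<I>[OF Rb] unfolding linear_on_trace_class_def by simp
      then obtain t where t: "positive_trace ?H (abs_op ?H (\<I> (R n) T)) t" by (auto simp: hilbert.trace_class_iff)
      show ?thesis using hilbert.positive_trace_nonneg[OF t] by (simp add: trace_norm_def hilbert.op_trace_positive[OF t])
    qed
    moreover have "trace_norm ?H (\<I> (R n) T) \<le> (\<Sum>k<4. s k * out_prob M a (complex_of_real (1 / s k) *\<^sub>C P k) (R n))" for n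
      unfolding TP by (rule norm[OF Rb P])
    ultimately show ?thesis
      using tendsto_sandwich[OF always_eventually always_eventually tendsto_const lim4] by simp
  qed
  have tr: "op_trace ?H (\<I> UNIV T) = op_trace ?H T" if T: "T \<in> trace_class ?H" for T
  proof -
    obtain P s where P: "\<And>k. positive_trace ?H (P k) (s k)" and TP: "T = (\<Sum>k<4. \<i> ^ k *\<^sub>C P k)"
      by (rule hilbert.trace_class_cases[OF T]) (rule that)
    have "positive_trace ?H (\<I> UNIV (P k)) (s k)" for k
    proof (cases "s k = 0")
      case False
      then show ?thesis
        using trace[OF _ P, of UNIV k] out_prob_UNIV[OF hilbert.positive_trace_normalize(1)[OF P False]] by simp
    qed (use trace[OF _ P, of UNIV k] in simp)
    then show ?thesis
      unfolding TP comb[OF sets.top[of borel, unfolded space_borel] P]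
      using P by (simp add: hilbert.op_trace_combination[where s = s])
  qed
  have "DL_instrument ?H \<I>"
    unfolding DL_instrument_def
  proof (intro conjI allI ballI impI)
    fix \<Delta> :: "real set" and T assume "\<Delta> \<notin> sets borel \<or> T \<notin> trace_class ?H"
    then show "\<I> \<Delta> T = 0" using out by (auto simp: \<I>_def)
  next
    fix \<Delta> :: "real set" assume \<Delta>: "\<Delta> \<in> sets borel"
    show "linear_on_trace_class ?H (\<I> \<Delta>)" using lin[OF \<Delta>] \<I>[OF \<Delta>] by simp
    show "positive_on_trace_class ?H (\<I> \<Delta>)"
      using trace[OF \<Delta>] hilbert.trace_class_positive_trace hilbert.positive_trace_positive
      unfolding positive_on_trace_class_def by blast
    show "\<exists>C. \<forall>T\<in>trace_class ?H. trace_norm ?H (\<I> \<Delta> T) \<le> C * trace_norm ?H T" using bound[OF \<Delta>] by blast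
  qed (use additive tr in auto)
  moreover have "\<I> \<Delta> \<rho> = complex_of_real (out_prob M a \<rho> \<Delta>) *\<^sub>C out_state M a \<rho> \<Delta>"
    if "\<Delta> \<in> sets borel" "\<rho> \<in> density_ops ?H" for \<Delta> \<rho>
    using \<Phi>P[OF that(1)] that hilbert.cone_extension_density[OF that(2), of "raw_output a \<Delta>"]
    by (simp add: \<I> hilbert.density_iff raw_output_def)
  ultimately show ?thesis unfolding operational_distribution_def by blast
qed

text \<open>On density operators the values are prescribed, linearity spreads this over the trace
  class, and outside the domain both instruments are 0 by convention.\<close>

theorem operational_distribution_unique:
  assumes I: "operational_distribution M a \<I>" and J: "operational_distribution M a \<J>"
  shows "\<I> = \<J>"
proof (intro ext)
  fix \<Delta> T x
  let ?H = "space_of M a"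
  have "\<I> \<Delta> T = \<J> \<Delta> T"
  proof (cases "\<Delta> \<in> sets borel \<and> T \<in> trace_class ?H")
    case False
    then show ?thesis using I J unfolding operational_distribution_def DL_instrument_def by auto
  next
    case True
    then have \<Delta>: "\<Delta> \<in> sets borel" and T: "T \<in> trace_class ?H" by auto
    have lin: "linear_on_trace_class ?H (\<I> \<Delta>)" "linear_on_trace_class ?H (\<J> \<Delta>)"
      using I J \<Delta> unfolding operational_distribution_def DL_instrument_def by auto
    from T show ?thesis
    proof (induction rule: hilbert.trace_class_induct)
      case zero
      show ?case
        by (simp only: hilbert.linear_on_trace_class_zero[OF lin(1)] hilbert.linear_on_trace_class_zero[OF lin(2)])
    next
      case (density \<rho>)
      then show ?case using I J \<Delta> unfolding operational_distribution_def by simp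
    next
      case (add S T)
      then have "\<I> \<Delta> (S + T) = \<I> \<Delta> S + \<I> \<Delta> T" "\<J> \<Delta> (S + T) = \<J> \<Delta> S + \<J> \<Delta> T"
        using lin unfolding linear_on_trace_class_def by blast+
      then show ?case by (simp only: add)
    next
      case (scale c T)
      then have "\<I> \<Delta> (c *\<^sub>C T) = c *\<^sub>C \<I> \<Delta> T" "\<J> \<Delta> (c *\<^sub>C T) = c *\<^sub>C \<J> \<Delta> T"
        using lin unfolding linear_on_trace_class_def by blast+
      then show ?case by (simp only: scale)
    qed
  qed
  then show "\<I> \<Delta> T x = \<J> \<Delta> T x" by simp
qed

end

section \<open>Identifying a composite system with tuples of vectors\<close>

lemma unitarily_equivalent_pair:
  assumes H: "hilbert_space H" and K: "hilbert_space K" and eq: "unitarily_equivalent H K"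
  obtains U W where "unitary_pair H K U W"
proof -
  interpret H: hilbert_space H by (rule H)
  interpret K: hilbert_space K by (rule K)
  obtain U where U: "bij_betw U (hcarrier H) (hcarrier K)"
    and add: "\<And>x y. x \<in> hcarrier H \<Longrightarrow> y \<in> hcarrier H \<Longrightarrow> U (x + y) = U x + U y"
    and scale: "\<And>x c. x \<in> hcarrier H \<Longrightarrow> U (c *\<^sub>C x) = c *\<^sub>C U x"
    and inner: "\<And>x y. x \<in> hcarrier H \<Longrightarrow> y \<in> hcarrier H \<Longrightarrow> hinner K (U x) (U y) = hinner H x y"
    using eq unfolding unitarily_equivalent_def by blast
  have "unitary_pair H K U (inv_into (hcarrier H) U)"
    by unfold_locales
      (use U bij_betw_inv_into_left[OF U] bij_betw_inv_into_right[OF U] in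
        \<open>auto simp: add scale inner bij_betw_def inv_into_into\<close>)
  then show thesis by (rule that)
qed

text \<open>If \<open>H'\<close> is \<open>n\<close>-dimensional, then \<open>x \<mapsto> \<Sum>i<n. t (x i) f\<^sub>i\<close> is unitary from \<open>tensor_Cn H n\<close> onto any
  tensor product of \<open>H\<close> and \<open>H'\<close>, where the \<open>f\<^sub>i\<close> form an orthonormal basis of \<open>H'\<close>.\<close>

lemma tensor_product_unitary:
  assumes H: "hilbert_space H" and K: "hilbert_space K" and U: "unitary_pair (Cn n) H' U W"
    and tp: "tensor_product H H' K t"
  obtains V V' where "unitary_pair (tensor_Cn H n) K V V'"
    "\<And>x c. x \<in> hcarrier H \<Longrightarrow> c \<in> hcarrier (Cn n) \<Longrightarrow> V (tens_Cn x c) = t x (U c)"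
proof -
  interpret H: hilbert_space H by (rule H)
  interpret K: hilbert_space K by (rule K)
  interpret U: unitary_pair "Cn n" H' U W by (rule U)
  interpret Hn: hilbert_space "tensor_Cn H n" by (rule H.tensor_Cn_hilbert_space)
  have t_mem: "t x y \<in> hcarrier K" if "x \<in> hcarrier H" "y \<in> hcarrier H'" for x y
    using tp that unfolding tensor_product_def by blast
  have t_add: "t (x + x') y = t x y + t x' y" if "x \<in> hcarrier H" "x' \<in> hcarrier H" "y \<in> hcarrier H'" for x x' y
    using tp that unfolding tensor_product_def by blast
  have t_add': "t x (y + y') = t x y + t x y'" if "x \<in> hcarrier H" "y \<in> hcarrier H'" "y' \<in> hcarrier H'" for x y y'
    using tp that unfolding tensor_product_def by blast
  have t_scale: "t (c *\<^sub>C x) y = c *\<^sub>C t x y" "t x (c *\<^sub>C y) = c *\<^sub>C t x y"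
    if "x \<in> hcarrier H" "y \<in> hcarrier H'" for x y c
    using tp that unfolding tensor_product_def by blast+
  have t_inner: "hinner K (t x y) (t x' y') = hinner H x x' * hinner H' y y'"
    if "x \<in> hcarrier H" "x' \<in> hcarrier H" "y \<in> hcarrier H'" "y' \<in> hcarrier H'" for x x' y y'
    using tp that unfolding tensor_product_def by blast
  define f where "f i = U (unit_vec i)" for i
  have f: "f i \<in> hcarrier H'" if "i < n" for i using that by (simp add: f_def)
  have f_inner: "hinner H' (f i) (f j) = (if i = j then 1 else 0)" if "i < n" "j < n" for i j
    unfolding f_def U.U_inner[OF unit_vec_mem[OF that(1)] unit_vec_mem[OF that(2)]] Cn_inner_unit[OF that(1)] by simp
  define V where "V x = (\<Sum>i<n. t (x i) (f i))" for x
  have tf: "t (x i) (f i) \<in> hcarrier K" if "x \<in> hcarrier (tensor_Cn H n)" "i < n" for x i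
    using that f by (intro t_mem) simp_all
  have V_mem: "V x \<in> hcarrier K" if "x \<in> hcarrier (tensor_Cn H n)" for x
    unfolding V_def using that f by (intro K.sum_mem t_mem) auto
  have V_add: "V (x + x') = V x + V x'" if "x \<in> hcarrier (tensor_Cn H n)" "x' \<in> hcarrier (tensor_Cn H n)" for x x'
    unfolding V_def using that f by (simp add: t_add sum.distrib)
  have V_scale: "V (c *\<^sub>C x) = c *\<^sub>C V x" if "x \<in> hcarrier (tensor_Cn H n)" for x c
    unfolding V_def using that f by (simp add: t_scale complex_vector.scale_sum_right)
  have V_inner: "hinner K (V x) (V y) = hinner (tensor_Cn H n) x y"
    if x: "x \<in> hcarrier (tensor_Cn H n)" and y: "y \<in> hcarrier (tensor_Cn H n)" for x y
  proof -
    have "hinner K (V x) (V y) = (\<Sum>i<n. hinner K (t (x i) (f i)) (V y))"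
      unfolding V_def[of x] by (intro K.inner_sum_left V_mem[OF y] tf[OF x]) simp
    also have "\<dots> = (\<Sum>i<n. \<Sum>j<n. hinner K (t (x i) (f i)) (t (y j) (f j)))"
      unfolding V_def[of y] by (intro sum.cong refl K.inner_sum_right tf x y) simp_all
    also have "\<dots> = (\<Sum>i<n. \<Sum>j<n. if j = i then hinner H (x i) (y i) else 0)"
      using x y f by (intro sum.cong refl) (simp add: t_inner f_inner)
    also have "\<dots> = hinner (tensor_Cn H n) x y" by (simp add: H.tensor_Cn_inner)
    finally show ?thesis .
  qed
  have V_tens: "V (tens_Cn x c) = t x (U c)" if x: "x \<in> hcarrier H" and c: "c \<in> hcarrier (Cn n)" for x c
  proof -
    have fin: "t x (\<Sum>j\<in>J. c j *\<^sub>C f j) = (\<Sum>j\<in>J. c j *\<^sub>C t x (f j)) \<and> (\<Sum>j\<in>J. c j *\<^sub>C f j) \<in> hcarrier H'"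
      if "finite J" "J \<subseteq> {..<n}" for J
      using that
    proof (induction J)
      case empty
      have "t x 0 = 0" using t_scale(2)[OF x U.K.zero_mem, of 0] by simp
      then show ?case by simp
    next
      case (insert j J)
      then show ?case using x f by (simp add: t_add' t_scale)
    qed
    have "U c = U (\<Sum>j<n. c j *\<^sub>C unit_vec j)" by (rule arg_cong[OF Cn_expand[OF c]])
    also have "\<dots> = (\<Sum>j<n. U (c j *\<^sub>C unit_vec j))"
      by (intro U.U_sum Cn.scale_mem unit_vec_mem) simp_all
    also have "\<dots> = (\<Sum>j<n. c j *\<^sub>C f j)"
      unfolding f_def by (intro sum.cong refl U.U_scale unit_vec_mem) simp
    finally have "U c = (\<Sum>j<n. c j *\<^sub>C f j)" .
    then show ?thesis using fin[of "{..<n}"] x f by (simp add: V_def tens_Cn_def t_scale)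
  qed
  have V_norm: "hnorm K (V x) = hnorm (tensor_Cn H n) x" if "x \<in> hcarrier (tensor_Cn H n)" for x
    using V_inner[OF that that] by (simp add: hnorm_def)
  have V_diff: "V (x - x') = V x - V x'" if "x \<in> hcarrier (tensor_Cn H n)" "x' \<in> hcarrier (tensor_Cn H n)" for x x'
    using V_add[of "x - x'" x'] that by simp
  have inj: "inj_on V (hcarrier (tensor_Cn H n))"
  proof (rule inj_onI)
    fix x y assume *: "x \<in> hcarrier (tensor_Cn H n)" "y \<in> hcarrier (tensor_Cn H n)" "V x = V y"
    then have "hnorm (tensor_Cn H n) (x - y) = 0" using V_norm[of "x - y"] V_diff[of x y] by simp
    then show "x = y" using Hn.hnorm_eq_zero[of "x - y"] * by simp
  qed
  \<comment> \<open>The range of the isometry \<open>V\<close> is a subspace containing all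
    elementary tensors, hence dense; completeness of \<open>tensor_Cn H n\<close> makes it
    closed.\<close>
  have surj: "k \<in> V ` hcarrier (tensor_Cn H n)" if k: "k \<in> hcarrier K" for k
  proof -
    let ?G = "{t x y | x y. x \<in> hcarrier H \<and> y \<in> hcarrier H'}"
    have "?G \<subseteq> V ` hcarrier (tensor_Cn H n)"
    proof
      fix g assume "g \<in> ?G"
      then obtain x y where xy: "x \<in> hcarrier H" "y \<in> hcarrier H'" "g = t x y" by blast
      \<comment> \<open>\<open>W y\<close> is the coordinate vector of \<open>y\<close> with respect
        to the basis \<open>f\<close>.\<close>
      then have "g = V (tens_Cn x (W y))" by (simp add: V_tens)
      then show "g \<in> V ` hcarrier (tensor_Cn H n)" using xy by simp
    qed
    moreover have "complex_vector.subspace (V ` hcarrier (tensor_Cn H n))"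
      unfolding complex_vector.subspace_def
    proof (intro conjI ballI allI)
      show "0 \<in> V ` hcarrier (tensor_Cn H n)"
        using V_scale[OF Hn.zero_mem, of 0] by (intro image_eqI[of _ _ 0]) simp_all
    next
      fix u v assume "u \<in> V ` hcarrier (tensor_Cn H n)" "v \<in> V ` hcarrier (tensor_Cn H n)"
      then obtain x y where xy: "x \<in> hcarrier (tensor_Cn H n)" "y \<in> hcarrier (tensor_Cn H n)" "u = V x" "v = V y"
        by blast
      show "u + v \<in> V ` hcarrier (tensor_Cn H n)"
        unfolding xy(3,4) V_add[OF xy(1,2), symmetric] using xy(1,2) by (intro imageI Hn.add_mem)
    next
      fix c u assume "u \<in> V ` hcarrier (tensor_Cn H n)"
      then obtain x where x: "x \<in> hcarrier (tensor_Cn H n)" "u = V x" by blast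
      show "c *\<^sub>C u \<in> V ` hcarrier (tensor_Cn H n)"
        unfolding x(2) V_scale[OF x(1), symmetric] using x(1) by (intro imageI Hn.scale_mem)
    qed
    ultimately have span: "complex_vector.span ?G \<subseteq> V ` hcarrier (tensor_Cn H n)"
      by (rule complex_vector.span_minimal)
    have dense: "dense_in K (complex_vector.span ?G)" using tp unfolding tensor_product_def by blast
    have approx: "\<exists>x\<in>hcarrier (tensor_Cn H n). hnorm K (k - V x) < \<epsilon>" if \<epsilon>: "\<epsilon> > 0" for \<epsilon>
    proof -
      obtain y where "y \<in> complex_vector.span ?G" "hnorm K (k - y) < \<epsilon>"
        using dense k \<epsilon> unfolding dense_in_def by blast
      then show ?thesis using span by blast
    qed
    have "\<exists>x. x \<in> hcarrier (tensor_Cn H n) \<and> hnorm K (k - V x) < inverse (real (Suc m))" for m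
      using approx[of "inverse (real (Suc m))"] by auto
    then obtain X where X: "\<And>m. X m \<in> hcarrier (tensor_Cn H n)"
      and Xk: "\<And>m. hnorm K (k - V (X m)) < inverse (real (Suc m))" by metis
    have conv: "K.converges (\<lambda>m. V (X m)) k"
      unfolding K.converges_def
    proof (intro conjI allI V_mem X k)
      have "norm (hnorm K (V (X m) - k)) \<le> inverse (real (Suc m))" for m
        using Xk[of m] K.hnorm_minus_commute[OF k V_mem[OF X, of m]] V_mem[OF X, of m] k by simp
      then show "(\<lambda>m. hnorm K (V (X m) - k)) \<longlonglongrightarrow> 0"
        by (rule Lim_null_comparison[OF always_eventually[OF allI] LIMSEQ_inverse_real_of_nat])
    qed
    \<comment> \<open>The preimages of a convergent sequence are Cauchy because \<open>V\<close>
      preserves norms.\<close>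
    have "\<exists>l\<in>hcarrier (tensor_Cn H n). (\<lambda>m. hnorm (tensor_Cn H n) (X m - l)) \<longlonglongrightarrow> 0"
    proof (rule Hn.Cauchy_converges[OF X])
      fix \<epsilon> :: real assume \<epsilon>: "\<epsilon> > 0"
      then obtain N where N: "inverse (real (Suc N)) < \<epsilon> / 2" using reals_Archimedean[of "\<epsilon> / 2"] by auto
      have "hnorm (tensor_Cn H n) (X m - X p) < \<epsilon>" if "m \<ge> N" "p \<ge> N" for m p
      proof -
        have "inverse (real (Suc m)) \<le> inverse (real (Suc N))" "inverse (real (Suc p)) \<le> inverse (real (Suc N))"
          using that by (simp_all add: le_imp_inverse_le)
        moreover have "hnorm (tensor_Cn H n) (X m - X p) = hnorm K (V (X m) - V (X p))"
          using V_norm[of "X m - X p"] X by (simp add: V_diff)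
        moreover have "hnorm K (V (X m) - V (X p)) \<le> hnorm K (V (X m) - k) + hnorm K (k - V (X p))"
          using X V_mem k by (intro K.triangle_diff) auto
        moreover have "hnorm K (V (X m) - k) = hnorm K (k - V (X m))"
          by (rule K.hnorm_minus_commute[OF V_mem[OF X] k])
        ultimately show ?thesis using Xk[of m] Xk[of p] N by argo
      qed
      then show "\<exists>N. \<forall>m\<ge>N. \<forall>p\<ge>N. hnorm (tensor_Cn H n) (X m - X p) < \<epsilon>" by blast
    qed
    then obtain l where l: "l \<in> hcarrier (tensor_Cn H n)" "(\<lambda>m. hnorm (tensor_Cn H n) (X m - l)) \<longlonglongrightarrow> 0" by blast
    have "hnorm K (V (X m) - V l) = hnorm (tensor_Cn H n) (X m - l)" for m
      using V_norm[of "X m - l"] X l by (simp add: V_diff)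
    then have "K.converges (\<lambda>m. V (X m)) (V l)"
      unfolding K.converges_def using l X V_mem by simp
    then have "k = V l" using conv K.converges_unique by blast
    then show ?thesis using l by blast
  qed
  have "unitary_pair (tensor_Cn H n) K V (inv_into (hcarrier (tensor_Cn H n)) V)"
  proof unfold_locales
    fix y assume "y \<in> hcarrier K"
    then have y: "y \<in> V ` hcarrier (tensor_Cn H n)" by (rule surj)
    show "inv_into (hcarrier (tensor_Cn H n)) V y \<in> hcarrier (tensor_Cn H n)" by (rule inv_into_into[OF y])
    show "V (inv_into (hcarrier (tensor_Cn H n)) V y) = y" by (rule f_inv_into_f[OF y])
  next
    show "inv_into (hcarrier (tensor_Cn H n)) V (V x) = x" if "x \<in> hcarrier (tensor_Cn H n)" for x
      using that by (rule inv_into_f_f[OF inj])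
  qed (fact V_mem V_add V_scale V_inner)+
  then show thesis using V_tens that by blast
qed

text \<open>The definite description \<open>tensor_op\<close> on the composite is resolved by
  pulling a competitor back to \<open>tensor_Cn H n\<close>, where \<open>tens_Cn_ext\<close> shows
  that values on elementary tensors determine a bounded operator.\<close>

lemma tensor_op_transport:
  assumes H: "hilbert_space H" and U: "unitary_pair (Cn n) H' U W" and V: "unitary_pair (tensor_Cn H n) K V V'"
    and tens: "\<And>x c. x \<in> hcarrier H \<Longrightarrow> c \<in> hcarrier (Cn n) \<Longrightarrow> V (tens_Cn x c) = t x (U c)"
    and T: "T \<in> bounded_ops H" and S: "S \<in> bounded_ops (Cn n)"
  shows "tensor_op H H' K t T (unitary_pair.transport H' U W S) =
    unitary_pair.transport K V V' (hilbert_space.tensor_matrix H n T S)"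
proof -
  interpret H: hilbert_space H by (rule H)
  interpret U: unitary_pair "Cn n" H' U W by (rule U)
  interpret V: unitary_pair "tensor_Cn H n" K V V' by (rule V)
  interpret V': unitary_pair K "tensor_Cn H n" V' V by (rule V.inverse)
  let ?R = "V.transport (H.tensor_matrix n T S)"
  have R: "?R \<in> bounded_ops K" by (rule V.transport_bounded[OF H.tensor_matrix_bounded[OF T]])
  have Rt: "?R (t x y) = t (T x) (U.transport S y)" if x: "x \<in> hcarrier H" and y: "y \<in> hcarrier H'" for x y
  proof -
    have txy: "t x y = V (tens_Cn x (W y))" using x y by (simp add: tens)
    have m: "tens_Cn x (W y) \<in> hcarrier (tensor_Cn H n)" using x y by simp
    have "?R (t x y) = V (tens_Cn (T x) (S (W y)))"
      unfolding txy using m x y T S by (simp add: H.tensor_matrix_tens)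
    then show ?thesis using x y T S by (simp add: tens)
  qed
  show ?thesis
    unfolding tensor_op_def
  proof (rule the_equality)
    show "?R \<in> bounded_ops K \<and> (\<forall>x\<in>hcarrier H. \<forall>y\<in>hcarrier H'. ?R (t x y) = t (T x) (U.transport S y))"
      using R Rt by blast
    fix R' assume R': "R' \<in> bounded_ops K \<and> (\<forall>x\<in>hcarrier H. \<forall>y\<in>hcarrier H'. R' (t x y) = t (T x) (U.transport S y))"
    have "V'.transport R' = V'.transport ?R"
    proof (rule H.tens_Cn_ext)
      fix x c assume "x \<in> hcarrier H" "c \<in> hcarrier (Cn n)"
      then show "V'.transport R' (tens_Cn x c) = V'.transport ?R (tens_Cn x c)"
        using R' Rt[of x "U c"] by (simp add: tens del: V.transport_apply)
    qed (use R R' V'.transport_bounded in auto)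
    then have "V.transport (V'.transport R') = V.transport (V'.transport ?R)" by simp
    then show "R' = ?R" using V'.transport_inverse R R' by simp
  qed
qed

section \<open>Complete positivity\<close>

context measurement_theory
begin

text \<open>The map \<open>\<Psi>\<close> is the operational distribution of the extended apparatus,
  conjugated from the composite system to \<open>tensor_Cn\<close>. Its positivity on entangled
  operators is part of being an instrument; the postulate serves to compute it on product
  states.\<close>

theorem operational_distribution_completely_positive:
  assumes obs: "observables_measurable M" and mix: "mixing_law M" and ext: "extendability_postulate M"
    and I: "operational_distribution M a \<I>" and \<Delta>: "\<Delta> \<in> sets borel"
  shows "completely_positive (space_of M a) (\<I> \<Delta>)"
  unfolding completely_positive_def
proof
  fix n
  let ?H = "space_of M a"
  interpret Cn: hilbert_space "Cn n" by (rule Cn_hilbert_space)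
  interpret Hn: hilbert_space "tensor_Cn ?H n" by (rule hilbert.tensor_Cn_hilbert_space)
  have lin: "linear_on_trace_class ?H (\<I> \<Delta>)"
    using I \<Delta> unfolding operational_distribution_def DL_instrument_def by blast
  have \<I>_tc: "\<I> \<Delta> T \<in> trace_class ?H" if "T \<in> trace_class ?H" for T
    using lin that unfolding linear_on_trace_class_def by blast
  have \<I>_bd: "\<I> \<Delta> T \<in> bounded_ops ?H" if "T \<in> trace_class ?H" for T
    using \<I>_tc[OF that] hilbert.trace_class_bounded by blast
  have tensor: "tensor_op ?H (Cn n) (tensor_Cn ?H n) tens_Cn T S = hilbert_space.tensor_matrix ?H n T S"
    if "T \<in> bounded_ops ?H" "S \<in> trace_class (Cn n)" for T S
    using that Cn.trace_class_bounded by (intro hilbert.tensor_op_Cn)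
  show "\<exists>\<Psi>. tensor_id_Cn ?H n (\<I> \<Delta>) \<Psi> \<and> positive_on_trace_class (tensor_Cn ?H n) \<Psi>"
  proof (cases "n = 0")
    \<comment> \<open>\<open>Cn 0\<close> is the zero space, for which no isolated system is
      provided. All operators on the tensor product vanish there, so the zero map serves.\<close>
    case True
    have "hilbert_space.tensor_matrix ?H n T S = 0" for T S
      using True by (simp add: hilbert.tensor_matrix_def fun_eq_iff)
    then have "tensor_id_Cn ?H n (\<I> \<Delta>) (\<lambda>_. 0)"
      using tensor \<I>_bd Hn.trace_class_zero unfolding tensor_id_Cn_def linear_on_trace_class_def by simp
    moreover have "positive_on_trace_class (tensor_Cn ?H n) (\<lambda>_. 0)"
      unfolding positive_on_trace_class_def using Hn.positive_zero by blast
    ultimately show ?thesis by blast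
  next
    case False
    have "unit_vec 0 \<in> hcarrier (Cn n)" "unit_vec 0 \<noteq> 0" using False by (auto simp: fun_eq_iff)
    then have "hcarrier (Cn n) \<noteq> {0}" by blast
    then obtain S' where S': "isolated M a S'" and eq: "unitarily_equivalent (hilb M S') (Cn n)"
      using ext Cn_separable_hilbert_space unfolding extendability_postulate_def isolated_systems_exist_def by meson
    let ?H' = "hilb M S'" and ?K = "hilb M (compose M (system_of M a) S')" and ?t = "tens M (system_of M a) S'"
    obtain a' where a': "system_of M a' = compose M (system_of M a) S'"
      and prob: "\<And>\<rho> \<rho>'. \<rho> \<in> density_ops ?H \<Longrightarrow> \<rho>' \<in> density_ops ?H' \<Longrightarrow>
        out_prob M a' (tensor_op ?H ?H' ?K ?t \<rho> \<rho>') \<Delta> = out_prob M a \<rho> \<Delta>"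
      and state: "\<And>\<rho> \<rho>'. \<rho> \<in> density_ops ?H \<Longrightarrow> \<rho>' \<in> density_ops ?H' \<Longrightarrow> out_prob M a \<rho> \<Delta> > 0 \<Longrightarrow>
        out_state M a' (tensor_op ?H ?H' ?K ?t \<rho> \<rho>') \<Delta> = tensor_op ?H ?H' ?K ?t (out_state M a \<rho> \<Delta>) \<rho>'"
      using ext S' \<Delta> unfolding extendability_postulate_def by meson
    obtain W U where "unitary_pair ?H' (Cn n) W U"
      by (rule unitarily_equivalent_pair[OF hilbert.hilbert_space_axioms Cn_hilbert_space eq]) (rule that)
    then have U: "unitary_pair (Cn n) ?H' U W" by (rule unitary_pair.inverse)
    obtain V V' where V: "unitary_pair (tensor_Cn ?H n) ?K V V'"
      and tens: "\<And>x c. x \<in> hcarrier ?H \<Longrightarrow> c \<in> hcarrier (Cn n) \<Longrightarrow> V (tens_Cn x c) = ?t x (U c)"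
      by (rule tensor_product_unitary[OF hilbert.hilbert_space_axioms hilbert.hilbert_space_axioms U composite[OF S']])
        (rule that)
    interpret U: unitary_pair "Cn n" ?H' U W by (rule U)
    interpret V: unitary_pair "tensor_Cn ?H n" ?K V V' by (rule V)
    interpret V': unitary_pair ?K "tensor_Cn ?H n" V' V by (rule V.inverse)
    let ?m = "hilbert_space.tensor_matrix ?H n"
    have tensor': "tensor_op ?H ?H' ?K ?t T (U.transport S) = V.transport (?m T S)"
      if "T \<in> bounded_ops ?H" "S \<in> bounded_ops (Cn n)" for T S
      by (rule tensor_op_transport[OF hilbert.hilbert_space_axioms U V _ that]) (rule tens)
    \<comment> \<open>Here the mixing law is used for the composite system, since \<open>a'\<close>
      is an apparatus measuring it.\<close>
    obtain \<J> where J: "operational_distribution M a' \<J>" using operational_distribution_exists[OF obs mix] by blast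
    have J_lin: "linear_on_trace_class ?K (\<J> \<Delta>)" and J_pos: "positive_on_trace_class ?K (\<J> \<Delta>)"
      and J_state: "\<And>\<rho>. \<rho> \<in> density_ops ?K \<Longrightarrow> \<J> \<Delta> \<rho> = complex_of_real (out_prob M a' \<rho> \<Delta>) *\<^sub>C out_state M a' \<rho> \<Delta>"
      using J \<Delta> a' unfolding operational_distribution_def DL_instrument_def by auto
    define \<Psi> where "\<Psi> T = V'.transport (\<J> \<Delta> (V.transport T))" for T
    have J_tc: "\<J> \<Delta> T \<in> trace_class ?K" if "T \<in> trace_class ?K" for T
      using J_lin that unfolding linear_on_trace_class_def by blast
    have \<Psi>_tc: "\<Psi> T \<in> trace_class (tensor_Cn ?H n)" if "T \<in> trace_class (tensor_Cn ?H n)" for T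
      unfolding \<Psi>_def by (intro V'.transport_trace_class J_tc V.transport_trace_class that)
    have \<Psi>_add: "\<Psi> (S + T) = \<Psi> S + \<Psi> T" if S: "S \<in> trace_class (tensor_Cn ?H n)" and T: "T \<in> trace_class (tensor_Cn ?H n)" for S T
    proof -
      note VS = V.transport_trace_class[OF S] and VT = V.transport_trace_class[OF T]
      have "\<J> \<Delta> (V.transport S + V.transport T) = \<J> \<Delta> (V.transport S) + \<J> \<Delta> (V.transport T)"
        using J_lin VS VT unfolding linear_on_trace_class_def by blast
      then show ?thesis
        unfolding \<Psi>_def V.transport_add[OF Hn.trace_class_bounded[OF S] Hn.trace_class_bounded[OF T]]
        using V'.transport_add[OF hilbert.trace_class_bounded[OF J_tc[OF VS]] hilbert.trace_class_bounded[OF J_tc[OF VT]]]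
        by metis
    qed
    have \<Psi>_scale: "\<Psi> (c *\<^sub>C T) = c *\<^sub>C \<Psi> T" if T: "T \<in> trace_class (tensor_Cn ?H n)" for c T
    proof -
      note VT = V.transport_trace_class[OF T]
      have "\<J> \<Delta> (c *\<^sub>C V.transport T) = c *\<^sub>C \<J> \<Delta> (V.transport T)"
        using J_lin VT unfolding linear_on_trace_class_def by blast
      then show ?thesis
        unfolding \<Psi>_def V.transport_scale[OF Hn.trace_class_bounded[OF T]]
        using V'.transport_scale[OF hilbert.trace_class_bounded[OF J_tc[OF VT]]] by metis
    qed
    have \<Psi>_lin: "linear_on_trace_class (tensor_Cn ?H n) \<Psi>"
      unfolding linear_on_trace_class_def using \<Psi>_tc \<Psi>_add \<Psi>_scale by blast
    have \<Psi>_zero: "\<Psi> 0 = 0" by (rule Hn.linear_on_trace_class_zero[OF \<Psi>_lin])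
    \<comment> \<open>Induction in each factor in turn reduces the claim to a product of states,
      which is a state.\<close>
    have m_tc: "?m T S \<in> trace_class (tensor_Cn ?H n)" if T: "T \<in> trace_class ?H" and S: "S \<in> trace_class (Cn n)" for T S
      using S
    proof (induction rule: Cn.trace_class_induct)
      case zero
      show ?case unfolding hilbert.tensor_matrix_zero_right by (rule Hn.trace_class_zero)
    next
      case (density \<sigma>)
      note \<sigma> = density
      from T show ?case
      proof (induction rule: hilbert.trace_class_induct)
        case zero
        show ?case unfolding hilbert.tensor_matrix_zero_left by (rule Hn.trace_class_zero)
      next
        case (density \<rho>)
        then show ?case using hilbert.tensor_matrix_density[OF density \<sigma>] unfolding density_ops_def by blast
      next
        case (add S T)
        then show ?case unfolding hilbert.tensor_matrix_add_left by (intro Hn.trace_class_add)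
      next
        case (scale c T)
        then show ?case unfolding hilbert.tensor_matrix_scale_left by (intro Hn.trace_class_scale)
      qed
    next
      case (add S S')
      then show ?case unfolding hilbert.tensor_matrix_add_right by (intro Hn.trace_class_add)
    next
      case (scale c S)
      then show ?case unfolding hilbert.tensor_matrix_scale_right by (intro Hn.trace_class_scale)
    qed
    have density: "\<Psi> (?m \<rho> \<sigma>) = ?m (\<I> \<Delta> \<rho>) \<sigma>" if \<rho>: "\<rho> \<in> density_ops ?H" and \<sigma>: "\<sigma> \<in> density_ops (Cn n)" for \<rho> \<sigma>
    proof -
      have bd: "\<rho> \<in> bounded_ops ?H" "\<sigma> \<in> bounded_ops (Cn n)"
        using \<rho> \<sigma> hilbert.trace_class_bounded Cn.trace_class_bounded unfolding density_ops_def by blast+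
      let ?\<sigma> = "U.transport \<sigma>"
      have \<sigma>': "?\<sigma> \<in> density_ops ?H'" by (rule U.transport_density[OF \<sigma>])
      have eq: "V.transport (?m \<rho> \<sigma>) = tensor_op ?H ?H' ?K ?t \<rho> ?\<sigma>" using tensor'[OF bd] by simp
      have dens: "V.transport (?m \<rho> \<sigma>) \<in> density_ops ?K"
        by (rule V.transport_density[OF hilbert.tensor_matrix_density[OF \<rho> \<sigma>]])
      have I\<rho>: "\<I> \<Delta> \<rho> = complex_of_real (out_prob M a \<rho> \<Delta>) *\<^sub>C out_state M a \<rho> \<Delta>"
        using I \<Delta> \<rho> unfolding operational_distribution_def by blast
      have J\<rho>: "\<J> \<Delta> (V.transport (?m \<rho> \<sigma>)) =
          complex_of_real (out_prob M a \<rho> \<Delta>) *\<^sub>C out_state M a' (tensor_op ?H ?H' ?K ?t \<rho> ?\<sigma>) \<Delta>"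
        unfolding J_state[OF dens] unfolding eq prob[OF \<rho> \<sigma>'] ..
      show ?thesis
      proof (cases "out_prob M a \<rho> \<Delta> = 0")
        \<comment> \<open>The postulate says nothing about the output state here, but the
          probability factor annihilates both sides.\<close>
        case True
        then have "\<J> \<Delta> (V.transport (?m \<rho> \<sigma>)) = 0" "\<I> \<Delta> \<rho> = 0" using J\<rho> I\<rho> by simp_all
        then show ?thesis unfolding \<Psi>_def by (simp only: V'.transport_zero hilbert.tensor_matrix_zero_left)
      next
        case False
        then have pos: "out_prob M a \<rho> \<Delta> > 0" using out_prob_nonneg[of a \<rho> \<Delta>] by simp
        have bo: "out_state M a \<rho> \<Delta> \<in> bounded_ops ?H"
          using out_state[OF \<rho> \<Delta> pos] hilbert.trace_class_bounded unfolding density_ops_def by blast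
        have "\<J> \<Delta> (V.transport (?m \<rho> \<sigma>)) = V.transport (?m (\<I> \<Delta> \<rho>) \<sigma>)"
          unfolding J\<rho> I\<rho> state[OF \<rho> \<sigma>' pos] tensor'[OF bo bd(2)] hilbert.tensor_matrix_scale_left
            V.transport_scale[OF hilbert.tensor_matrix_bounded[OF bo]] ..
        then show ?thesis
          unfolding \<Psi>_def using V.transport_inverse[OF hilbert.tensor_matrix_bounded[OF \<I>_bd]] \<rho>
          by (simp add: density_ops_def)
      qed
    qed
    \<comment> \<open>Both sides are linear in \<open>S\<close> for fixed \<open>T\<close> and
      linear in \<open>T\<close> for fixed \<open>S\<close>, so two nested inductions bring the
      identity down to product states.\<close>
    have product: "\<Psi> (?m T S) = ?m (\<I> \<Delta> T) S" if T: "T \<in> trace_class ?H" and S: "S \<in> trace_class (Cn n)" for T S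
      using S
    proof (induction rule: Cn.trace_class_induct)
      case zero
      show ?case unfolding hilbert.tensor_matrix_zero_right by (rule \<Psi>_zero)
    next
      case (density \<sigma>)
      note \<sigma> = density
      then have \<sigma>_tc: "\<sigma> \<in> trace_class (Cn n)" by (simp add: density_ops_def)
      from T show ?case
      proof (induction rule: hilbert.trace_class_induct)
        case zero
        show ?case
          unfolding hilbert.linear_on_trace_class_zero[OF lin] hilbert.tensor_matrix_zero_left by (rule \<Psi>_zero)
      next
        case (density \<rho>)
        then show ?case using \<sigma> by (rule \<open>\<And>\<sigma> \<rho>. \<rho> \<in> density_ops ?H \<Longrightarrow> \<sigma> \<in> density_ops (Cn n) \<Longrightarrow> \<Psi> (?m \<rho> \<sigma>) = ?m (\<I> \<Delta> \<rho>) \<sigma>\<close>)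
      next
        case (add S T)
        have "\<I> \<Delta> (S + T) = \<I> \<Delta> S + \<I> \<Delta> T" using lin add(1,2) unfolding linear_on_trace_class_def by blast
        then show ?case
          unfolding hilbert.tensor_matrix_add_left \<Psi>_add[OF m_tc[OF add(1) \<sigma>_tc] m_tc[OF add(2) \<sigma>_tc]] add(3,4)
          by (simp only: hilbert.tensor_matrix_add_left)
      next
        case (scale c T)
        have "\<I> \<Delta> (c *\<^sub>C T) = c *\<^sub>C \<I> \<Delta> T" using lin scale(1) unfolding linear_on_trace_class_def by blast
        then show ?case
          unfolding hilbert.tensor_matrix_scale_left \<Psi>_scale[OF m_tc[OF scale(1) \<sigma>_tc]] scale(2)
          by (simp only: hilbert.tensor_matrix_scale_left)
      qed
    next
      case (add S S')
      then show ?case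
        unfolding hilbert.tensor_matrix_add_right \<Psi>_add[OF m_tc[OF T add(1)] m_tc[OF T add(2)]] by (simp only:)
    next
      case (scale c S)
      then show ?case
        unfolding hilbert.tensor_matrix_scale_right \<Psi>_scale[OF m_tc[OF T scale(1)]] by (simp only:)
    qed
    have "tensor_id_Cn ?H n (\<I> \<Delta>) \<Psi>"
      unfolding tensor_id_Cn_def
    proof (intro conjI \<Psi>_lin ballI)
      fix T S assume T: "T \<in> trace_class ?H" and S: "S \<in> trace_class (Cn n)"
      show "\<Psi> (tensor_op ?H (Cn n) (tensor_Cn ?H n) tens_Cn T S) =
          tensor_op ?H (Cn n) (tensor_Cn ?H n) tens_Cn (\<I> \<Delta> T) S"
        unfolding tensor[OF hilbert.trace_class_bounded[OF T] S] tensor[OF \<I>_bd[OF T] S] by (rule product[OF T S])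
    qed
    moreover have "positive_on_trace_class (tensor_Cn ?H n) \<Psi>"
      unfolding positive_on_trace_class_def \<Psi>_def
      using J_pos V.transport_trace_class V.transport_positive V'.transport_positive
      unfolding positive_on_trace_class_def by blast
    ultimately show ?thesis by blast
  qed
qed

end

theorem mainTheorem11:
  fixes M :: "('s, 'a, 'v::complex_vector) apparatus_theory"
  assumes "measurement_theory M"
    and "observables_measurable M"
    and "mixing_law M"
    and "extendability_postulate M"
  shows "(\<forall>a. \<exists>!\<I>. operational_distribution M a \<I>) \<and>
    (\<forall>a \<I>. operational_distribution M a \<I> \<longrightarrow> CP_instrument (space_of M a) \<I>)"
proof (intro conjI allI impI)
  interpret measurement_theory M by (rule assms(1))
  show "\<exists>!\<I>. operational_distribution M a \<I>" for a
    using operational_distribution_exists[OF assms(2,3)] operational_distribution_unique by blast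
  show "CP_instrument (space_of M a) \<I>" if "operational_distribution M a \<I>" for a \<I>
    using that operational_distribution_completely_positive[OF assms(2-4) that]
    unfolding CP_instrument_def operational_distribution_def by blast
qed

end
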